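(* Let $\Omega=(a,b)\subset\mathbb{R}$ be a bounded open interval, $1<p<\infty$, $q=\frac{p}{p-1}$, $\alpha,\beta>0$ and $f\in L^2(\Omega)$. A pair $(w,u)\in L^p(\Omega)\times \mathrm{BV}(\Omega)$ is a solution of $$\min_{u\in \mathrm{BV}(\Omega),\ w\in L^p(\Omega)}\ \frac12\|f-u\|_{L^2(\Omega)}^2+\alpha\|Du-w\|_{\mathcal M}+\beta\|w\|_{L^p(\Omega)}$$ if and only if there exists a function $\phi\in H_0^1(\Omega)$ such that $$\phi'=u-f,\qquad \phi\in\alpha\,\mathrm{Sgn}(Du-w),$$ and $$\begin{cases}\phi\in\{\tilde\phi\in L^q(\Omega):\|\tilde\phi\|_{L^q(\Omega)}\le\beta\}&\text{if } w=0,\\[3pt] \phi=\beta\,\dfrac{|w|^{p-2}w}{\|w\|_{L^p(\Omega)}^{p-1}}&\text{if } w\ne0.\end{cases}$$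
   Context: $Du$ is the distributional derivative of $u\in\mathrm{BV}(\Omega)$ (a finite Radon measure), $w$ is identified with the measure $w\,\mathcal L^1$, and $\|\mu\|_{\mathcal M}=|\mu|(\Omega)$ is the Radon norm. For a finite signed Radon measure $\mu$ on $\Omega$ with polar decomposition $\mu=\mathrm{sgn}(\mu)|\mu|$, the set-valued sign is $$\mathrm{Sgn}(\mu)=\{v\in L^\infty(\Omega)\cap L^\infty(\Omega,|\mu|):\ \|v\|_\infty\le1,\ v=\mathrm{sgn}(\mu)\ |\mu|\text{-a.e.}\}.$$ Functions $\phi\in H_0^1(\Omega)$ are identified with their continuous representatives. The last conditions (for $w=0$ and $w\neq0$) and $\phi'=u-f$ hold almost everywhere. *)

theory Defs
  imports "HOL-Analysis.Analysis" "HOL-Probability.Essential_Supremum"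
begin

text \<open>
  Functions on an open set \<Omega> of reals are represented by functions \<open>real \<Rightarrow> real\<close> whose values
  outside \<Omega> play no role; elements of Lebesgue spaces are represented by arbitrary
  representatives, so that equality of classes becomes equality almost everywhere.
\<close>

section \<open>Lebesgue spaces\<close>

definition Lp :: "'a measure \<Rightarrow> real \<Rightarrow> ('a \<Rightarrow> real) set" where
  "Lp M p = {g \<in> borel_measurable M. integrable M (\<lambda>x. \<bar>g x\<bar> powr p)}"

definition Lp_norm :: "'a measure \<Rightarrow> real \<Rightarrow> ('a \<Rightarrow> real) \<Rightarrow> real" where
  "Lp_norm M p g = (\<integral>x. \<bar>g x\<bar> powr p \<partial>M) powr (1 / p)"

definition Linf_norm :: "'a measure \<Rightarrow> ('a \<Rightarrow> real) \<Rightarrow> ereal" where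
  "Linf_norm M g = esssup M (\<lambda>x. ereal \<bar>g x\<bar>)"

definition Linf :: "'a measure \<Rightarrow> ('a \<Rightarrow> real) set" where
  "Linf M = {g \<in> borel_measurable M. Linf_norm M g < \<infinity>}"

section \<open>Finite signed measures\<close>

text \<open>
  Of a parameter \<open>M\<close> only the space and the sets matter in this section, not its measure.
  A finite signed measure is a real-valued set function; it is set to zero off the sigma-algebra
  (as \<^const>\<open>emeasure\<close> is), so that two signed measures are equal as soon as they agree
  on measurable sets.  On the Borel sets of an open interval every finite signed measure is Radon.
\<close>

definition signed_measure :: "'a measure \<Rightarrow> ('a set \<Rightarrow> real) \<Rightarrow> bool" where
  "signed_measure M \<mu> \<longleftrightarrow>
     \<mu> {} = 0 \<and>
     (\<forall>A :: nat \<Rightarrow> 'a set. range A \<subseteq> sets M \<longrightarrow> disjoint_family A \<longrightarrow>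
        (\<lambda>n. \<mu> (A n)) sums \<mu> (\<Union>n. A n)) \<and>
     (\<forall>A. A \<notin> sets M \<longrightarrow> \<mu> A = 0)"

definition total_variation :: "'a measure \<Rightarrow> ('a set \<Rightarrow> real) \<Rightarrow> 'a measure" where
  "total_variation M \<mu> = measure_of (space M) (sets M)
     (\<lambda>A. SUP P \<in> {P. finite P \<and> P \<subseteq> sets M \<and> partition_on A P}. \<Sum>B\<in>P. ennreal \<bar>\<mu> B\<bar>)"

text \<open>The density of the polar decomposition; it is determined up to null sets of the total variation.\<close>

definition sgn_measure :: "'a measure \<Rightarrow> ('a set \<Rightarrow> real) \<Rightarrow> 'a \<Rightarrow> real" where
  "sgn_measure M \<mu> = (SOME \<sigma>. \<sigma> \<in> borel_measurable (total_variation M \<mu>) \<and>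
     (AE x in total_variation M \<mu>. \<bar>\<sigma> x\<bar> = 1) \<and>
     (\<forall>A \<in> sets M. \<mu> A = (LINT x:A|total_variation M \<mu>. \<sigma> x)))"

definition signed_integral :: "'a measure \<Rightarrow> ('a set \<Rightarrow> real) \<Rightarrow> ('a \<Rightarrow> real) \<Rightarrow> real" where
  "signed_integral M \<mu> g = (\<integral>x. g x * sgn_measure M \<mu> x \<partial>total_variation M \<mu>)"

abbreviation borel_on :: "real set \<Rightarrow> real measure" where
  "borel_on \<Omega> \<equiv> restrict_space borel \<Omega>"

definition Radon_norm :: "real set \<Rightarrow> (real set \<Rightarrow> real) \<Rightarrow> real" where
  "Radon_norm \<Omega> \<mu> = measure (total_variation (borel_on \<Omega>) \<mu>) \<Omega>"

text \<open>The signed measure with density \<open>w\<close> with respect to Lebesgue measure.\<close>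

definition lebesgue_density :: "real set \<Rightarrow> (real \<Rightarrow> real) \<Rightarrow> real set \<Rightarrow> real" where
  "lebesgue_density \<Omega> w A = (if A \<in> sets (borel_on \<Omega>) then LINT x:A|lebesgue_on \<Omega>. w x else 0)"

text \<open>
  The elements of \<open>Sgn\<close> are actual functions, not classes: their values matter both Lebesgue-a.e. and
  a.e. for the total variation.  The completion makes the second measurability requirement the usual
  one up to null sets.
\<close>

definition Sgn :: "real set \<Rightarrow> (real set \<Rightarrow> real) \<Rightarrow> (real \<Rightarrow> real) set" where
  "Sgn \<Omega> \<mu> = {v. v \<in> Linf (lebesgue_on \<Omega>) \<inter> Linf (completion (total_variation (borel_on \<Omega>) \<mu>)) \<and>
     Linf_norm (lebesgue_on \<Omega>) v \<le> 1 \<and>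
     (AE x in total_variation (borel_on \<Omega>) \<mu>. v x = sgn_measure (borel_on \<Omega>) \<mu> x)}"

section \<open>Weak derivatives, Sobolev functions and functions of bounded variation\<close>

definition test_functions :: "real set \<Rightarrow> (real \<Rightarrow> real) set" where
  "test_functions \<Omega> = {\<psi>. (\<forall>n. (deriv ^^ n) \<psi> differentiable_on UNIV) \<and>
     compact (closure {x. \<psi> x \<noteq> 0}) \<and> closure {x. \<psi> x \<noteq> 0} \<subseteq> \<Omega>}"

definition locally_integrable :: "real set \<Rightarrow> (real \<Rightarrow> real) set" where
  "locally_integrable \<Omega> = {g. \<forall>K. compact K \<and> K \<subseteq> \<Omega> \<longrightarrow> integrable (lebesgue_on K) g}"

definition has_weak_derivative :: "real set \<Rightarrow> (real \<Rightarrow> real) \<Rightarrow> (real \<Rightarrow> real) \<Rightarrow> bool" where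
  "has_weak_derivative \<Omega> g g' \<longleftrightarrow>
     g \<in> locally_integrable \<Omega> \<and> g' \<in> locally_integrable \<Omega> \<and>
     (\<forall>\<psi> \<in> test_functions \<Omega>.
        (\<integral>x. g x * deriv \<psi> x \<partial>lebesgue_on \<Omega>) = - (\<integral>x. g' x * \<psi> x \<partial>lebesgue_on \<Omega>))"

text \<open>The closure of the test functions in the Sobolev space of square-integrable functions with
  square-integrable weak derivative.\<close>

definition H01 :: "real set \<Rightarrow> (real \<Rightarrow> real) set" where
  "H01 \<Omega> = {g \<in> Lp (lebesgue_on \<Omega>) 2. \<exists>g' \<in> Lp (lebesgue_on \<Omega>) 2. has_weak_derivative \<Omega> g g' \<and>
     (\<exists>\<psi> :: nat \<Rightarrow> real \<Rightarrow> real. (\<forall>n. \<psi> n \<in> test_functions \<Omega>) \<and>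
        (\<lambda>n. Lp_norm (lebesgue_on \<Omega>) 2 (\<lambda>x. \<psi> n x - g x)) \<longlonglongrightarrow> 0 \<and>
        (\<lambda>n. Lp_norm (lebesgue_on \<Omega>) 2 (\<lambda>x. deriv (\<psi> n) x - g' x)) \<longlonglongrightarrow> 0)}"

definition has_measure_derivative :: "real set \<Rightarrow> (real \<Rightarrow> real) \<Rightarrow> (real set \<Rightarrow> real) \<Rightarrow> bool" where
  "has_measure_derivative \<Omega> u \<mu> \<longleftrightarrow>
     signed_measure (borel_on \<Omega>) \<mu> \<and>
     (\<forall>\<psi> \<in> test_functions \<Omega>.
        (\<integral>x. u x * deriv \<psi> x \<partial>lebesgue_on \<Omega>) = - signed_integral (borel_on \<Omega>) \<mu> \<psi>)"

definition BV :: "real set \<Rightarrow> (real \<Rightarrow> real) set" where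
  "BV \<Omega> = {u. integrable (lebesgue_on \<Omega>) u \<and> (\<exists>\<mu>. has_measure_derivative \<Omega> u \<mu>)}"

definition distr_deriv :: "real set \<Rightarrow> (real \<Rightarrow> real) \<Rightarrow> real set \<Rightarrow> real" where
  "distr_deriv \<Omega> u = (THE \<mu>. has_measure_derivative \<Omega> u \<mu>)"

section \<open>The variational problem\<close>

definition residual_measure :: "real set \<Rightarrow> (real \<Rightarrow> real) \<Rightarrow> (real \<Rightarrow> real) \<Rightarrow> real set \<Rightarrow> real" where
  "residual_measure \<Omega> u w = (\<lambda>A. distr_deriv \<Omega> u A - lebesgue_density \<Omega> w A)"

text \<open>On a bounded interval \<Omega> functions in \<open>BV \<Omega>\<close> are essentially bounded, so for square-integrable \<open>f\<close>
  all three terms are finite and the real-valued norms are the true ones.\<close>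

definition objective ::
    "real set \<Rightarrow> real \<Rightarrow> real \<Rightarrow> real \<Rightarrow> (real \<Rightarrow> real) \<Rightarrow> (real \<Rightarrow> real) \<times> (real \<Rightarrow> real) \<Rightarrow> real" where
  "objective \<Omega> p \<alpha> \<beta> f = (\<lambda>(w, u).
     1 / 2 * (Lp_norm (lebesgue_on \<Omega>) 2 (\<lambda>x. f x - u x))\<^sup>2
     + \<alpha> * Radon_norm \<Omega> (residual_measure \<Omega> u w)
     + \<beta> * Lp_norm (lebesgue_on \<Omega>) p w)"

definition is_solution ::
    "real set \<Rightarrow> real \<Rightarrow> real \<Rightarrow> real \<Rightarrow> (real \<Rightarrow> real) \<Rightarrow> (real \<Rightarrow> real) \<times> (real \<Rightarrow> real) \<Rightarrow> bool" where
  "is_solution \<Omega> p \<alpha> \<beta> f = is_arg_min (objective \<Omega> p \<alpha> \<beta> f)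
     (\<lambda>(w, u). w \<in> Lp (lebesgue_on \<Omega>) p \<and> u \<in> BV \<Omega>)"

end

theory Submission
  imports Defs
begin

text \<open>
  A function of bounded variation is, up to a constant, the distribution function of its derivative,
  so Fubini's theorem gives the integration by parts \<open>\<integral>h u = - \<integral>\<phi> d(Du)\<close> for \<open>\<phi>(x) = \<integral>\<^sub>a\<^sup>x h\<close>
  whenever \<open>\<integral>h = 0\<close>; it is applied to \<open>h = u - f\<close>.  As \<open>Du\<close> ranges over
  all finite measures, the residual \<open>\<nu> = Du - w\<close> and \<open>w\<close> can be varied independently, and minimality of \<open>(w, u)\<close>
  decouples: \<open>\<alpha>\<parallel>\<nu>'\<parallel> - \<integral>\<phi> d\<nu>'\<close> and \<open>\<beta>\<parallel>w'\<parallel> - \<integral>\<phi> w'\<close> are nonnegative for all \<open>\<nu>'\<close>, \<open>w'\<close> and vanish at \<open>\<nu>\<close>, \<open>w\<close>.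
  Point masses turn the first condition into \<open>\<bar>\<phi>\<bar> \<le> \<alpha>\<close> with polar alignment, and the equality case of
  Young's inequality turns the second into the formula for \<open>\<phi>\<close>.  Conversely, the two conditions give
  minimality by expanding the square.
\<close>

section \<open>Signed measures\<close>

text \<open>The total variation is a supremum, its polar density a \<open>SOME\<close>, the
  distributional derivative a \<open>THE\<close>. A Hahn decomposition evaluates the first and
  supplies the second; uniqueness against test functions justifies the third. Since the polar
  density depends on the measure in no explicit way, linearity of integrals in the measure is not
  visible; such identities are reduced to indicators by a sup-norm bound. The norms are not
  differentiable, so minimality is used along one-sided variations, which yield the dual
  inequalities. The matching equalities come from shrinking \<open>\<nu>\<close> or \<open>w\<close>
  by a factor \<open>1 - t\<close>, where the norm scales. To move \<open>w\<close> with the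
  residual fixed, \<open>u\<close> moves along by a primitive. Integration by parts needs mean zero,
  so constants are the first competitors. Placing \<open>\<phi>\<close> in \<open>H01\<close>, a
  closure, requires density of test functions in L2 and a correction of means. As the residual may
  have atoms, Lebesgue-a.e. relations for \<open>\<phi>\<close> are upgraded to pointwise ones by
  continuity.\<close>

lemma signed_measure_empty: "signed_measure M \<mu> \<Longrightarrow> \<mu> {} = 0"
  by (simp add: signed_measure_def)

lemma signed_measure_not_sets: "signed_measure M \<mu> \<Longrightarrow> A \<notin> sets M \<Longrightarrow> \<mu> A = 0"
  by (simp add: signed_measure_def)

lemma signed_measure_sums:
  "signed_measure M \<mu> \<Longrightarrow> range A \<subseteq> sets M \<Longrightarrow> disjoint_family A \<Longrightarrow>
    (\<lambda>n::nat. \<mu> (A n)) sums \<mu> (\<Union>n. A n)"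
  by (simp add: signed_measure_def)

lemma signed_measure_Un:
  assumes "signed_measure M \<mu>" "A \<in> sets M" "B \<in> sets M" "A \<inter> B = {}"
  shows "\<mu> (A \<union> B) = \<mu> A + \<mu> B"
proof -
  have "(\<lambda>n. \<mu> (binaryset A B n)) sums \<mu> (\<Union>n. binaryset A B n)"
  proof (rule signed_measure_sums[OF assms(1)])
    show "range (binaryset A B) \<subseteq> sets M"
      using assms by (auto simp: range_binaryset_eq)
    show "disjoint_family (binaryset A B)"
      using assms by (simp add: disjoint_family_on_def binaryset_def Int_commute)
  qed
  moreover have "(\<lambda>n. \<mu> (binaryset A B n)) sums (\<mu> A + \<mu> B)"
    by (rule binaryset_sums) (simp add: signed_measure_empty[OF assms(1)])
  ultimately show ?thesis
    by (simp add: UN_binaryset_eq sums_unique2)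
qed

lemma signed_measure_split:
  assumes "signed_measure M \<mu>" "A \<in> sets M" "H \<in> sets M"
  shows "\<mu> A = \<mu> (A \<inter> H) + \<mu> (A - H)"
  using signed_measure_Un[OF assms(1), of "A \<inter> H" "A - H"] assms
  by (simp add: Int_Diff_Un Int_Diff_disjoint)

lemma signed_measure_UN_finite:
  assumes "signed_measure M \<mu>" "finite P" "P \<subseteq> sets M" "disjoint P"
  shows "\<mu> (\<Union>P) = (\<Sum>B\<in>P. \<mu> B)"
  using assms(2,3,4)
proof (induction P rule: finite_induct)
  case empty
  then show ?case by (simp add: signed_measure_empty[OF assms(1)])
next
  case (insert B P)
  have "B \<inter> \<Union>P = {}"
    using insert.prems insert.hyps by (auto simp: pairwise_def disjnt_def)
  moreover have "\<Union>P \<in> sets M"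
    using insert by (auto intro!: sets.finite_Union)
  moreover have "disjoint P"
    using insert.prems by (auto simp: pairwise_def)
  ultimately show ?case
    using insert signed_measure_Un[OF assms(1), of B "\<Union>P"] by simp
qed

lemma signed_measure_linear:
  assumes "signed_measure M \<mu>" "signed_measure M \<nu>"
  shows "signed_measure M (\<lambda>A. s * \<mu> A + t * \<nu> A)"
  using assms unfolding signed_measure_def by (auto intro!: sums_add sums_mult)

lemma signed_measure_uminus:
  assumes "signed_measure M \<mu>"
  shows "signed_measure M (\<lambda>A. - \<mu> A)"
  using signed_measure_linear[OF assms assms, of "-1" 0] by simp

text \<open>The case distinction matters because \<open>A \<inter> H\<close> may be measurable
  although \<open>A\<close> is not, while a signed measure has to vanish off the
  sigma-algebra.\<close>

lemma signed_measure_restrict: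
  assumes "signed_measure M \<mu>" "H \<in> sets M"
  shows "signed_measure M (\<lambda>A. if A \<in> sets M then \<mu> (A \<inter> H) else 0)"
  unfolding signed_measure_def
proof (intro conjI allI impI)
  fix A :: "nat \<Rightarrow> 'a set" assume A: "range A \<subseteq> sets M" "disjoint_family A"
  have "(\<lambda>n. \<mu> (A n \<inter> H)) sums \<mu> (\<Union>n. A n \<inter> H)"
    using A assms(2) by (intro signed_measure_sums[OF assms(1)]) (auto simp: disjoint_family_on_def)
  then show "(\<lambda>n. if A n \<in> sets M then \<mu> (A n \<inter> H) else 0) sums
      (if (\<Union>n. A n) \<in> sets M then \<mu> ((\<Union>n. A n) \<inter> H) else 0)"
    using A by (auto simp: range_subsetD)
qed (simp_all add: signed_measure_empty[OF assms(1)])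

section \<open>Hahn decomposition by greedy exhaustion\<close>

lemma greedy_choice:
  fixes S :: "real set"
  assumes "0 \<in> S"
  shows "\<exists>b\<in>S. 0 \<le> b \<and> (\<forall>c\<in>S. min 1 (c / 2) \<le> b)"
\<comment> \<open>\<open>S\<close> may be unbounded, as no bound on a signed measure is known yet.
  An element that is at least 1 serves at once, thanks to the cap in \<open>min 1 (c / 2)\<close>;
  otherwise \<open>Sup S\<close> is available, and half of a positive supremum is exceeded by some
  element.\<close>
proof (cases "\<exists>b\<in>S. 1 \<le> b")
  case True
  then obtain b where b: "b \<in> S" "1 \<le> b" by auto
  then have "min 1 (c / 2) \<le> b" for c :: real by simp
  then show ?thesis using b by (intro bexI[of _ b]) auto
next
  case False
  then have bdd: "bdd_above S" by (force intro: bdd_aboveI[of _ 1])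
  have S0: "0 \<le> Sup S" using assms bdd by (rule cSup_upper)
  show ?thesis
  proof (cases "Sup S = 0")
    case True
    then have "\<forall>c\<in>S. c \<le> 0" using bdd by (metis cSup_upper)
    then show ?thesis using assms by (intro bexI[of _ 0]) auto
  next
    case False
    then have "Sup S / 2 < Sup S" using S0 by simp
    then obtain b where b: "b \<in> S" "Sup S / 2 < b"
      using assms by (metis empty_iff less_cSupD)
    have "min 1 (c / 2) \<le> b" if "c \<in> S" for c
      using cSup_upper[OF that bdd] b by simp
    then show ?thesis using b S0 by (intro bexI[of _ b]) auto
  qed
qed

text \<open>Greedily removing candidates of almost maximal measure exhausts all candidates of positive
  measure, because the removed measures are summable.\<close>

lemma greedy_exhaustion:
  assumes sm: "signed_measure M \<nu>" and Q0: "Q {}" and Qs: "\<And>C. Q C \<Longrightarrow> C \<in> sets M"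
  obtains B :: "nat \<Rightarrow> 'a set" where "disjoint_family B" "\<And>n. Q (B n)" "\<And>n. B n \<subseteq> D"
    "\<And>n. 0 \<le> \<nu> (B n)" "\<And>C. Q C \<Longrightarrow> C \<subseteq> D - (\<Union>n. B n) \<Longrightarrow> \<nu> C \<le> 0"
proof -
  have "\<exists>B. (Q B \<and> B \<subseteq> D - U) \<and> 0 \<le> \<nu> B \<and>
      (\<forall>C. Q C \<and> C \<subseteq> D - U \<longrightarrow> min 1 (\<nu> C / 2) \<le> \<nu> B)" for U
    using greedy_choice[of "\<nu> ` {C. Q C \<and> C \<subseteq> D - U}"] Q0 signed_measure_empty[OF sm]
    by (auto simp: image_iff)
  then obtain G where G: "\<And>U. Q (G U)" "\<And>U. G U \<subseteq> D - U" "\<And>U. 0 \<le> \<nu> (G U)"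
      "\<And>U C. Q C \<Longrightarrow> C \<subseteq> D - U \<Longrightarrow> min 1 (\<nu> C / 2) \<le> \<nu> (G U)"
    by metis
  \<comment> \<open>\<open>U n\<close> is the union of the choices made before stage
    \<open>n\<close>. A choice depends on the past only through this union, so recursion on sets is
    enough.\<close>
  define U where "U = rec_nat {} (\<lambda>_ V. V \<union> G V)"
  have U: "U 0 = {}" "\<And>n. U (Suc n) = U n \<union> G (U n)" by (simp_all add: U_def)
  define B where "B n = G (U n)" for n
  have mono: "U m \<subseteq> U n" if "m \<le> n" for m n
    using that by (induction rule: dec_induct) (auto simp: U)
  have BU: "B m \<subseteq> U n" if "m < n" for m n
    using mono[of "Suc m" n] that U B_def by auto
  have "B m \<inter> B n = {}" if "m < n" for m n
    using BU[OF that] G(2)[of "U n"] by (auto simp: B_def)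
  then have disj: "disjoint_family B"
    unfolding disjoint_family_on_def by (metis Int_commute nat_neq_iff)
  have UB: "U n \<subseteq> (\<Union>n. B n)" for n
    by (induction n) (auto simp: U B_def)
  have "(\<lambda>n. \<nu> (B n)) sums \<nu> (\<Union>n. B n)"
    using G(1)[of "U _", folded B_def] Qs disj by (intro signed_measure_sums[OF sm]) (auto simp: B_def[symmetric])
  then have lim: "(\<lambda>n. \<nu> (B n)) \<longlonglongrightarrow> 0"
    by (intro summable_LIMSEQ_zero) (auto simp: sums_iff)
  have "\<nu> C \<le> 0" if C: "Q C" "C \<subseteq> D - (\<Union>n. B n)" for C
  proof -
    have "min 1 (\<nu> C / 2) \<le> \<nu> (B n)" for n
      unfolding B_def by (rule G(4)[OF C(1)]) (use C(2) UB[of n] in blast)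
    then have "min 1 (\<nu> C / 2) \<le> 0"
      by (intro LIMSEQ_le_const[OF lim]) auto
    then show ?thesis by (auto simp: min_def split: if_splits)
  qed
  then show ?thesis
    using that[of B] disj G by (auto simp: B_def)
qed

text \<open>With all measurable sets as candidates, the exhausting sets have a union of nonnegative
  measure. Discarding it from \<open>D\<close> cannot increase the measure, and no subset of
  positive measure survives.\<close>

lemma exists_negative_subset:
  assumes sm: "signed_measure M \<mu>" and D: "D \<in> sets M"
  shows "\<exists>A\<in>sets M. A \<subseteq> D \<and> \<mu> A \<le> \<mu> D \<and> (\<forall>B\<in>sets M. B \<subseteq> A \<longrightarrow> \<mu> B \<le> 0)"
proof -
  obtain B where B: "disjoint_family B" "\<And>n. B n \<in> sets M" "\<And>n. B n \<subseteq> D"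
    "\<And>n. 0 \<le> \<mu> (B n)" "\<And>C. C \<in> sets M \<Longrightarrow> C \<subseteq> D - (\<Union>n::nat. B n) \<Longrightarrow> \<mu> C \<le> 0"
    by (rule greedy_exhaustion[OF sm, of "\<lambda>C. C \<in> sets M" D, OF sets.empty_sets _ that])
  define N where "N = (\<Union>n. B n)"
  have N: "N \<in> sets M" "N \<subseteq> D" using B by (auto simp: N_def)
  have "(\<lambda>n. \<mu> (B n)) sums \<mu> N"
    unfolding N_def using B by (intro signed_measure_sums[OF sm]) auto
  then have "0 \<le> \<mu> N"
    by (rule sums_le[OF B(4) sums_zero])
  moreover have "\<mu> D = \<mu> N + \<mu> (D - N)"
    using signed_measure_split[OF sm D N(1)] N(2) by (simp add: Int_absorb1)
  ultimately show ?thesis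
    using B(5) D N by (intro bexI[of _ "D - N"]) (auto simp: N_def)
qed

text \<open>Exhaustion is applied to \<open>- \<mu>\<close> with the negative sets as candidates. A
  set of negative measure outside their union would contain, by
  \<open>exists_negative_subset\<close>, one more negative set of strictly negative measure, which
  the exhaustion excludes.\<close>

lemma signed_Hahn_decomposition:
  assumes sm: "signed_measure M \<mu>"
  obtains H where "H \<in> sets M" "\<And>A. A \<in> sets M \<Longrightarrow> A \<subseteq> H \<Longrightarrow> 0 \<le> \<mu> A"
    "\<And>A. A \<in> sets M \<Longrightarrow> A \<inter> H = {} \<Longrightarrow> \<mu> A \<le> 0"
proof -
  define neg where "neg A \<longleftrightarrow> A \<in> sets M \<and> (\<forall>B\<in>sets M. B \<subseteq> A \<longrightarrow> \<mu> B \<le> 0)" for A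
  have negI: "neg {}" "\<And>C. neg C \<Longrightarrow> C \<in> sets M"
    by (auto simp: neg_def signed_measure_empty[OF sm])
  obtain B where B: "disjoint_family B" "\<And>n. neg (B n)" "\<And>n. B n \<subseteq> space M"
    "\<And>n. 0 \<le> - \<mu> (B n)" "\<And>C. neg C \<Longrightarrow> C \<subseteq> space M - (\<Union>n::nat. B n) \<Longrightarrow> - \<mu> C \<le> 0"
    by (rule greedy_exhaustion[OF signed_measure_uminus[OF sm], of neg "space M", OF negI that])
  define N where "N = (\<Union>n. B n)"
  have N: "N \<in> sets M" using B by (auto simp: N_def neg_def)
  show ?thesis
  proof
    show "space M - N \<in> sets M" using N by auto
    fix A assume A: "A \<in> sets M"
    show "0 \<le> \<mu> A" if "A \<subseteq> space M - N"
    proof -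
      obtain C where C: "C \<subseteq> A" "\<mu> C \<le> \<mu> A" "neg C"
        using exists_negative_subset[OF sm A] by (auto simp: neg_def)
      then show ?thesis using B(5)[of C] that unfolding N_def by force
    qed
    show "\<mu> A \<le> 0" if "A \<inter> (space M - N) = {}"
    proof -
      \<comment> \<open>A subset of \<open>N\<close> is cut into its intersections with the disjoint
        negative sets \<open>B n\<close>, and every term of the resulting series is at most
        zero.\<close>
      have "A \<subseteq> N" using that sets.sets_into_space[OF A] by auto
      then have AN: "(\<Union>n. A \<inter> B n) = A" by (auto simp: N_def)
      have "(\<lambda>n. \<mu> (A \<inter> B n)) sums \<mu> (\<Union>n. A \<inter> B n)"
        using B A by (intro signed_measure_sums[OF sm]) (auto simp: disjoint_family_on_def neg_def)
      then have "(\<lambda>n. \<mu> (A \<inter> B n)) sums \<mu> A"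
        by (simp only: AN)
      moreover have "\<mu> (A \<inter> B n) \<le> 0" for n
        using B(2)[of n] A by (auto simp: neg_def)
      ultimately show ?thesis
        using sums_le[OF _ _ sums_zero, of "\<lambda>n. \<mu> (A \<inter> B n)" "\<mu> A"] by blast
    qed
  qed
qed

section \<open>Total variation and polar density\<close>

lemma space_total_variation [simp]: "space (total_variation M \<mu>) = space M"
  and sets_total_variation [measurable_cong, simp]: "sets (total_variation M \<mu>) = sets M"
  by (simp_all add: total_variation_def sets.space_closed)

text \<open>The supremum over partitions is attained by the two pieces cut out by \<open>H\<close>:
  every block satisfies \<open>\<bar>\<mu> B\<bar> \<le> T B\<close>, and \<open>T\<close> is
  additive, so no partition of \<open>A\<close> exceeds \<open>T A\<close>.\<close>

lemma emeasure_total_variation_Hahn: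
  assumes sm: "signed_measure M \<mu>" and H: "H \<in> sets M"
    and pos: "\<And>A. A \<in> sets M \<Longrightarrow> A \<subseteq> H \<Longrightarrow> 0 \<le> \<mu> A"
    and neg: "\<And>A. A \<in> sets M \<Longrightarrow> A \<inter> H = {} \<Longrightarrow> \<mu> A \<le> 0"
    and A: "A \<in> sets M"
  shows "emeasure (total_variation M \<mu>) A = ennreal (\<mu> (A \<inter> H) - \<mu> (A - H))"
proof -
  let ?V = "\<lambda>A. SUP P \<in> {P. finite P \<and> P \<subseteq> sets M \<and> partition_on A P}. \<Sum>B\<in>P. ennreal \<bar>\<mu> B\<bar>"
  define T where "T A = \<mu> (A \<inter> H) - \<mu> (A - H)" for A
  have T: "T A = \<mu> (A \<inter> H) + (- \<mu> (A - H))" for A by (simp add: T_def)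
  have disjH: "(A - H) \<inter> H = {}" for A by auto
  have T0: "0 \<le> T A" "\<bar>\<mu> A\<bar> \<le> T A" if "A \<in> sets M" for A
    using pos[of "A \<inter> H"] neg[of "A - H", OF _ disjH] signed_measure_split[OF sm that H] that H
    by (auto simp: T_def)
  have sT: "signed_measure M (\<lambda>A. if A \<in> sets M then T A else 0)"
  proof -
    have "signed_measure M (\<lambda>A. 1 * (if A \<in> sets M then \<mu> (A \<inter> H) else 0)
        + (-1) * (if A \<in> sets M then \<mu> (A \<inter> (space M - H)) else 0))"
      using H by (intro signed_measure_linear signed_measure_restrict sm) auto
    moreover have "(\<lambda>A. 1 * (if A \<in> sets M then \<mu> (A \<inter> H) else 0)
        + (-1) * (if A \<in> sets M then \<mu> (A \<inter> (space M - H)) else 0)) =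
        (\<lambda>A. if A \<in> sets M then T A else 0)"
    proof
      fix A
      show "1 * (if A \<in> sets M then \<mu> (A \<inter> H) else 0)
        + (-1) * (if A \<in> sets M then \<mu> (A \<inter> (space M - H)) else 0) = (if A \<in> sets M then T A else 0)"
      proof (cases "A \<in> sets M")
        case True
        then have "A \<inter> (space M - H) = A - H" using sets.sets_into_space by blast
        then show ?thesis by (simp add: T_def)
      qed simp
    qed
    ultimately show ?thesis by simp
  qed
  have eq: "?V A
      = ennreal (T A)" if A: "A \<in> sets M" for A
  proof (rule antisym)
    show "?V A
        \<le> ennreal (T A)"
    proof (rule SUP_least)
      fix P assume "P \<in> {P. finite P \<and> P \<subseteq> sets M \<and> partition_on A P}"
      then have P: "finite P" "P \<subseteq> sets M" "partition_on A P" by auto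
      have "(\<Sum>B\<in>P. ennreal \<bar>\<mu> B\<bar>) = ennreal (\<Sum>B\<in>P. \<bar>\<mu> B\<bar>)" by simp
      also have "\<dots> \<le> ennreal (\<Sum>B\<in>P. T B)"
        using T0 P by (intro ennreal_leI sum_mono) auto
      also have "(\<Sum>B\<in>P. T B) = (\<Sum>B\<in>P. if B \<in> sets M then T B else 0)"
        using P by (intro sum.cong) auto
      also have "\<dots> = T A"
        using signed_measure_UN_finite[OF sT P(1,2)] P(3) A by (auto simp: partition_on_def)
      finally show "(\<Sum>B\<in>P. ennreal \<bar>\<mu> B\<bar>) \<le> ennreal (T A)" .
    qed
    \<comment> \<open>\<open>partition_on\<close> forbids the empty set as a block, so an empty half
      of the cut is dropped.\<close>
    define P where "P = {A \<inter> H, A - H} - {{}}"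
    have "ennreal (T A) = (\<Sum>B\<in>{A \<inter> H, A - H}. ennreal \<bar>\<mu> B\<bar>)"
    \<comment> \<open>The two halves coincide only if both are empty; the sum then has one term
      instead of two.\<close>
    proof (cases "A \<inter> H = A - H")
      case True
      then have e: "A \<inter> H = {}" "A - H = {}" by auto
      show ?thesis using signed_measure_empty[OF sm] unfolding T_def e by simp
    next
      case False
      then show ?thesis
        using pos[of "A \<inter> H"] neg[of "A - H", OF _ disjH] A H by (auto simp: T_def simp flip: ennreal_plus)
    qed
    also have "\<dots> = (\<Sum>B\<in>P. ennreal \<bar>\<mu> B\<bar>)"
      using signed_measure_empty[OF sm]
      unfolding P_def by (intro sum.mono_neutral_right) auto
    also have "\<dots> \<le> ?V A"
      using A H by (intro SUP_upper) (auto simp: P_def partition_on_def disjoint_def)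
    finally show "ennreal (T A) \<le> \<dots>" .
  qed
  \<comment> \<open>\<open>measure_of\<close> reproduces a set function only if it is positive and
    countably additive, and is the zero measure otherwise. Both properties are inherited from
    \<open>T\<close> through \<open>eq\<close>.\<close>
  have "emeasure (total_variation M \<mu>) A = ennreal (T A)"
    unfolding total_variation_def
  proof (subst emeasure_measure_of[OF refl])
    show "positive (sets (measure_of (space M) (sets M) ?V))
       ?V"
      using eq[of "{}"] signed_measure_empty[OF sm] by (simp add: positive_def T_def)
    show "countably_additive (sets (measure_of (space M) (sets M) ?V))
       ?V"
    proof (rule countably_additiveI, goal_cases)
      case (1 F)
      then have F: "range F \<subseteq> sets M" "disjoint_family F" "(\<Union>i. F i) \<in> sets M"
        by (auto simp: sets.space_closed)
      have "(\<lambda>i. if F i \<in> sets M then T (F i) else 0) sums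
          (if (\<Union>i. F i) \<in> sets M then T (\<Union>i. F i) else 0)"
        by (rule signed_measure_sums[OF sT F(1,2)])
      then have s: "(\<lambda>i. T (F i)) sums T (\<Union>i. F i)"
        using F by (auto simp: range_subsetD)
      have "(\<Sum>i. ennreal (T (F i))) = ennreal (\<Sum>i. T (F i))"
        using s F T0 by (intro suminf_ennreal2) (auto simp: sums_iff)
      then show ?case using s F eq by (auto simp: sums_iff range_subsetD)
    qed
    show "A \<in> sets (measure_of (space M) (sets M) ?V)"
      using A by (simp add: sets.space_closed)
    show "sets M \<subseteq> Pow (space M)" by (rule sets.space_closed)
    show "?V A = ennreal (T A)"
      by (rule eq[OF A])
  qed
  then show ?thesis by (simp add: T_def)
qed

lemma finite_measure_total_variation:
  assumes sm: "signed_measure M \<mu>"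
  shows "finite_measure (total_variation M \<mu>)"
proof -
  obtain H where H: "H \<in> sets M" "\<And>A. A \<in> sets M \<Longrightarrow> A \<subseteq> H \<Longrightarrow> 0 \<le> \<mu> A"
    "\<And>A. A \<in> sets M \<Longrightarrow> A \<inter> H = {} \<Longrightarrow> \<mu> A \<le> 0"
    by (rule signed_Hahn_decomposition[OF sm that])
  have "emeasure (total_variation M \<mu>) (space M) = ennreal (\<mu> (space M \<inter> H) - \<mu> (space M - H))"
    by (rule emeasure_total_variation_Hahn[OF sm H sets.top])
  then show ?thesis
    by (intro finite_measureI) simp
qed

lemma measure_total_variation_Hahn:
  assumes sm: "signed_measure M \<mu>"
  shows "\<exists>H\<in>sets M. \<forall>A\<in>sets M. 0 \<le> \<mu> (A \<inter> H) \<and> \<mu> (A - H) \<le> 0 \<and>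
      measure (total_variation M \<mu>) A = \<mu> (A \<inter> H) - \<mu> (A - H)"
proof -
  obtain H where H: "H \<in> sets M" "\<And>A. A \<in> sets M \<Longrightarrow> A \<subseteq> H \<Longrightarrow> 0 \<le> \<mu> A"
    "\<And>A. A \<in> sets M \<Longrightarrow> A \<inter> H = {} \<Longrightarrow> \<mu> A \<le> 0"
    by (rule signed_Hahn_decomposition[OF sm that])
  have "0 \<le> \<mu> (A \<inter> H) \<and> \<mu> (A - H) \<le> 0 \<and>
      measure (total_variation M \<mu>) A = \<mu> (A \<inter> H) - \<mu> (A - H)" if A: "A \<in> sets M" for A
  proof -
    have p: "0 \<le> \<mu> (A \<inter> H)" using H(1) A by (intro H(2)) auto
    have n: "\<mu> (A - H) \<le> 0" using H(1) A by (intro H(3)) auto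
    have "emeasure (total_variation M \<mu>) A = ennreal (\<mu> (A \<inter> H) - \<mu> (A - H))"
      by (rule emeasure_total_variation_Hahn[OF sm H A])
    then show ?thesis
      using p n by (simp add: measure_def)
  qed
  then show ?thesis using H(1) by blast
qed

lemma abs_le_total_variation:
  assumes sm: "signed_measure M \<mu>" and A: "A \<in> sets M"
  shows "\<bar>\<mu> A\<bar> \<le> measure (total_variation M \<mu>) A"
proof -
  obtain H where H: "H \<in> sets M" "\<forall>A\<in>sets M. 0 \<le> \<mu> (A \<inter> H) \<and> \<mu> (A - H) \<le> 0 \<and>
      measure (total_variation M \<mu>) A = \<mu> (A \<inter> H) - \<mu> (A - H)"
    using measure_total_variation_Hahn[OF sm] by blast
  show ?thesis
    using bspec[OF H(2) A] signed_measure_split[OF sm A H(1)] by auto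
qed

text \<open>The function that is 1 on a Hahn set and -1 off it satisfies the specification, so the
  \<open>SOME\<close> in \<open>sgn_measure_def\<close> does too. All later reasoning about the
  polar density goes through these three facts.\<close>

lemma sgn_measure:
  assumes sm: "signed_measure M \<mu>"
  shows borel_measurable_sgn_measure: "sgn_measure M \<mu> \<in> borel_measurable M"
    and AE_abs_sgn_measure: "AE x in total_variation M \<mu>. \<bar>sgn_measure M \<mu> x\<bar> = 1"
    and set_integral_sgn_measure:
      "\<And>A. A \<in> sets M \<Longrightarrow> \<mu> A = (LINT x:A|total_variation M \<mu>. sgn_measure M \<mu> x)"
proof -
  let ?T = "total_variation M \<mu>"
  interpret finite_measure ?T by (rule finite_measure_total_variation[OF sm])
  obtain H where H: "H \<in> sets M"
    and tv: "\<forall>A\<in>sets M. measure ?T A = \<mu> (A \<inter> H) - \<mu> (A - H)"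
    using measure_total_variation_Hahn[OF sm] by blast
  define \<sigma> :: "'a \<Rightarrow> real" where "\<sigma> x = indicator H x - indicator (space M - H) x" for x
  have "\<sigma> \<in> borel_measurable ?T \<and> (AE x in ?T. \<bar>\<sigma> x\<bar> = 1) \<and>
     (\<forall>A \<in> sets M. \<mu> A = (LINT x:A|?T. \<sigma> x))"
  proof (intro conjI ballI)
    show "\<sigma> \<in> borel_measurable ?T"
      unfolding \<sigma>_def using H(1) by measurable
    show "AE x in ?T. \<bar>\<sigma> x\<bar> = 1"
      by (rule AE_I2) (auto simp: \<sigma>_def indicator_def)
    fix A assume A: "A \<in> sets M"
    have sub: "A \<subseteq> space M" by (rule sets.sets_into_space[OF A])
    have e: "(\<lambda>x. indicator A x *\<^sub>R \<sigma> x) =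
        (\<lambda>x. indicator (A \<inter> H) x - indicator (A - H) x)"
      using sub by (intro ext) (auto simp: \<sigma>_def indicator_def)
    have "(LINT x:A|?T. \<sigma> x) = measure ?T (A \<inter> H) - measure ?T (A - H)"
      unfolding set_lebesgue_integral_def e using A H(1)
      by (subst Bochner_Integration.integral_diff) (auto simp: emeasure_eq_measure)
    also have "measure ?T (A \<inter> H) = \<mu> (A \<inter> H)"
      using tv A H(1) signed_measure_empty[OF sm] by (simp add: Int_Diff)
    also have "measure ?T (A - H) = - \<mu> (A - H)"
    proof -
      have "(A - H) \<inter> H = {}" "A - H - H = A - H" by auto
      then show ?thesis
        using bspec[OF tv, of "A - H"] A H(1) signed_measure_empty[OF sm] by simp
    qed
    also have "\<mu> (A \<inter> H) - - \<mu> (A - H) = \<mu> A"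
      using signed_measure_split[OF sm A H(1)] by simp
    finally show "\<mu> A = (LINT x:A|?T. \<sigma> x)" by simp
  qed
  then have *: "sgn_measure M \<mu> \<in> borel_measurable ?T \<and>
     (AE x in ?T. \<bar>sgn_measure M \<mu> x\<bar> = 1) \<and>
     (\<forall>A \<in> sets M. \<mu> A = (LINT x:A|?T. sgn_measure M \<mu> x))"
    unfolding sgn_measure_def by (rule someI[where x=\<sigma>])
  then show "sgn_measure M \<mu> \<in> borel_measurable M"
    by (simp cong: measurable_cong_sets)
  show "AE x in ?T. \<bar>sgn_measure M \<mu> x\<bar> = 1"
    "\<And>A. A \<in> sets M \<Longrightarrow> \<mu> A = (LINT x:A|?T. sgn_measure M \<mu> x)"
    using * by auto
qed

text \<open>The bound is pointwise on the space and not almost everywhere, so the class depends only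
  on the space and the sets of \<open>M\<close>. One and the same class thus serves all signed
  measures on \<open>M\<close>, including point masses.\<close>

definition bounded_measurable :: "'a measure \<Rightarrow> ('a \<Rightarrow> real) set" where
  "bounded_measurable M = {g \<in> borel_measurable M. \<exists>K. \<forall>x\<in>space M. \<bar>g x\<bar> \<le> K}"

lemma bounded_measurableI:
  "g \<in> borel_measurable M \<Longrightarrow> (\<And>x. x \<in> space M \<Longrightarrow> \<bar>g x\<bar> \<le> K) \<Longrightarrow> g \<in> bounded_measurable M"
  by (auto simp: bounded_measurable_def)

lemma bounded_measurableE:
  assumes "g \<in> bounded_measurable M"
  obtains K where "0 \<le> K" "\<And>x. x \<in> space M \<Longrightarrow> \<bar>g x\<bar> \<le> K" "g \<in> borel_measurable M"
proof -
  obtain K where "\<forall>x\<in>space M. \<bar>g x\<bar> \<le> K" "g \<in> borel_measurable M"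
    using assms by (auto simp: bounded_measurable_def)
  then show ?thesis by (intro that[of "\<bar>K\<bar>"]) force+
qed

lemma bounded_measurable_add:
  assumes "g \<in> bounded_measurable M" "h \<in> bounded_measurable M"
  shows "(\<lambda>x. g x + h x) \<in> bounded_measurable M"
proof -
  obtain K where "0 \<le> K" "\<And>x. x \<in> space M \<Longrightarrow> \<bar>g x\<bar> \<le> K" "g \<in> borel_measurable M"
    by (rule bounded_measurableE[OF assms(1) that])
  moreover obtain L where "0 \<le> L" "\<And>x. x \<in> space M \<Longrightarrow> \<bar>h x\<bar> \<le> L" "h \<in> borel_measurable M"
    by (rule bounded_measurableE[OF assms(2) that])
  ultimately show ?thesis
    by (intro bounded_measurableI[where K="K + L"])
      (auto intro!: order_trans[OF abs_triangle_ineq] add_mono)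
qed

lemma bounded_measurable_cmult:
  assumes "g \<in> bounded_measurable M"
  shows "(\<lambda>x. c * g x) \<in> bounded_measurable M"
proof -
  obtain K where "0 \<le> K" "\<And>x. x \<in> space M \<Longrightarrow> \<bar>g x\<bar> \<le> K" "g \<in> borel_measurable M"
    by (rule bounded_measurableE[OF assms that])
  then show ?thesis
    by (intro bounded_measurableI[where K="\<bar>c\<bar> * K"]) (auto simp: abs_mult mult_left_mono)
qed

lemma bounded_measurable_indicator: "A \<in> sets M \<Longrightarrow> indicator A \<in> bounded_measurable M"
  by (rule bounded_measurableI[where K=1]) (auto simp: indicator_def)

text \<open>Bounded measurable functions are uniform limits of finite combinations of indicators, namely
  of \<open>\<lfloor>n g\<rfloor> / n\<close>.\<close>

lemma bounded_functional_zero: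
  fixes D :: "('a \<Rightarrow> real) \<Rightarrow> real"
  assumes add: "\<And>g h. g \<in> bounded_measurable M \<Longrightarrow> h \<in> bounded_measurable M \<Longrightarrow>
      D (\<lambda>x. g x + h x) = D g + D h"
    and cmult: "\<And>g c. g \<in> bounded_measurable M \<Longrightarrow> D (\<lambda>x. c * g x) = c * D g"
    and ind: "\<And>A. A \<in> sets M \<Longrightarrow> D (indicator A) = 0"
    and bound: "\<And>g K. g \<in> bounded_measurable M \<Longrightarrow> (\<And>x. x \<in> space M \<Longrightarrow> \<bar>g x\<bar> \<le> K) \<Longrightarrow>
      \<bar>D g\<bar> \<le> C * K"
    and g: "g \<in> bounded_measurable M"
  shows "D g = 0"
proof -
  obtain K where "0 \<le> K" and K: "\<And>x. x \<in> space M \<Longrightarrow> \<bar>g x\<bar> \<le> K" "g \<in> borel_measurable M"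
    by (rule bounded_measurableE[OF g that])
  note K(2)[measurable]
  have le: "\<bar>D g\<bar> \<le> C * (1 / real (Suc n))" for n
  proof -
    let ?n = "real (Suc n)"
    \<comment> \<open>\<open>I\<close> contains every value of \<open>\<lfloor>n g\<rfloor>\<close>,
      as \<open>g\<close> lies between \<open>- K\<close> and \<open>K\<close>; hence finitely many
      level sets \<open>A k\<close> cover the space.\<close>
    define I where "I = {\<lfloor>- (?n * K)\<rfloor> .. \<lfloor>?n * K\<rfloor>}"
    define A where "A k = {x \<in> space M. \<lfloor>?n * g x\<rfloor> = k}" for k :: int
    have A: "A k \<in> sets M" for k unfolding A_def by measurable
    have S: "(\<lambda>x. \<Sum>k\<in>J. (real_of_int k / ?n) * indicator (A k) x) \<in> bounded_measurable M \<and>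
        D (\<lambda>x. \<Sum>k\<in>J. (real_of_int k / ?n) * indicator (A k) x) = 0" if "finite J" for J
      using that
    proof (induction J rule: finite_induct)
      case empty
      have "D (\<lambda>x. 0 * indicator {} x) = 0" by (subst cmult) (auto intro!: bounded_measurable_indicator)
      then show ?case by (auto intro: bounded_measurableI[where K=0])
    next
      case (insert k J)
      have "(\<lambda>x. (real_of_int k / ?n) * indicator (A k) x) \<in> bounded_measurable M"
        by (intro bounded_measurable_cmult bounded_measurable_indicator A)
      moreover have "D (\<lambda>x. (real_of_int k / ?n) * indicator (A k) x) = 0"
        using A by (subst cmult) (auto intro!: bounded_measurable_indicator simp: ind)
      ultimately show ?case
        using insert by (simp add: add bounded_measurable_add)
    qed
    define s where "s x = (\<Sum>k\<in>I. (real_of_int k / ?n) * indicator (A k) x)" for x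
    have s: "s \<in> bounded_measurable M" "D s = 0"
      unfolding s_def using S[of I] by (auto simp: I_def)
    have sx: "s x = \<lfloor>?n * g x\<rfloor> / ?n" if x: "x \<in> space M" for x
    proof -
      have "- K \<le> g x" "g x \<le> K" using K(1)[OF x] by auto
      then have "?n * - K \<le> ?n * g x" "?n * g x \<le> ?n * K"
        by (simp_all only: mult_left_mono of_nat_0_le_iff)
      then have "\<lfloor>?n * g x\<rfloor> \<in> I" unfolding I_def by (auto simp del: of_nat_Suc intro!: floor_mono)
      moreover have "s x = (\<Sum>k\<in>I. if k = \<lfloor>?n * g x\<rfloor> then real_of_int k / ?n else 0)"
        unfolding s_def using x by (intro sum.cong) (auto simp: A_def)
      ultimately show ?thesis by (simp add: I_def)
    qed
    have d: "\<bar>g x + (-1) * s x\<bar> \<le> 1 / ?n" if x: "x \<in> space M" for x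
    proof -
      have "\<bar>?n * g x - \<lfloor>?n * g x\<rfloor>\<bar> \<le> 1" by linarith
      then have "\<bar>?n * g x - \<lfloor>?n * g x\<rfloor>\<bar> / ?n \<le> 1 / ?n" by (intro divide_right_mono) auto
      moreover have "g x + (-1) * s x = (?n * g x - \<lfloor>?n * g x\<rfloor>) / ?n"
        unfolding sx[OF x] by (simp add: field_simps)
      ultimately show ?thesis by (simp add: abs_divide)
    qed
    have m: "(\<lambda>x. (-1) * s x) \<in> bounded_measurable M"
      by (rule bounded_measurable_cmult[OF s(1)])
    have "\<bar>D (\<lambda>x. g x + (-1) * s x)\<bar> \<le> C * (1 / ?n)"
      by (intro bound bounded_measurable_add g m d)
    then show ?thesis using s by (simp only: add[OF g m] cmult[OF s(1)] s(2) mult_zero_right add_0_right)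
  qed
  have "(\<lambda>n. C * (1 / real (Suc n))) \<longlonglongrightarrow> C * 0"
    by (intro tendsto_mult tendsto_const) (rule LIMSEQ_Suc[OF lim_1_over_n])
  then have "\<bar>D g\<bar> \<le> C * 0"
    by (rule LIMSEQ_le_const) (use le in auto)
  then show ?thesis by simp
qed

section \<open>Integration against a signed measure\<close>

lemma integrable_mult_sgn_measure:
  assumes sm: "signed_measure M \<mu>" and g: "g \<in> bounded_measurable M"
  shows "integrable (total_variation M \<mu>) (\<lambda>x. g x * sgn_measure M \<mu> x)"
proof -
  interpret finite_measure "total_variation M \<mu>" by (rule finite_measure_total_variation[OF sm])
  obtain K where K: "0 \<le> K" "\<And>x. x \<in> space M \<Longrightarrow> \<bar>g x\<bar> \<le> K" "g \<in> borel_measurable M"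
    by (rule bounded_measurableE[OF g that])
  note [measurable] = K(3) borel_measurable_sgn_measure[OF sm]
  show ?thesis
  proof (rule integrable_const_bound[where B=K])
    show "AE x in total_variation M \<mu>. norm (g x * sgn_measure M \<mu> x) \<le> K"
      using AE_abs_sgn_measure[OF sm] AE_space by eventually_elim (auto simp: abs_mult K)
  qed measurable
qed

lemma signed_integral_add:
  assumes "signed_measure M \<mu>" "g \<in> bounded_measurable M" "h \<in> bounded_measurable M"
  shows "signed_integral M \<mu> (\<lambda>x. g x + h x) = signed_integral M \<mu> g + signed_integral M \<mu> h"
  using assms unfolding signed_integral_def
  by (simp add: distrib_right integrable_mult_sgn_measure)

lemma signed_integral_cmult:
  "signed_integral M \<mu> (\<lambda>x. c * g x) = c * signed_integral M \<mu> g"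
  unfolding signed_integral_def by (simp add: mult.assoc)

lemma signed_integral_indicator:
  "signed_measure M \<mu> \<Longrightarrow> A \<in> sets M \<Longrightarrow> signed_integral M \<mu> (indicator A) = \<mu> A"
  by (simp add: signed_integral_def set_integral_sgn_measure set_lebesgue_integral_def)

lemma signed_integral_cong:
  "(\<And>x. x \<in> space M \<Longrightarrow> g x = h x) \<Longrightarrow> signed_integral M \<mu> g = signed_integral M \<mu> h"
  unfolding signed_integral_def by (intro Bochner_Integration.integral_cong) auto

lemma abs_signed_integral_le:
  assumes sm: "signed_measure M \<mu>" and g: "g \<in> bounded_measurable M"
    and K: "\<And>x. x \<in> space M \<Longrightarrow> \<bar>g x\<bar> \<le> K"
  shows "\<bar>signed_integral M \<mu> g\<bar> \<le> measure (total_variation M \<mu>) (space M) * K"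
proof -
  interpret finite_measure "total_variation M \<mu>" by (rule finite_measure_total_variation[OF sm])
  have "\<bar>signed_integral M \<mu> g\<bar> \<le> (\<integral>x. \<bar>g x * sgn_measure M \<mu> x\<bar> \<partial>total_variation M \<mu>)"
    unfolding signed_integral_def by (rule integral_abs_bound)
  also have "\<dots> \<le> (\<integral>x. K \<partial>total_variation M \<mu>)"
  proof (rule integral_mono_AE)
    show "integrable (total_variation M \<mu>) (\<lambda>x. \<bar>g x * sgn_measure M \<mu> x\<bar>)"
      using integrable_mult_sgn_measure[OF sm g] by simp
    show "AE x in total_variation M \<mu>. \<bar>g x * sgn_measure M \<mu> x\<bar> \<le> K"
      using AE_abs_sgn_measure[OF sm] AE_space by eventually_elim (auto simp: abs_mult K)
  qed simp
  finally show ?thesis by simp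
qed

text \<open>The three integrals are taken against three different total variations with separately
  chosen densities. Their combination \<open>D\<close> vanishes on indicators, where it only
  compares values of the measures, and is bounded in the sup norm;
  \<open>bounded_functional_zero\<close> finishes.\<close>

lemma signed_integral_linear:
  assumes sm: "signed_measure M \<mu>" "signed_measure M \<nu>" and g: "g \<in> bounded_measurable M"
  shows "signed_integral M (\<lambda>A. s * \<mu> A + t * \<nu> A) g =
    s * signed_integral M \<mu> g + t * signed_integral M \<nu> g"
proof -
  define \<kappa> where "\<kappa> = (\<lambda>A. s * \<mu> A + t * \<nu> A)"
  let ?I = "signed_integral M"
  let ?V = "\<lambda>\<mu>. measure (total_variation M \<mu>) (space M)"
  have smk: "signed_measure M \<kappa>" unfolding \<kappa>_def by (rule signed_measure_linear[OF sm])
  define D where "D h = ?I \<kappa> h - (s * ?I \<mu> h + t * ?I \<nu> h)" for h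
  have "D g = 0"
  proof (rule bounded_functional_zero[OF _ _ _ _ g, where D=D and C="?V \<kappa> + \<bar>s\<bar> * ?V \<mu> + \<bar>t\<bar> * ?V \<nu>"])
    fix h K assume h: "h \<in> bounded_measurable M" "\<And>x. x \<in> space M \<Longrightarrow> \<bar>h x\<bar> \<le> K"
    have "\<bar>?I \<kappa> h\<bar> \<le> ?V \<kappa> * K"
      by (rule abs_signed_integral_le[OF smk h])
    moreover have "\<bar>s * ?I \<mu> h\<bar> \<le> \<bar>s\<bar> * (?V \<mu> * K)"
      unfolding abs_mult by (intro mult_left_mono abs_signed_integral_le[OF sm(1) h] abs_ge_zero)
    moreover have "\<bar>t * ?I \<nu> h\<bar> \<le> \<bar>t\<bar> * (?V \<nu> * K)"
      unfolding abs_mult by (intro mult_left_mono abs_signed_integral_le[OF sm(2) h] abs_ge_zero)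
    ultimately have "\<bar>D h\<bar> \<le> ?V \<kappa> * K + \<bar>s\<bar> * (?V \<mu> * K) + \<bar>t\<bar> * (?V \<nu> * K)"
      unfolding D_def by linarith
    then show "\<bar>D h\<bar> \<le> (?V \<kappa> + \<bar>s\<bar> * ?V \<mu> + \<bar>t\<bar> * ?V \<nu>) * K"
      by (simp only: distrib_right mult.assoc)
  next
    fix A assume "A \<in> sets M"
    then show "D (indicator A) = 0"
      by (simp add: D_def signed_integral_indicator sm smk) (simp add: \<kappa>_def)
  qed (use sm smk in \<open>simp_all add: D_def signed_integral_add signed_integral_cmult algebra_simps\<close>)
  then show ?thesis by (simp add: D_def \<kappa>_def)
qed

text \<open>On a Hahn set of the combination its norm is a difference of two values, which is linear
  in \<open>\<mu>\<close> and \<open>\<nu>\<close>. For any \<open>H\<close>, the values of a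
  measure on \<open>H\<close> and on its complement are together dominated by its total
  variation.\<close>

lemma total_variation_linear_le:
  assumes sm: "signed_measure M \<mu>" "signed_measure M \<nu>"
  shows "measure (total_variation M (\<lambda>A. s * \<mu> A + t * \<nu> A)) (space M) \<le>
    \<bar>s\<bar> * measure (total_variation M \<mu>) (space M) + \<bar>t\<bar> * measure (total_variation M \<nu>) (space M)"
proof -
  let ?\<kappa> = "\<lambda>A. s * \<mu> A + t * \<nu> A"
  have *: "\<bar>\<mu> (space M \<inter> H)\<bar> + \<bar>\<mu> (space M - H)\<bar> \<le> measure (total_variation M \<mu>) (space M)"
    if "signed_measure M \<mu>" and H: "H \<in> sets M" for \<mu> H
  proof -
    interpret finite_measure "total_variation M \<mu>"
      by (rule finite_measure_total_variation[OF that(1)])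
    have "measure (total_variation M \<mu>) (space M \<inter> H) + measure (total_variation M \<mu>) (space M - H)
      = measure (total_variation M \<mu>) ((space M \<inter> H) \<union> (space M - H))"
      by (rule finite_measure_Union[symmetric]) (use H in auto)
    also have "(space M \<inter> H) \<union> (space M - H) = space M" by auto
    finally show ?thesis
      using abs_le_total_variation[OF that(1), of "space M \<inter> H"]
        abs_le_total_variation[OF that(1), of "space M - H"] H by auto
  qed
  have le: "c * (x - y) \<le> \<bar>c\<bar> * (\<bar>x\<bar> + \<bar>y\<bar>)" for c x y :: real
  proof -
    have "c * (x - y) \<le> \<bar>c\<bar> * \<bar>x - y\<bar>" by (metis abs_ge_self abs_mult)
    also have "\<dots> \<le> \<bar>c\<bar> * (\<bar>x\<bar> + \<bar>y\<bar>)" by (intro mult_left_mono) auto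
    finally show ?thesis .
  qed
  obtain H where H: "H \<in> sets M"
    "\<forall>A\<in>sets M. measure (total_variation M ?\<kappa>) A = ?\<kappa> (A \<inter> H) - ?\<kappa> (A - H)"
    using measure_total_variation_Hahn[OF signed_measure_linear[OF sm, of s t]] by blast
  have "measure (total_variation M ?\<kappa>) (space M) =
      s * (\<mu> (space M \<inter> H) - \<mu> (space M - H)) + t * (\<nu> (space M \<inter> H) - \<nu> (space M - H))"
    using bspec[OF H(2) sets.top] by (simp add: right_diff_distrib)
  also have "\<dots> \<le> \<bar>s\<bar> * (\<bar>\<mu> (space M \<inter> H)\<bar> + \<bar>\<mu> (space M - H)\<bar>) +
      \<bar>t\<bar> * (\<bar>\<nu> (space M \<inter> H)\<bar> + \<bar>\<nu> (space M - H)\<bar>)"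
    by (intro add_mono le)
  also have "\<dots> \<le> \<bar>s\<bar> * measure (total_variation M \<mu>) (space M) +
      \<bar>t\<bar> * measure (total_variation M \<nu>) (space M)"
    by (intro add_mono mult_left_mono * sm H) auto
  finally show ?thesis .
qed

section \<open>Point masses\<close>

definition point_mass :: "'a measure \<Rightarrow> 'a \<Rightarrow> 'a set \<Rightarrow> real" where
  "point_mass M x A = (if A \<in> sets M then indicator A x else 0)"

lemma signed_measure_point_mass: "signed_measure M (point_mass M x)"
  unfolding signed_measure_def point_mass_def
proof (intro conjI allI impI)
  fix A :: "nat \<Rightarrow> 'a set" assume A: "range A \<subseteq> sets M" "disjoint_family A"
  have "(\<lambda>n. indicator (A n) x :: real) sums indicator (\<Union>n. A n) x"
  proof (cases "\<exists>n. x \<in> A n")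
    case True
    then obtain n where n: "x \<in> A n" by auto
    then have "indicator (A m) x = (if m = n then 1 else 0 :: real)" for m
      using A(2) by (auto simp: disjoint_family_on_def indicator_def)
    then show ?thesis using n sums_single[of n "\<lambda>_. 1::real"] by (auto simp: indicator_def)
  qed (simp add: indicator_def)
  then show "(\<lambda>n. if A n \<in> sets M then indicator (A n) x else 0 :: real) sums
      (if (\<Union>n. A n) \<in> sets M then indicator (\<Union>n. A n) x else 0)"
    using A by (auto simp: range_subsetD)
qed simp_all

lemma total_variation_point_mass: "measure (total_variation M (point_mass M x)) (space M) \<le> 1"
proof -
  obtain H where "H \<in> sets M" "measure (total_variation M (point_mass M x)) (space M) =
      point_mass M x (space M \<inter> H) - point_mass M x (space M - H)"
    using measure_total_variation_Hahn[OF signed_measure_point_mass[of M x]] sets.top[of M] by blast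
  then show ?thesis by (auto simp: point_mass_def indicator_def)
qed

text \<open>Evaluation at \<open>x\<close> and the signed integral agree on indicators, and both are
  bounded in the sup norm; the constant 2 counts one for each of them.\<close>

lemma signed_integral_point_mass:
  assumes g: "g \<in> bounded_measurable M" and x: "x \<in> space M"
  shows "signed_integral M (point_mass M x) g = g x"
proof -
  note sm = signed_measure_point_mass[of M x]
  define D where "D h = signed_integral M (point_mass M x) h - h x" for h
  have "D g = 0"
  proof (rule bounded_functional_zero[OF _ _ _ _ g, where D=D and C=2])
    fix h K assume h: "h \<in> bounded_measurable M" "\<And>x. x \<in> space M \<Longrightarrow> \<bar>h x\<bar> \<le> K"
    have "0 \<le> K" using h(2)[OF x] by simp
    then have "measure (total_variation M (point_mass M x)) (space M) * K \<le> 1 * K"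
      by (intro mult_right_mono total_variation_point_mass)
    then show "\<bar>D h\<bar> \<le> 2 * K"
      unfolding D_def using abs_signed_integral_le[OF sm h] h(2)[OF x] by simp
  qed (use sm in \<open>simp_all add: D_def signed_integral_add signed_integral_cmult
      signed_integral_indicator algebra_simps point_mass_def\<close>)
  then show ?thesis by (simp add: D_def)
qed

section \<open>Test functions\<close>

text \<open>\<open>deriv\<close> is total and returns an arbitrary value where no derivative exists.
  Demanding that every iterate be differentiable makes each \<open>(deriv ^^ n) f\<close> a genuine
  derivative.\<close>

definition smooth :: "(real \<Rightarrow> real) \<Rightarrow> bool" where
  "smooth f \<longleftrightarrow> (\<forall>n. (deriv ^^ n) f differentiable_on UNIV)"

lemma smooth_deriv: "smooth f \<Longrightarrow> smooth (deriv f)"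
  unfolding smooth_def using funpow_Suc_right[of _ deriv] by (metis comp_apply)

lemma smooth_has_real_derivative:
  assumes "smooth f"
  shows "(f has_real_derivative deriv f x) (at x)"
proof -
  have "(deriv ^^ 0) f differentiable_on UNIV"
    using assms unfolding smooth_def by blast
  then show ?thesis
    by (simp add: differentiable_on_def DERIV_deriv_iff_real_differentiable)
qed

text \<open>A class closed under taking derivatives contains all iterated derivatives of its
  members. Smoothness proofs then need one differentiation step and no formula for the n-th
  derivative.\<close>

lemma smooth_coinduct:
  assumes "f \<in> S" and step: "\<And>g. g \<in> S \<Longrightarrow> \<exists>g'\<in>S. \<forall>x. (g has_real_derivative g' x) (at x)"
  shows "smooth f"
proof -
  have "(deriv ^^ n) f \<in> S" for n
  proof (induction n)
    case (Suc n)
    then obtain g' where "g' \<in> S" "\<forall>x. ((deriv ^^ n) f has_real_derivative g' x) (at x)"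
      using step by blast
    moreover from this(2) have "deriv ((deriv ^^ n) f) = g'"
      by (intro ext DERIV_imp_deriv) auto
    ultimately show ?case by simp
  qed (simp add: assms(1))
  then have "(deriv ^^ n) f differentiable (at x)" for n x
    using step real_differentiable_def by blast
  then show ?thesis
    unfolding smooth_def differentiable_on_def by simp
qed

lemma smooth_const: "smooth (\<lambda>_. c)"
proof (rule smooth_coinduct)
  show "(\<lambda>_. c) \<in> range (\<lambda>c _. c)" by simp
  fix g :: "real \<Rightarrow> real" assume "g \<in> range (\<lambda>c _. c)"
  then show "\<exists>g'\<in>range (\<lambda>c _. c). \<forall>x. (g has_real_derivative g' x) (at x)"
    by (intro bexI[of _ "\<lambda>_. 0"]) auto
qed

lemma smooth_add:
  assumes "smooth f" "smooth g"
  shows "smooth (\<lambda>x. f x + g x)"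
proof (rule smooth_coinduct)
  let ?S = "{h. \<exists>f g. h = (\<lambda>x. f x + g x) \<and> smooth f \<and> smooth g}"
  show "(\<lambda>x. f x + g x) \<in> ?S" using assms by blast
  fix h assume "h \<in> ?S"
  then obtain f g where h: "h = (\<lambda>x. f x + g x)" "smooth f" "smooth g" by blast
  have "(\<lambda>x. deriv f x + deriv g x) \<in> ?S"
    using smooth_deriv[OF h(2)] smooth_deriv[OF h(3)] by blast
  moreover have "\<forall>x. (h has_real_derivative deriv f x + deriv g x) (at x)"
    unfolding h(1) using h smooth_has_real_derivative by (auto intro!: DERIV_add)
  ultimately show "\<exists>g'\<in>?S. \<forall>x. (h has_real_derivative g' x) (at x)"
    by (rule rev_bexI[where x="\<lambda>x. deriv f x + deriv g x"])
qed

text \<open>The product rule leads out of the products but not out of their sums, so this is the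
  invariant that \<open>smooth_coinduct\<close> needs for products, in place of the Leibniz
  formula.\<close>

inductive_set product_sums :: "(real \<Rightarrow> real) set" where
  prod: "smooth f \<Longrightarrow> smooth g \<Longrightarrow> (\<lambda>x. f x * g x) \<in> product_sums"
| sum: "f \<in> product_sums \<Longrightarrow> g \<in> product_sums \<Longrightarrow> (\<lambda>x. f x + g x) \<in> product_sums"

lemma smooth_mult:
  assumes "smooth f" "smooth g"
  shows "smooth (\<lambda>x. f x * g x)"
proof (rule smooth_coinduct[where S=product_sums])
  show "(\<lambda>x. f x * g x) \<in> product_sums" using assms by (rule product_sums.prod)
  fix h assume "h \<in> product_sums"
  then show "\<exists>g'\<in>product_sums. \<forall>x. (h has_real_derivative g' x) (at x)"
  proof (induction rule: product_sums.induct)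
    case (prod f g)
    have "(\<lambda>x. f x * deriv g x + deriv f x * g x) \<in> product_sums"
      by (intro product_sums.intros prod smooth_deriv)
    moreover have "\<forall>x. ((\<lambda>x. f x * g x) has_real_derivative f x * deriv g x + deriv f x * g x) (at x)"
      using DERIV_mult'[OF smooth_has_real_derivative[OF prod(1)] smooth_has_real_derivative[OF prod(2)]]
      by simp
    ultimately show ?case by (rule rev_bexI[where x="\<lambda>x. f x * deriv g x + deriv f x * g x"])
  next
    case (sum f g)
    then obtain f' g' where *: "f' \<in> product_sums" "g' \<in> product_sums"
      "\<forall>x. (f has_real_derivative f' x) (at x)" "\<forall>x. (g has_real_derivative g' x) (at x)" by blast
    have "(\<lambda>x. f' x + g' x) \<in> product_sums"
      using *(1,2) by (rule product_sums.sum)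
    moreover have "\<forall>x. ((\<lambda>x. f x + g x) has_real_derivative f' x + g' x) (at x)"
      using * by (auto intro!: DERIV_add)
    ultimately show ?case by (rule rev_bexI[where x="\<lambda>x. f' x + g' x"])
  qed
qed

lemma smooth_cmult: "smooth f \<Longrightarrow> smooth (\<lambda>x. c * f x)"
  by (rule smooth_mult[OF smooth_const])

lemma smooth_affine:
  assumes "smooth f"
  shows "smooth (\<lambda>x. f (c * x + d))"
proof (rule smooth_coinduct)
  \<comment> \<open>The factor \<open>k\<close> absorbs the powers of \<open>c\<close> that the
    chain rule produces.\<close>
  let ?S = "{h. \<exists>k f. h = (\<lambda>x. k * f (c * x + d)) \<and> smooth f}"
  have "(\<lambda>x. f (c * x + d)) = (\<lambda>x. 1 * f (c * x + d))" by simp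
  then show "(\<lambda>x. f (c * x + d)) \<in> ?S" using assms by blast
  fix h assume "h \<in> ?S"
  then obtain k f where h: "h = (\<lambda>x. k * f (c * x + d))" "smooth f" by blast
  have "(\<lambda>x. (k * c) * deriv f (c * x + d)) \<in> ?S"
    using smooth_deriv[OF h(2)] by blast
  moreover have "\<forall>x. (h has_real_derivative (k * c) * deriv f (c * x + d)) (at x)"
  proof
    fix x
    have "((\<lambda>x. c * x + d) has_real_derivative c) (at x)"
      by (auto intro!: derivative_eq_intros)
    then have "((\<lambda>x. f (c * x + d)) has_real_derivative deriv f (c * x + d) * c) (at x)"
      by (rule DERIV_chain2[OF smooth_has_real_derivative[OF h(2)]])
    then have "((\<lambda>x. k * f (c * x + d)) has_real_derivative k * (deriv f (c * x + d) * c)) (at x)"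
      by (rule DERIV_cmult)
    then show "(h has_real_derivative (k * c) * deriv f (c * x + d)) (at x)"
      by (simp add: h(1) mult_ac)
  qed
  ultimately show "\<exists>g'\<in>?S. \<forall>x. (h has_real_derivative g' x) (at x)"
    by (rule rev_bexI[where x="\<lambda>x. (k * c) * deriv f (c * x + d)"])
qed

section \<open>Flat functions and bumps\<close>

lemma tendsto_poly_div_exp: "((\<lambda>x::real. poly p x / exp x) \<longlongrightarrow> 0) at_top"
proof -
  have "((\<lambda>x. \<Sum>i\<le>degree p. coeff p i * (x ^ i / exp x)) \<longlongrightarrow> (\<Sum>i\<le>degree p. coeff p i * 0)) at_top"
    by (intro tendsto_sum tendsto_mult tendsto_const tendsto_power_div_exp_0)
  then show ?thesis by (simp add: poly_altdef sum_divide_distrib)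
qed

text \<open>\<open>exp_germ 1\<close> is the classical flat function at 0. The polynomial factor in
  \<open>1 / x\<close> makes the family closed under differentiation, as
  \<open>smooth_coinduct\<close> requires.\<close>

definition exp_germ :: "real poly \<Rightarrow> real \<Rightarrow> real" where
  "exp_germ p x = (if 0 < x then poly p (1 / x) * exp (- (1 / x)) else 0)"

text \<open>For positive \<open>x\<close> and \<open>y = 1 / x\<close>, differentiating
  \<open>poly p y * exp (- y)\<close> in \<open>x\<close> gives
  \<open>y^2 * (poly p y - poly (pderiv p) y) * exp (- y)\<close>; \<open>[:0, 0, 1:]\<close> is the
  factor \<open>y^2\<close>. At 0 the exponential beats every polynomial.\<close>

lemma exp_germ_has_derivative:
  "(exp_germ p has_real_derivative exp_germ ([:0, 0, 1:] * (p - pderiv p)) x) (at x)"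
proof -
  let ?q = "[:0, 0, 1:] * (p - pderiv p)"
  consider "x < 0" | "x = 0" | "0 < x" by linarith
  then show ?thesis
  proof cases
    case 1
    have "((\<lambda>_. 0) has_real_derivative 0) (at x)" by simp
    then have "(exp_germ p has_real_derivative 0) (at x)"
      by (rule has_field_derivative_transform_within_open[where S="{..<0}"])
        (use 1 in \<open>auto simp: exp_germ_def\<close>)
    then show ?thesis using 1 by (simp add: exp_germ_def)
  next
    case 2
    have "((\<lambda>h. exp_germ p h / h) \<longlongrightarrow> 0) (at 0)"
    proof (rule filterlim_split_at)
      have "\<forall>\<^sub>F h in at_left (0::real). exp_germ p h / h = 0"
        by (auto simp: eventually_at_filter exp_germ_def)
      then show "((\<lambda>h. exp_germ p h / h) \<longlongrightarrow> 0) (at_left 0)"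
        by (rule tendsto_eventually)
      \<comment> \<open>The difference quotient at \<open>h = 1 / y\<close> contributes one more
        factor \<open>y\<close>, hence \<open>pCons 0 p\<close>.\<close>
      have "\<forall>\<^sub>F y in at_top. poly (pCons 0 p) y / exp y = exp_germ p (inverse y) / inverse y"
        using eventually_gt_at_top[of 0]
        by eventually_elim (simp add: exp_germ_def exp_minus field_simps)
      then have "((\<lambda>y. exp_germ p (inverse y) / inverse y) \<longlongrightarrow> 0) at_top"
        by (rule Lim_transform_eventually[OF tendsto_poly_div_exp])
      then show "((\<lambda>h. exp_germ p h / h) \<longlongrightarrow> 0) (at_right 0)"
        by (simp add: filterlim_at_right_to_top)
    qed
    then show ?thesis using 2 by (simp add: DERIV_def exp_germ_def)
  next
    case 3
    have "((\<lambda>x. poly p (1 / x) * exp (- (1 / x))) has_real_derivative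
        poly p (1 / x) * (exp (- (1 / x)) * (1 / x\<^sup>2)) + poly (pderiv p) (1 / x) * (- 1 / x\<^sup>2) * exp (- (1 / x))) (at x)"
    proof -
      have i: "((\<lambda>x. 1 / x) has_real_derivative - 1 / x\<^sup>2) (at x)"
        using 3 by (auto intro!: derivative_eq_intros simp: power2_eq_square)
      have "((\<lambda>x. poly p (1 / x)) has_real_derivative poly (pderiv p) (1 / x) * (- 1 / x\<^sup>2)) (at x)"
        by (rule DERIV_chain2[OF poly_DERIV i])
      moreover have "((\<lambda>x. exp (- (1 / x))) has_real_derivative exp (- (1 / x)) * (1 / x\<^sup>2)) (at x)"
        using DERIV_chain2[OF DERIV_exp DERIV_minus[OF i]] by simp
      ultimately show ?thesis by (rule DERIV_mult')
    qed
    also have "poly p (1 / x) * (exp (- (1 / x)) * (1 / x\<^sup>2)) + poly (pderiv p) (1 / x) * (- 1 / x\<^sup>2) * exp (- (1 / x))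
        = exp_germ ?q x"
      using 3 by (simp add: exp_germ_def field_simps power2_eq_square)
    finally show ?thesis
      by (rule has_field_derivative_transform_within_open[where S="{0<..}"])
        (use 3 in \<open>auto simp: exp_germ_def\<close>)
  qed
qed

lemma smooth_exp_germ: "smooth (exp_germ p)"
proof (rule smooth_coinduct)
  show "exp_germ p \<in> range exp_germ" by simp
  fix g assume "g \<in> range exp_germ"
  then obtain p where "g = exp_germ p" by blast
  then show "\<exists>g'\<in>range exp_germ. \<forall>x. (g has_real_derivative g' x) (at x)"
    using exp_germ_has_derivative[of p] by blast
qed

text \<open>\<open>exp_germ 1\<close> increases to 1 at infinity and vanishes on the negative axis.
  Stretching by \<open>Suc n\<close> therefore pushes the values inside \<open>{c<..<d}\<close> to 1
  and keeps them 0 outside, so the bumps tend pointwise to the indicator of the interval.\<close>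

definition bump :: "real \<Rightarrow> real \<Rightarrow> nat \<Rightarrow> real \<Rightarrow> real" where
  "bump c d n x = exp_germ 1 (real (Suc n) * (x - c)) * exp_germ 1 (real (Suc n) * (d - x))"

lemma smooth_bump: "smooth (bump c d n)"
proof -
  have "bump c d n = (\<lambda>x. exp_germ 1 (real (Suc n) * x + - real (Suc n) * c) *
      exp_germ 1 (- real (Suc n) * x + real (Suc n) * d))"
    by (simp add: fun_eq_iff bump_def algebra_simps)
  then show ?thesis
    by (simp only: smooth_mult[OF smooth_affine[OF smooth_exp_germ] smooth_affine[OF smooth_exp_germ]])
qed

lemma bump_zero: "x \<notin> {c<..<d} \<Longrightarrow> bump c d n x = 0"
  by (auto simp: bump_def exp_germ_def zero_less_mult_iff simp del: of_nat_Suc)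

lemma abs_bump_le: "\<bar>bump c d n x\<bar> \<le> 1"
proof -
  have "\<bar>exp_germ 1 y\<bar> \<le> 1" for y by (simp add: exp_germ_def)
  then show ?thesis unfolding bump_def abs_mult by (simp add: mult_le_one)
qed

lemma bump_tendsto: "(\<lambda>n. bump c d n x) \<longlonglongrightarrow> indicator {c<..<d} x"
proof (cases "x \<in> {c<..<d}")
  case True
  have *: "(\<lambda>n. exp_germ 1 (real (Suc n) * y)) \<longlonglongrightarrow> 1" if "0 < y" for y
  proof -
    have "(\<lambda>n. - ((1 / real (Suc n)) * (1 / y))) \<longlonglongrightarrow> - (0 * (1 / y))"
      by (intro tendsto_minus tendsto_mult tendsto_const LIMSEQ_Suc[OF lim_1_over_n])
    then have "(\<lambda>n. exp (- ((1 / real (Suc n)) * (1 / y)))) \<longlonglongrightarrow> exp (- (0 * (1 / y)))"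
      by (rule tendsto_exp)
    then show ?thesis using that by (simp add: exp_germ_def zero_less_mult_iff)
  qed
  have "(\<lambda>n. bump c d n x) \<longlonglongrightarrow> 1 * 1"
    unfolding bump_def using True by (intro tendsto_mult *) auto
  then show ?thesis using True by simp
qed (simp add: bump_zero)

lemma test_functions_iff:
  assumes "a < b"
  shows "\<psi> \<in> test_functions {a<..<b} \<longleftrightarrow>
    smooth \<psi> \<and> (\<exists>c d. a < c \<and> c < d \<and> d < b \<and> (\<forall>x. x \<notin> {c..d} \<longrightarrow> \<psi> x = 0))"
proof
  assume "\<psi> \<in> test_functions {a<..<b}"
  then have \<psi>: "smooth \<psi>" and K: "compact (closure {x. \<psi> x \<noteq> 0})" "closure {x. \<psi> x \<noteq> 0} \<subseteq> {a<..<b}"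
    by (auto simp: test_functions_def smooth_def)
  let ?K = "closure {x. \<psi> x \<noteq> 0}"
  have "\<exists>c d. a < c \<and> c < d \<and> d < b \<and> ?K \<subseteq> {c..d}"
  proof (cases "?K = {}")
    case True
    obtain c where "a < c" "c < b" using dense[OF assms] by blast
    moreover obtain d where "c < d" "d < b" using dense[OF \<open>c < b\<close>] by blast
    ultimately show ?thesis using True by auto
  next
    case False
    obtain l where l: "l \<in> ?K" "\<forall>x\<in>?K. l \<le> x" using compact_attains_inf[OF K(1) False] by blast
    obtain r where r: "r \<in> ?K" "\<forall>x\<in>?K. x \<le> r" using compact_attains_sup[OF K(1) False] by blast
    have "a < l" "r < b" using l r K(2) by (auto simp: subset_iff)
    moreover have "l \<le> r" using l r by blast
    moreover obtain d where "r < d" "d < b" using dense[OF \<open>r < b\<close>] by blast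
    \<comment> \<open>The right end is moved beyond \<open>r\<close> so that the strict inequality
      \<open>c < d\<close> holds even for \<open>l = r\<close>.\<close>
    ultimately show ?thesis
      using l r by (intro exI[of _ l] exI[of _ d]) force
  qed
  moreover have "{x. \<psi> x \<noteq> 0} \<subseteq> ?K" by (rule closure_subset)
  ultimately have "\<exists>c d. a < c \<and> c < d \<and> d < b \<and> (\<forall>x. x \<notin> {c..d} \<longrightarrow> \<psi> x = 0)"
    by (smt (verit, ccfv_threshold) in_mono mem_Collect_eq)
  then show "smooth \<psi> \<and> (\<exists>c d. a < c \<and> c < d \<and> d < b \<and> (\<forall>x. x \<notin> {c..d} \<longrightarrow> \<psi> x = 0))"
    using \<psi> by blast
next
  assume "smooth \<psi> \<and> (\<exists>c d. a < c \<and> c < d \<and> d < b \<and> (\<forall>x. x \<notin> {c..d} \<longrightarrow> \<psi> x = 0))"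
  then obtain c d where \<psi>: "smooth \<psi>" and cd: "a < c" "d < b" "\<forall>x. x \<notin> {c..d} \<longrightarrow> \<psi> x = 0" by blast
  have sub: "closure {x. \<psi> x \<noteq> 0} \<subseteq> {c..d}"
    using cd(3) by (intro closure_minimal) auto
  then have "compact ({c..d} \<inter> closure {x. \<psi> x \<noteq> 0})"
    by (intro compact_Int_closed) auto
  moreover have "{c..d} \<inter> closure {x. \<psi> x \<noteq> 0} = closure {x. \<psi> x \<noteq> 0}"
    using sub by blast
  moreover have "closure {x. \<psi> x \<noteq> 0} \<subseteq> {a<..<b}"
    using sub cd(1,2) by (meson atLeastAtMost_iff greaterThanLessThan_iff less_le_trans le_less_trans subset_iff)
  ultimately show "\<psi> \<in> test_functions {a<..<b}"
    using \<psi> by (simp add: test_functions_def smooth_def)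
qed

section \<open>Measurability and limits on a subset of the line\<close>

lemma continuous_on_smooth: "smooth f \<Longrightarrow> continuous_on S f"
  by (meson DERIV_continuous_on has_field_derivative_at_within smooth_has_real_derivative)

lemma borel_measurable_smooth: "smooth f \<Longrightarrow> f \<in> borel_measurable borel"
  by (rule borel_measurable_continuous_onI[OF continuous_on_smooth])

lemma sets_borel_on_subset: "sets (borel_on \<Omega>) \<subseteq> sets (lebesgue_on \<Omega>)"
  unfolding sets_restrict_space by (rule image_mono) auto

lemma Int_in_sets_borel_on: "A \<in> sets borel \<Longrightarrow> A \<inter> \<Omega> \<in> sets (borel_on \<Omega>)"
  unfolding sets_restrict_space by (subst Int_commute) (rule imageI)

lemma space_borel_on [simp]: "space (borel_on \<Omega>) = \<Omega>"
  by (simp add: space_restrict_space)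

lemma borel_measurable_lebesgue_on_of_borel_on:
  assumes "g \<in> borel_measurable (borel_on \<Omega>)"
  shows "g \<in> borel_measurable (lebesgue_on \<Omega>)"
  using assms sets_borel_on_subset[of \<Omega>] unfolding measurable_def by (auto simp: subset_iff)

lemma bounded_measurable_lebesgue_on:
  "g \<in> bounded_measurable (borel_on \<Omega>) \<Longrightarrow> g \<in> bounded_measurable (lebesgue_on \<Omega>)"
  by (simp add: bounded_measurable_def borel_measurable_lebesgue_on_of_borel_on)

lemma integrable_bounded_mult:
  assumes g: "g \<in> bounded_measurable M" and h: "integrable M h"
  shows "integrable M (\<lambda>x. g x * h x)"
proof -
  obtain K where K: "0 \<le> K" "\<And>x. x \<in> space M \<Longrightarrow> \<bar>g x\<bar> \<le> K" "g \<in> borel_measurable M"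
    by (rule bounded_measurableE[OF g that])
  show ?thesis
  proof (rule Bochner_Integration.integrable_bound)
    show "integrable M (\<lambda>x. K * h x)" using h by simp
    show "(\<lambda>x. g x * h x) \<in> borel_measurable M"
      using K(3) borel_measurable_integrable[OF h] by (rule borel_measurable_times)
    show "AE x in M. norm (g x * h x) \<le> norm (K * h x)"
      by (rule AE_I2) (use K in \<open>auto simp: abs_mult intro!: mult_right_mono\<close>)
  qed
qed

text \<open>Open intervals are the generators of choice because their indicators are limits of
  bumps. Both induction arguments over Borel sets start from them.\<close>

lemma borel_Ioo_sigma_sets: "sets borel = sigma_sets UNIV (range (\<lambda>(c, d). {c<..<d::real}))"
  unfolding borel_eq_box box_real by simp

lemma Int_stable_Ioo: "Int_stable (range (\<lambda>(c, d). {c<..<d::real}))"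
proof (rule Int_stableI)
  fix A B :: "real set" assume "A \<in> range (\<lambda>(c, d). {c<..<d})" "B \<in> range (\<lambda>(c, d). {c<..<d})"
  then obtain c d c' d' where "A = {c<..<d}" "B = {c'<..<d'}" by auto
  then have "A \<inter> B = (\<lambda>(c, d). {c<..<d}) (max c c', min d d')" by auto
  then show "A \<inter> B \<in> range (\<lambda>(c, d). {c<..<d})" by (rule range_eqI)
qed

lemma finite_measure_lebesgue_on_Ioo: "finite_measure (lebesgue_on {a<..<b::real})"
  by (rule finite_measure_lebesgue_on) simp

lemma signed_integral_bounded_convergence:
  assumes sm: "signed_measure M \<mu>" and g: "\<And>n. g n \<in> borel_measurable M"
    and K: "\<And>n x. x \<in> space M \<Longrightarrow> \<bar>g n x\<bar> \<le> K"
    and lim: "\<And>x. x \<in> space M \<Longrightarrow> (\<lambda>n. g n x) \<longlonglongrightarrow> h x"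
  shows "(\<lambda>n. signed_integral M \<mu> (g n)) \<longlonglongrightarrow> signed_integral M \<mu> h"
proof -
  let ?T = "total_variation M \<mu>"
  interpret finite_measure ?T by (rule finite_measure_total_variation[OF sm])
  have h: "h \<in> borel_measurable M"
    by (rule borel_measurable_LIMSEQ_metric[OF g lim])
  note [measurable] = g h borel_measurable_sgn_measure[OF sm]
  show ?thesis
    unfolding signed_integral_def
  proof (rule integral_dominated_convergence[where w="\<lambda>_. K"])
    show "AE x in ?T. (\<lambda>n. g n x * sgn_measure M \<mu> x) \<longlonglongrightarrow> h x * sgn_measure M \<mu> x"
      by (rule AE_I2) (auto intro!: tendsto_mult lim)
    show "AE x in ?T. norm (g n x * sgn_measure M \<mu> x) \<le> K" for n
      using AE_abs_sgn_measure[OF sm] AE_space by eventually_elim (auto simp: abs_mult K)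
  qed (simp_all, measurable)
qed

section \<open>A bounded interval: test functions determine signed measures\<close>

locale bounded_interval =
  fixes a b :: real
  assumes ab: "a < b"
begin

abbreviation "\<Omega> \<equiv> {a<..<b}"
abbreviation "L \<equiv> lebesgue_on \<Omega>"

lemma test_function_smooth: "\<psi> \<in> test_functions \<Omega> \<Longrightarrow> smooth \<psi>"
  using test_functions_iff[OF ab] by blast

lemma test_functions_add:
  assumes "\<psi> \<in> test_functions \<Omega>" "\<xi> \<in> test_functions \<Omega>"
  shows "(\<lambda>x. \<psi> x + \<xi> x) \<in> test_functions \<Omega>"
proof -
  obtain c d where 1: "smooth \<psi>" "a < c" "c < d" "d < b" "\<And>x. x \<notin> {c..d} \<Longrightarrow> \<psi> x = 0"
    using assms(1) unfolding test_functions_iff[OF ab] by blast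
  obtain c' d' where 2: "smooth \<xi>" "a < c'" "c' < d'" "d' < b" "\<And>x. x \<notin> {c'..d'} \<Longrightarrow> \<xi> x = 0"
    using assms(2) unfolding test_functions_iff[OF ab] by blast
  have "\<psi> x + \<xi> x = 0" if "x \<notin> {min c c'..max d d'}" for x
  proof -
    have "x \<notin> {c..d}" "x \<notin> {c'..d'}" using that by auto
    then show ?thesis using 1 2 by simp
  qed
  then have "a < min c c' \<and> min c c' < max d d' \<and> max d d' < b \<and>
      (\<forall>x. x \<notin> {min c c'..max d d'} \<longrightarrow> \<psi> x + \<xi> x = 0)"
    using 1(2-4) 2(2-4) by auto
  moreover have "smooth (\<lambda>x. \<psi> x + \<xi> x)" by (rule smooth_add[OF 1(1) 2(1)])
  ultimately show ?thesis unfolding test_functions_iff[OF ab] by blast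
qed

lemma test_functions_cmult:
  assumes "\<psi> \<in> test_functions \<Omega>"
  shows "(\<lambda>x. k * \<psi> x) \<in> test_functions \<Omega>"
proof -
  obtain c d where 1: "smooth \<psi>" "a < c" "c < d" "d < b" "\<forall>x. x \<notin> {c..d} \<longrightarrow> \<psi> x = 0"
    using assms(1) unfolding test_functions_iff[OF ab] by blast
  have "\<forall>x. x \<notin> {c..d} \<longrightarrow> k * \<psi> x = 0" using 1(5) by simp
  then show ?thesis
    unfolding test_functions_iff[OF ab] using 1 smooth_cmult[OF 1(1)] by blast
qed

lemma test_functions_zero: "(\<lambda>_. 0) \<in> test_functions \<Omega>"
  unfolding test_functions_iff[OF ab] using ab dense by (metis smooth_const)

lemma test_functions_bump:
  assumes "a < c" "c < d" "d < b"
  shows "bump c d n \<in> test_functions \<Omega>"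
proof -
  have "\<forall>x. x \<notin> {c..d} \<longrightarrow> bump c d n x = 0" by (auto intro!: bump_zero)
  then show ?thesis
    unfolding test_functions_iff[OF ab] using assms smooth_bump by blast
qed

lemma bounded_measurable_continuous:
  assumes "continuous_on UNIV f"
  shows "f \<in> bounded_measurable (borel_on \<Omega>)"
proof -
  have "compact (f ` {a..b})"
    by (intro compact_continuous_image continuous_on_subset[OF assms]) auto
  then obtain K where "\<forall>y\<in>f ` {a..b}. norm y \<le> K"
    using compact_imp_bounded bounded_iff by blast
  then have "\<bar>f x\<bar> \<le> K" if "x \<in> space (borel_on \<Omega>)" for x
    using that by auto
  then show ?thesis
    by (intro bounded_measurableI measurable_restrict_space1 borel_measurable_continuous_onI assms)
qed

lemma bounded_measurable_smooth: "smooth f \<Longrightarrow> f \<in> bounded_measurable (borel_on \<Omega>)"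
  by (rule bounded_measurable_continuous[OF continuous_on_smooth])

lemma integrable_smooth_mult:
  assumes "smooth \<psi>" "integrable L h"
  shows "integrable L (\<lambda>x. h x * \<psi> x)"
  using integrable_bounded_mult[OF bounded_measurable_lebesgue_on[OF bounded_measurable_smooth[OF assms(1)]] assms(2)]
  by (simp add: mult.commute)

lemma integrable_L_const: "integrable L (\<lambda>_. c :: real)"
proof -
  interpret finite_measure L by (rule finite_measure_lebesgue_on_Ioo)
  show ?thesis by simp
qed

lemma integrable_smooth:
  assumes "smooth \<psi>"
  shows "integrable L \<psi>"
  using integrable_smooth_mult[OF assms integrable_L_const[of 1]] by simp

text \<open>A bump on an interval reaching an end of \<open>\<Omega>\<close> is no test function.
  The interval is therefore cut to \<open>\<Omega>\<close> and shrunk by \<open>1 / Suc n\<close> on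
  each side; for small \<open>n\<close> the result may be empty.\<close>

lemma Ioo_exhaustion:
  obtains c' d' :: "nat \<Rightarrow> real" where "\<And>n. a < c' n" "\<And>n. d' n < b"
    "\<And>x. (\<lambda>n. indicator {c' n<..<d' n} x :: real) \<longlonglongrightarrow> indicator ({c<..<d} \<inter> \<Omega>) x"
proof -
  define c' where "c' n = max c a + 1 / real (Suc n)" for n
  define d' where "d' n = min d b - 1 / real (Suc n)" for n
  have lt: "max c a < c' n" "d' n < min d b" for n
  proof -
    have "0 < 1 / real (Suc n)" by simp
    then show "max c a < c' n" "d' n < min d b"
      unfolding c'_def d'_def by linarith+
  qed
  have c: "c' \<longlonglongrightarrow> max c a" and d: "d' \<longlonglongrightarrow> min d b"
    using tendsto_add[OF tendsto_const[of "max c a"] LIMSEQ_Suc[OF lim_1_over_n]]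
      tendsto_diff[OF tendsto_const[of "min d b"] LIMSEQ_Suc[OF lim_1_over_n]]
    unfolding c'_def d'_def by auto
  have "(\<lambda>n. indicator {c' n<..<d' n} x :: real) \<longlonglongrightarrow> indicator ({c<..<d} \<inter> \<Omega>) x" for x
  proof (cases "x \<in> {c<..<d} \<inter> \<Omega>")
    case True
    then have "\<forall>\<^sub>F n in sequentially. c' n < x" "\<forall>\<^sub>F n in sequentially. x < d' n"
      using order_tendstoD(2)[OF c, of x] order_tendstoD(1)[OF d, of x] by auto
    then have "\<forall>\<^sub>F n in sequentially. indicator {c' n<..<d' n} x = (1::real)"
      by eventually_elim auto
    then show ?thesis using True by (simp add: tendsto_eventually)
  next
    case False
    then have "x \<notin> {c' n<..<d' n}" for n
      using lt[of n] by auto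
    then show ?thesis using False by simp
  qed
  moreover have "a < c' n" "d' n < b" for n
    using lt[of n] by auto
  ultimately show ?thesis by (intro that[of c' d'])
qed

text \<open>Two bounded limits are taken one after the other: bumps reach the intervals whose ends
  lie inside \<open>\<Omega>\<close>, and these exhaust an arbitrary interval cut to
  \<open>\<Omega>\<close>.\<close>

lemma signed_measure_Ioo_zero:
  assumes sm: "signed_measure (borel_on \<Omega>) \<mu>"
    and test: "\<And>\<psi>. \<psi> \<in> test_functions \<Omega> \<Longrightarrow> signed_integral (borel_on \<Omega>) \<mu> \<psi> = 0"
  shows "\<mu> ({c<..<d} \<inter> \<Omega>) = 0"
proof -
  have ind: "{c<..<d} \<inter> \<Omega> \<in> sets (borel_on \<Omega>)" for c d
    by (rule Int_in_sets_borel_on) simp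
  have compact_case: "signed_integral (borel_on \<Omega>) \<mu> (indicator {c<..<d}) = 0" if "a < c" "d < b" for c d
  proof (cases "c < d")
    case True
    have "(\<lambda>n. signed_integral (borel_on \<Omega>) \<mu> (bump c d n)) \<longlonglongrightarrow>
        signed_integral (borel_on \<Omega>) \<mu> (indicator {c<..<d})"
      by (intro signed_integral_bounded_convergence[OF sm, where K=1] measurable_restrict_space1
          borel_measurable_smooth smooth_bump bump_tendsto abs_bump_le)
    moreover have "signed_integral (borel_on \<Omega>) \<mu> (bump c d n) = 0" for n
      by (intro test test_functions_bump that True)
    ultimately show ?thesis by (simp add: LIMSEQ_const_iff)
  qed (simp add: signed_integral_def)
  obtain c' d' where c'd': "\<And>n. a < c' n" "\<And>n. d' n < b"
    "\<And>x. (\<lambda>n. indicator {c' n<..<d' n} x :: real) \<longlonglongrightarrow> indicator ({c<..<d} \<inter> \<Omega>) x"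
    by (rule Ioo_exhaustion[OF that])
  have "(\<lambda>n. signed_integral (borel_on \<Omega>) \<mu> (indicator {c' n<..<d' n})) \<longlonglongrightarrow>
      signed_integral (borel_on \<Omega>) \<mu> (indicator ({c<..<d} \<inter> \<Omega>))"
  proof (rule signed_integral_bounded_convergence[OF sm, where K=1])
    show "indicator {c' n<..<d' n} \<in> borel_measurable (borel_on \<Omega>)" for n
      by (intro measurable_restrict_space1) simp
    show "\<bar>indicator {c' n<..<d' n} x\<bar> \<le> (1::real)" for n x by (simp add: indicator_def)
    show "(\<lambda>n. indicator {c' n<..<d' n} x) \<longlonglongrightarrow> (indicator ({c<..<d} \<inter> \<Omega>) x :: real)" for x
      by (rule c'd'(3))
  qed
  then have "signed_integral (borel_on \<Omega>) \<mu> (indicator ({c<..<d} \<inter> \<Omega>)) = 0"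
    by (simp add: compact_case[OF c'd'(1,2)] LIMSEQ_const_iff)
  then show ?thesis
    using signed_integral_indicator[OF sm ind] by simp
qed

text \<open>Measures that vanish on an intersection-stable generator vanish on the generated
  sigma-algebra. Off the measurable sets the value is 0 by convention, so \<open>A\<close> may be
  arbitrary and equality of measures becomes equality of functions.\<close>

lemma signed_measure_eq_zeroI:
  assumes sm: "signed_measure (borel_on \<Omega>) \<mu>"
    and test: "\<And>\<psi>. \<psi> \<in> test_functions \<Omega> \<Longrightarrow> signed_integral (borel_on \<Omega>) \<mu> \<psi> = 0"
  shows "\<mu> A = 0"
proof -
  let ?G = "range (\<lambda>(c, d). {c<..<d::real})"
  note borel = borel_Ioo_sigma_sets
  have meas: "B \<inter> \<Omega> \<in> sets (borel_on \<Omega>)" if "B \<in> sigma_sets UNIV ?G" for B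
    using that unfolding borel[symmetric] by (rule Int_in_sets_borel_on)
  \<comment> \<open>For signed measures the complement step needs the total mass, and
    \<open>\<Omega>\<close> is itself one of the intervals.\<close>
  have Om: "\<mu> \<Omega> = 0"
    using signed_measure_Ioo_zero[OF sm test, of a b] by simp
  have subset_Pow_UNIV: "?G \<subseteq> Pow UNIV" by simp
  have zero: "\<mu> (B \<inter> \<Omega>) = 0" if B: "B \<in> sigma_sets UNIV ?G" for B
    using Int_stable_Ioo subset_Pow_UNIV B
  proof (induction rule: sigma_sets_induct_disjoint)
    case (basic A)
    then show ?case using signed_measure_Ioo_zero[OF sm test] by auto
  next
    case empty
    then show ?case by (simp add: signed_measure_empty[OF sm])
  next
    case (compl A)
    have "\<Omega> \<inter> (A \<inter> \<Omega>) = A \<inter> \<Omega>" "\<Omega> - A \<inter> \<Omega> = (UNIV - A) \<inter> \<Omega>" by auto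
    moreover have "\<Omega> \<in> sets (borel_on \<Omega>)" using sets.top[of "borel_on \<Omega>"] by simp
    ultimately show ?case
      using signed_measure_split[OF sm _ meas[OF compl(1)], of \<Omega>] compl(2) Om by simp
  next
    case (union A)
    have "(\<lambda>n. \<mu> (A n \<inter> \<Omega>)) sums \<mu> (\<Union>n. A n \<inter> \<Omega>)"
      using union meas by (intro signed_measure_sums[OF sm]) (auto simp: disjoint_family_on_def)
    moreover have "(\<Union>n. A n \<inter> \<Omega>) = (\<Union>n. A n) \<inter> \<Omega>" by auto
    ultimately show ?case
      using union(3) sums_unique by fastforce
  qed
  show ?thesis
  proof (cases "A \<in> sets (borel_on \<Omega>)")
    case True
    then obtain B where "B \<in> sigma_sets UNIV ?G" "A = B \<inter> \<Omega>"
      unfolding borel[symmetric] by (auto simp: sets_restrict_space)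
    then show ?thesis using zero by simp
  qed (rule signed_measure_not_sets[OF sm])
qed

section \<open>Lebesgue densities and the fundamental lemma\<close>

lemma set_integral_lebesgue_density:
  assumes "integrable L w" "A \<in> sets (borel_on \<Omega>)"
  shows "lebesgue_density \<Omega> w A = (\<integral>x. indicator A x * w x \<partial>L)"
  using assms by (simp add: lebesgue_density_def set_lebesgue_integral_def)

lemma signed_measure_lebesgue_density:
  assumes w: "integrable L w"
  shows "signed_measure (borel_on \<Omega>) (lebesgue_density \<Omega> w)"
  unfolding signed_measure_def
proof (intro conjI allI impI)
  show "lebesgue_density \<Omega> w {} = 0" by (simp add: set_integral_lebesgue_density[OF w])
  fix A :: "nat \<Rightarrow> real set" assume A: "range A \<subseteq> sets (borel_on \<Omega>)" "disjoint_family A"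
  have AL: "A n \<in> sets L" for n using A(1) sets_borel_on_subset[of \<Omega>] by blast
  \<comment> \<open>The partial unions turn partial sums into set integrals over an increasing
    sequence, where continuity from below applies.\<close>
  define B where "B n = (\<Union>i<n. A i)" for n
  have int: "set_integrable L C w" if "C \<in> sets L" for C
    unfolding set_integrable_def by (rule integrable_mult_indicator[OF that w])
  have "incseq B" unfolding B_def by (intro incseq_SucI UN_mono) auto
  then have B: "B n \<in> sets L" "incseq B" "(\<Union>n. B n) = (\<Union>n. A n)" for n
    using AL by (auto simp: B_def)
  have UAL: "(\<Union>n. A n) \<in> sets L" using AL by blast
  have fin: "(LINT x:B n|L. w x) = (\<Sum>i<n. LINT x:A i|L. w x)" for n
  proof -
    have "(\<lambda>x. indicator (B n) x *\<^sub>R w x) = (\<lambda>x. \<Sum>i<n. indicator (A i) x *\<^sub>R w x)"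
      unfolding B_def using A(2)
      by (subst indicator_UN_disjoint) (auto simp: disjoint_family_on_def sum_distrib_right)
    moreover have "(\<integral>x. (\<Sum>i<n. indicator (A i) x *\<^sub>R w x) \<partial>L) = (\<Sum>i<n. \<integral>x. indicator (A i) x *\<^sub>R w x \<partial>L)"
      by (rule Bochner_Integration.integral_sum) (rule int[OF AL, unfolded set_integrable_def])
    ultimately show ?thesis
      unfolding set_lebesgue_integral_def by (simp only:)
  qed
  have "(\<lambda>n. LINT x:B n|L. w x) \<longlonglongrightarrow> (LINT x:(\<Union>n. B n)|L. w x)"
    by (intro set_integral_cont_up B int) (simp add: B UAL)
  then have "(\<lambda>n. LINT x:A n|L. w x) sums (LINT x:(\<Union>n. A n)|L. w x)"
    unfolding sums_def fin B(3) .
  then show "(\<lambda>n. lebesgue_density \<Omega> w (A n)) sums lebesgue_density \<Omega> w (\<Union>n. A n)"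
    using A(1) by (auto simp: lebesgue_density_def range_subsetD)
qed (simp add: lebesgue_density_def)

text \<open>The total variation of the density is never computed. Both sides agree on indicators by
  definition of \<open>lebesgue_density\<close> and are bounded in the sup norm, the right one with
  constant \<open>\<integral>\<bar>w\<bar>\<close>.\<close>

lemma signed_integral_lebesgue_density:
  assumes w: "integrable L w" and g: "g \<in> bounded_measurable (borel_on \<Omega>)"
  shows "signed_integral (borel_on \<Omega>) (lebesgue_density \<Omega> w) g = (\<integral>x. g x * w x \<partial>L)"
proof -
  let ?M = "borel_on \<Omega>"
  note sm = signed_measure_lebesgue_density[OF w]
  have int: "integrable L (\<lambda>x. h x * w x)" if "h \<in> bounded_measurable ?M" for h
    by (rule integrable_bounded_mult[OF bounded_measurable_lebesgue_on[OF that] w])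
  define I where "I h = (\<integral>x. h x * w x \<partial>L)" for h
  define D where "D h = signed_integral ?M (lebesgue_density \<Omega> w) h - I h" for h
  let ?V = "measure (total_variation ?M (lebesgue_density \<Omega> w)) (space ?M)"
  have "D g = 0"
  proof (rule bounded_functional_zero[OF _ _ _ _ g, where D=D and C="?V + (\<integral>x. \<bar>w x\<bar> \<partial>L)"])
    fix h k assume h: "h \<in> bounded_measurable ?M" "k \<in> bounded_measurable ?M"
    have "I (\<lambda>x. h x + k x) = I h + I k"
      unfolding I_def using int[OF h(1)] int[OF h(2)] by (simp add: distrib_right)
    then show "D (\<lambda>x. h x + k x) = D h + D k"
      unfolding D_def signed_integral_add[OF sm h] by simp
  next
    fix h c assume "h \<in> bounded_measurable ?M"
    have "I (\<lambda>x. c * h x) = c * I h"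
      unfolding I_def by (simp add: mult.assoc)
    then show "D (\<lambda>x. c * h x) = c * D h"
      unfolding D_def signed_integral_cmult by (simp add: right_diff_distrib)
  next
    fix A assume A: "A \<in> sets ?M"
    show "D (indicator A) = 0"
      unfolding D_def I_def signed_integral_indicator[OF sm A] set_integral_lebesgue_density[OF w A]
      by simp
  next
    fix h K assume h: "h \<in> bounded_measurable ?M" "\<And>x. x \<in> space ?M \<Longrightarrow> \<bar>h x\<bar> \<le> K"
    have "\<bar>I h\<bar> \<le> (\<integral>x. \<bar>h x * w x\<bar> \<partial>L)"
      unfolding I_def by (rule integral_abs_bound)
    also have "\<dots> \<le> (\<integral>x. K * \<bar>w x\<bar> \<partial>L)"
    proof (rule integral_mono)
      show "integrable L (\<lambda>x. \<bar>h x * w x\<bar>)" by (rule integrable_abs[OF int[OF h(1)]])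
      show "integrable L (\<lambda>x. K * \<bar>w x\<bar>)" using w by simp
      show "\<bar>h x * w x\<bar> \<le> K * \<bar>w x\<bar>" if "x \<in> space L" for x
        unfolding abs_mult by (rule mult_right_mono) (use h(2)[of x] that in auto)
    qed
    finally have "\<bar>I h\<bar> \<le> (\<integral>x. \<bar>w x\<bar> \<partial>L) * K" by (simp add: mult.commute)
    moreover have "\<bar>signed_integral ?M (lebesgue_density \<Omega> w) h\<bar> \<le> ?V * K"
      by (rule abs_signed_integral_le[OF sm h])
    ultimately show "\<bar>D h\<bar> \<le> (?V + (\<integral>x. \<bar>w x\<bar> \<partial>L)) * K"
      unfolding D_def distrib_right by linarith
  qed
  then show ?thesis by (simp add: D_def I_def)
qed

text \<open>Signed measures act on Borel sets while \<open>w\<close> is only Lebesgue measurable; a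
  Borel representative has level sets on which measures can be evaluated.\<close>

lemma borel_version:
  fixes w :: "real \<Rightarrow> real"
  assumes w: "w \<in> borel_measurable L"
  shows "\<exists>v\<in>borel_measurable borel. AE x in L. w x = v x"
proof -
  have "(\<lambda>x. if x \<in> \<Omega> then w x else 0) \<in> borel_measurable lebesgue"
    using w by (intro borel_measurable_if_I) auto
  then obtain v where v: "v \<in> borel_measurable lborel" "AE x in lborel. (if x \<in> \<Omega> then w x else 0) = v x"
    using completion_ex_borel_measurable_real by blast
  have "AE x in lebesgue. x \<in> \<Omega> \<longrightarrow> w x = v x"
    using AE_completion[OF v(2)] by eventually_elim auto
  then have "AE x in L. w x = v x" by (subst AE_restrict_space_iff) auto
  then show ?thesis using v(1) by auto
qed

lemma AE_zero_if_density_nonneg: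
  assumes w: "integrable L w" and zero: "\<And>A. A \<in> sets (borel_on \<Omega>) \<Longrightarrow> lebesgue_density \<Omega> w A = 0"
  shows "AE x in L. w x \<le> 0"
proof -
  obtain v where v: "v \<in> borel_measurable borel" and eq: "AE x in L. w x = v x"
    using borel_version[OF borel_measurable_integrable[OF w]] by blast
  \<comment> \<open>On this Borel set \<open>w\<close> is positive almost everywhere, so a vanishing
    integral over it forces the set to be null.\<close>
  define A where "A = {x \<in> \<Omega>. 0 < v x}"
  have "A = \<Omega> \<inter> (v -` {0<..})" by (auto simp: A_def)
  moreover have "v -` {0<..} \<in> sets borel"
    using measurable_sets[OF v, of "{0<..}"] by simp
  ultimately have A: "A \<in> sets (borel_on \<Omega>)" by (auto simp: sets_restrict_space)
  then have AL: "A \<in> sets L" using sets_borel_on_subset[of \<Omega>] by blast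
  have int: "integrable L (\<lambda>x. indicator A x * w x)"
    using integrable_mult_indicator[OF AL w] by simp
  have nonneg: "AE x in L. 0 \<le> indicator A x * w x"
    using eq by eventually_elim (auto simp: A_def indicator_def)
  have "(\<integral>x. indicator A x * w x \<partial>L) = 0"
    using zero[OF A] set_integral_lebesgue_density[OF w A] by simp
  then have "AE x in L. indicator A x * w x = 0"
    using integral_nonneg_eq_0_iff_AE[OF int nonneg] by simp
  then show ?thesis
    using eq AE_space by eventually_elim (auto simp: A_def indicator_def split: if_splits)
qed

lemma AE_zero_if_density_zero:
  assumes w: "integrable L w" and zero: "\<And>A. A \<in> sets (borel_on \<Omega>) \<Longrightarrow> lebesgue_density \<Omega> w A = 0"
  shows "AE x in L. w x = 0"
proof -
  have "lebesgue_density \<Omega> (\<lambda>x. - w x) A = 0" if "A \<in> sets (borel_on \<Omega>)" for A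
    using zero[OF that] set_integral_lebesgue_density[OF _ that] w by simp
  then have "AE x in L. - w x \<le> 0"
    using w by (intro AE_zero_if_density_nonneg) auto
  moreover have "AE x in L. w x \<le> 0"
    by (rule AE_zero_if_density_nonneg[OF w zero])
  ultimately show ?thesis by eventually_elim simp
qed

text \<open>Read as a signed measure, \<open>w\<close> annihilates all test functions, so functions
  and measures share the uniqueness argument of \<open>signed_measure_eq_zeroI\<close>.\<close>

lemma fundamental_lemma:
  assumes w: "integrable L w" and zero: "\<And>\<psi>. \<psi> \<in> test_functions \<Omega> \<Longrightarrow> (\<integral>x. w x * \<psi> x \<partial>L) = 0"
  shows "AE x in L. w x = 0"
proof (rule AE_zero_if_density_zero[OF w], rule signed_measure_eq_zeroI[OF signed_measure_lebesgue_density[OF w]])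
  fix \<psi> assume "\<psi> \<in> test_functions \<Omega>"
  then show "signed_integral (borel_on \<Omega>) (lebesgue_density \<Omega> w) \<psi> = 0"
    using zero[of \<psi>] signed_integral_lebesgue_density[OF w bounded_measurable_smooth[OF test_function_smooth]]
    by (simp add: mult.commute)
qed

section \<open>Primitives of test functions and the du Bois-Reymond lemma\<close>

lemma integral_derivative:
  assumes cd: "c \<le> d" and F: "\<And>x. (F has_real_derivative F' x) (at x)" and F': "continuous_on UNIV F'"
  shows "integrable (lebesgue_on {c<..<d}) F'" "(\<integral>x. F' x \<partial>lebesgue_on {c<..<d}) = F d - F c"
proof -
  have int: "integrable (lebesgue_on {c..d}) F'"
    using continuous_on_subset[OF F'] by (intro continuous_imp_integrable_real) auto
  have "set_integrable lebesgue {c..d} F'"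
    using int by (simp add: integrable_restrict_space set_integrable_def)
  then have "set_integrable lebesgue {c<..<d} F'"
    by (rule set_integrable_subset) auto
  then show i: "integrable (lebesgue_on {c<..<d}) F'"
    by (simp add: integrable_restrict_space set_integrable_def)
  have "(F' has_integral (F d - F c)) {c..d}"
    using cd F by (intro fundamental_theorem_of_calculus)
      (auto simp: has_real_derivative_iff_has_vector_derivative[symmetric]
        intro: has_field_derivative_at_within)
  then have "integral {c<..<d} F' = F d - F c"
    by (simp add: has_integral_Icc_iff_Ioo integral_unique)
  then show "(\<integral>x. F' x \<partial>lebesgue_on {c<..<d}) = F d - F c"
    using lebesgue_integral_eq_integral[OF i] by simp
qed

lemma continuous_has_antiderivative:
  fixes f :: "real \<Rightarrow> real"
  assumes "continuous_on UNIV f"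
  shows "\<exists>F. \<forall>x. (F has_real_derivative f x) (at x)"
proof -
  have "isCont f x" for x using assms by (simp add: continuous_on_eq_continuous_at)
  then show ?thesis
    using einterval_antiderivative[of "-\<infinity>" "\<infinity>" f]
    by (simp add: has_real_derivative_iff_has_vector_derivative)
qed

text \<open>An antiderivative of \<open>\<psi>\<close> is constant on either side of the support,
  and mean zero makes the two constants equal. Subtracting the value at \<open>a\<close> leaves a
  function with the same support interval.\<close>

lemma test_function_primitive:
  assumes \<psi>: "\<psi> \<in> test_functions \<Omega>" and zero: "(\<integral>x. \<psi> x \<partial>L) = 0"
  shows "\<exists>\<Psi>\<in>test_functions \<Omega>. deriv \<Psi> = \<psi>"
proof -
  obtain c d where cd: "smooth \<psi>" "a < c" "c < d" "d < b" "\<And>x. x \<notin> {c..d} \<Longrightarrow> \<psi> x = 0"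
    using \<psi> unfolding test_functions_iff[OF ab] by blast
  obtain F where F: "\<And>x. (F has_real_derivative \<psi> x) (at x)"
    using continuous_has_antiderivative[OF continuous_on_smooth[OF cd(1)]] by blast
  define \<Psi> where "\<Psi> x = F x - F a" for x
  have D: "(\<Psi> has_real_derivative \<psi> x) (at x)" for x
    unfolding \<Psi>_def using DERIV_diff[OF F DERIV_const[of "F a"]] by simp
  then have deriv: "deriv \<Psi> = \<psi>" by (intro ext DERIV_imp_deriv)
  have "F b = F a"
    using integral_derivative(2)[OF less_imp_le[OF ab] F continuous_on_smooth[OF cd(1)]] zero by simp
  have const: "F y = F x" if "x < y" "\<And>z. x < z \<Longrightarrow> z < y \<Longrightarrow> \<psi> z = 0" for x y
  proof (rule DERIV_isconst_end[OF that(1)])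
    show "continuous_on {x..y} F"
      by (rule DERIV_continuous_on[OF has_field_derivative_at_within[OF F]])
    show "(F has_real_derivative 0) (at z)" if "x < z" "z < y" for z
      using F[of z] \<open>\<And>z. x < z \<Longrightarrow> z < y \<Longrightarrow> \<psi> z = 0\<close>[OF that] by simp
  qed
  have zero: "\<Psi> x = 0" if x: "x \<notin> {c..d}" for x
  proof -
    \<comment> \<open>Test functions live on the whole line, so the primitive must vanish outside
      \<open>\<Omega>\<close> as well as in the gaps between the support and the ends.\<close>
    consider "x < a" | "x = a" | "a < x" "x < c" | "d < x" "x < b" | "x = b" | "b < x"
      using x cd(2-4) by (simp add: not_le) linarith
    then have "F x = F a"
    proof cases
      case 1
      have "F a = F x" by (rule const[OF 1]) (use cd in auto)
      then show ?thesis by simp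
    next
      case 3
      show ?thesis by (rule const[OF 3(1)]) (use cd 3 in auto)
    next
      case 4
      have "F b = F x" by (rule const[OF 4(2)]) (use cd 4 in auto)
      then show ?thesis using \<open>F b = F a\<close> by simp
    next
      case 6
      have "F x = F b" by (rule const[OF 6]) (use cd in auto)
      then show ?thesis using \<open>F b = F a\<close> by simp
    qed (simp_all add: \<open>F b = F a\<close>)
    then show ?thesis by (simp add: \<Psi>_def)
  qed
  have "smooth \<Psi>"
  proof (rule smooth_coinduct[where S="insert \<Psi> {f. smooth f}"])
    fix g assume "g \<in> insert \<Psi> {f. smooth f}"
    then show "\<exists>g'\<in>insert \<Psi> {f. smooth f}. \<forall>x. (g has_real_derivative g' x) (at x)"
      using D cd(1) smooth_has_real_derivative smooth_deriv by blast
  qed simp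
  then have "\<Psi> \<in> test_functions \<Omega>"
    unfolding test_functions_iff[OF ab] using cd zero by blast
  then show ?thesis using deriv by blast
qed

text \<open>If every test function had integral 0, the fundamental lemma applied to the constant 1
  would give \<open>1 = 0\<close> almost everywhere on a set of positive measure.\<close>

lemma exists_normalized_test_function: "\<exists>\<eta>\<in>test_functions \<Omega>. (\<integral>x. \<eta> x \<partial>L) = 1"
proof -
  have "\<exists>\<psi>\<in>test_functions \<Omega>. (\<integral>x. \<psi> x \<partial>L) \<noteq> 0"
  proof (rule ccontr)
    assume "\<not> ?thesis"
    then have "AE x in L. (1::real) = 0"
      by (intro fundamental_lemma integrable_L_const) auto
    then have "AE x in L. False" by simp
    then have "ae_filter L = bot" by (simp only: eventually_False)
    then have "emeasure L (space L) = 0" by (simp only: ae_filter_eq_bot_iff)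
    then show False using ab by (simp add: emeasure_restrict_space)
  qed
  then obtain \<psi> where \<psi>: "\<psi> \<in> test_functions \<Omega>" "(\<integral>x. \<psi> x \<partial>L) \<noteq> 0" by blast
  let ?k = "1 / (\<integral>x. \<psi> x \<partial>L)"
  have "(\<integral>x. ?k * \<psi> x \<partial>L) = 1" using \<psi>(2) by simp
  then show ?thesis using test_functions_cmult[OF \<psi>(1), of ?k] by blast
qed

text \<open>Subtracting a multiple of a normalized \<open>\<eta>\<close> gives any test function
  mean zero and hence makes it the derivative of a test function. The defect is a constant, namely
  the pairing of \<open>g\<close> with \<open>\<eta>\<close>.\<close>

lemma du_Bois_Reymond:
  assumes g: "integrable L g"
    and zero: "\<And>\<psi>. \<psi> \<in> test_functions \<Omega> \<Longrightarrow> (\<integral>x. g x * deriv \<psi> x \<partial>L) = 0"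
  shows "\<exists>k. AE x in L. g x = k"
proof -
  obtain \<eta> where \<eta>: "\<eta> \<in> test_functions \<Omega>" "(\<integral>x. \<eta> x \<partial>L) = 1"
    using exists_normalized_test_function by blast
  define k where "k = (\<integral>x. g x * \<eta> x \<partial>L)"
  have "AE x in L. g x - k = 0"
  proof (rule fundamental_lemma)
    show "integrable L (\<lambda>x. g x - k)"
      using g integrable_L_const by (rule Bochner_Integration.integrable_diff)
    fix \<psi> assume \<psi>: "\<psi> \<in> test_functions \<Omega>"
    define m where "m = (\<integral>x. \<psi> x \<partial>L)"
    define \<xi> where "\<xi> x = \<psi> x + (- m) * \<eta> x" for x
    have \<xi>: "\<xi> \<in> test_functions \<Omega>"
      unfolding \<xi>_def by (intro test_functions_add test_functions_cmult \<psi> \<eta>)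
    have int: "integrable L \<psi>" "integrable L \<eta>" "integrable L (\<lambda>x. g x * \<psi> x)" "integrable L (\<lambda>x. g x * \<eta> x)"
      using integrable_smooth integrable_smooth_mult[OF _ g] test_function_smooth \<psi> \<eta>(1) by auto
    have "(\<integral>x. \<xi> x \<partial>L) = 0"
      using int \<eta>(2) by (simp add: \<xi>_def m_def)
    then obtain \<Psi> where "\<Psi> \<in> test_functions \<Omega>" "deriv \<Psi> = \<xi>"
      using test_function_primitive[OF \<xi>] by blast
    then have "(\<integral>x. g x * \<xi> x \<partial>L) = 0" using zero by blast
    also have "(\<lambda>x. g x * \<xi> x) = (\<lambda>x. g x * \<psi> x - m * (g x * \<eta> x))"
      by (simp add: \<xi>_def algebra_simps)
    also have "(\<integral>x. g x * \<psi> x - m * (g x * \<eta> x) \<partial>L) = (\<integral>x. g x * \<psi> x \<partial>L) - m * k"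
      using int by (simp add: k_def)
    finally have "(\<integral>x. g x * \<psi> x \<partial>L) = m * k" by simp
    moreover have "(\<integral>x. (g x - k) * \<psi> x \<partial>L) = (\<integral>x. g x * \<psi> x \<partial>L) - k * m"
      using int by (simp add: left_diff_distrib m_def)
    ultimately show "(\<integral>x. (g x - k) * \<psi> x \<partial>L) = 0" by simp
  qed
  then show ?thesis by auto
qed

section \<open>Distribution functions and integration by parts\<close>

definition cumul :: "(real set \<Rightarrow> real) \<Rightarrow> real \<Rightarrow> real" where
  "cumul \<mu> x = \<mu> ({..x} \<inter> \<Omega>)"

text \<open>Being an integral over \<open>L\<close>, it is 0 left of \<open>a\<close> and constant
  right of \<open>b\<close>, so for integrable \<open>h\<close> it is continuous on the whole line;
  the values outside \<open>\<Omega>\<close> are harmless.\<close>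

definition primitive :: "(real \<Rightarrow> real) \<Rightarrow> real \<Rightarrow> real" where
  "primitive h x = (\<integral>t. indicator {..x} t * h t \<partial>L)"

lemma Atmost_borel_on: "{..x} \<inter> \<Omega> \<in> sets (borel_on \<Omega>)"
  by (rule Int_in_sets_borel_on) simp

lemma indicator_sets_L: "A \<in> sets borel \<Longrightarrow> A \<inter> \<Omega> \<in> sets L"
  by (rule subsetD[OF sets_borel_on_subset Int_in_sets_borel_on])

lemma integrable_indicator_mult:
  fixes h :: "real \<Rightarrow> real"
  assumes h: "integrable L h" and A: "A \<in> sets borel"
  shows "integrable L (\<lambda>t. indicator A t * h t)"
proof -
  have "integrable L (\<lambda>t. indicator (A \<inter> \<Omega>) t *\<^sub>R h t)"
    by (rule integrable_mult_indicator[OF indicator_sets_L[OF A] h])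
  then show ?thesis
    by (rule Bochner_Integration.integrable_cong[THEN iffD1, rotated -1]) (auto simp: indicator_def)
qed

lemma AE_L_neq: "AE x in L. x \<noteq> y"
proof -
  have "AE x in lebesgue. x \<noteq> y" by (rule AE_completion[OF AE_lborel_singleton])
  then show ?thesis by (subst AE_restrict_space_iff) auto
qed

lemma cumul_eq_integral:
  assumes sm: "signed_measure (borel_on \<Omega>) \<mu>"
  shows "cumul \<mu> x = (\<integral>y. (if y \<le> x then sgn_measure (borel_on \<Omega>) \<mu> y else 0)
    \<partial>total_variation (borel_on \<Omega>) \<mu>)"
  unfolding cumul_def set_integral_sgn_measure[OF sm Atmost_borel_on] set_lebesgue_integral_def
  by (rule Bochner_Integration.integral_cong) (auto simp: indicator_def)

lemma abs_cumul_le: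
  assumes sm: "signed_measure (borel_on \<Omega>) \<mu>"
  shows "\<bar>cumul \<mu> x\<bar> \<le> measure (total_variation (borel_on \<Omega>) \<mu>) \<Omega>"
proof -
  interpret finite_measure "total_variation (borel_on \<Omega>) \<mu>"
    by (rule finite_measure_total_variation[OF sm])
  have "\<bar>cumul \<mu> x\<bar> \<le> measure (total_variation (borel_on \<Omega>) \<mu>) ({..x} \<inter> \<Omega>)"
    unfolding cumul_def by (rule abs_le_total_variation[OF sm Atmost_borel_on])
  also have "\<dots> \<le> measure (total_variation (borel_on \<Omega>) \<mu>) \<Omega>"
    using sets.top[of "borel_on \<Omega>"] by (intro finite_measure_mono) auto
  finally show ?thesis .
qed

lemma id_measurable_borel_on: "(\<lambda>x. x) \<in> borel_measurable (borel_on \<Omega>)"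
  by (rule measurable_restrict_space1) simp

lemma id_measurable_L: "(\<lambda>x. x) \<in> borel_measurable L"
  by (rule borel_measurable_lebesgue_on_of_borel_on[OF id_measurable_borel_on])

text \<open>The kernel of the closed ray in \<open>cumul\<close>, in both orders: one for Fubini,
  the other for measurability of \<open>cumul\<close> as an integral with parameter.
  \<open>T\<close> stands for a total variation on Borel sets, while \<open>L\<close> carries the
  Lebesgue sets, so the coordinates are treated separately.\<close>

lemma measurable_triangle_kernel:
  fixes h g :: "real \<Rightarrow> real"
  assumes [measurable]: "h \<in> borel_measurable L" "g \<in> borel_measurable (borel_on \<Omega>)"
    and S: "sets T = sets (borel_on \<Omega>)"
  shows "(\<lambda>(y, x). if y \<le> x then h x * g y else 0) \<in> borel_measurable (T \<Otimes>\<^sub>M L)"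
    and "(\<lambda>(x, y). if y \<le> x then h x * g y else 0) \<in> borel_measurable (L \<Otimes>\<^sub>M T)"
proof -
  have idT: "(\<lambda>x. x) \<in> borel_measurable T" and [measurable]: "g \<in> borel_measurable T"
    using id_measurable_borel_on assms(2) by (simp_all cong: measurable_cong_sets add: measurable_cong_sets[OF S refl])
  have [measurable]: "(\<lambda>p. fst p) \<in> borel_measurable (T \<Otimes>\<^sub>M L)" "(\<lambda>p. snd p) \<in> borel_measurable (T \<Otimes>\<^sub>M L)"
    "(\<lambda>p. fst p) \<in> borel_measurable (L \<Otimes>\<^sub>M T)" "(\<lambda>p. snd p) \<in> borel_measurable (L \<Otimes>\<^sub>M T)"
    by (rule measurable_compose[OF measurable_fst idT] measurable_compose[OF measurable_snd id_measurable_L]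
      measurable_compose[OF measurable_fst id_measurable_L] measurable_compose[OF measurable_snd idT])+
  show "(\<lambda>(y, x). if y \<le> x then h x * g y else 0) \<in> borel_measurable (T \<Otimes>\<^sub>M L)"
    unfolding split_beta' by measurable
  show "(\<lambda>(x, y). if y \<le> x then h x * g y else 0) \<in> borel_measurable (L \<Otimes>\<^sub>M T)"
    unfolding split_beta' by measurable
qed

lemma borel_measurable_cumul:
  assumes sm: "signed_measure (borel_on \<Omega>) \<mu>"
  shows "cumul \<mu> \<in> borel_measurable L"
proof -
  let ?T = "total_variation (borel_on \<Omega>) \<mu>"
  interpret finite_measure ?T by (rule finite_measure_total_variation[OF sm])
  have "(\<lambda>x. \<integral>y. (if y \<le> x then 1 * sgn_measure (borel_on \<Omega>) \<mu> y else 0) \<partial>?T) \<in> borel_measurable L"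
    by (rule borel_measurable_lebesgue_integral)
      (rule measurable_triangle_kernel[OF _ borel_measurable_sgn_measure[OF sm]], simp_all)
  moreover have "cumul \<mu> = (\<lambda>x. \<integral>y. (if y \<le> x then 1 * sgn_measure (borel_on \<Omega>) \<mu> y else 0) \<partial>?T)"
    by (intro ext) (simp only: cumul_eq_integral[OF sm] mult_1)
  ultimately show ?thesis by (simp only:)
qed

lemma bounded_measurable_cumul:
  "signed_measure (borel_on \<Omega>) \<mu> \<Longrightarrow> cumul \<mu> \<in> bounded_measurable L"
  by (rule bounded_measurableI[OF borel_measurable_cumul abs_cumul_le])

lemma integrable_cumul: "signed_measure (borel_on \<Omega>) \<mu> \<Longrightarrow> integrable L (cumul \<mu>)"
  using integrable_bounded_mult[OF bounded_measurable_cumul integrable_L_const[of 1]] by simp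

text \<open>Writing \<open>cumul\<close> as an integral over \<open>y \<le> x\<close> and exchanging
  the order turns the ray below \<open>x\<close> into the ray above \<open>y\<close>. The kernel is
  integrable on the product since the total variation is finite and the inner absolute integral is
  at most \<open>\<integral>\<bar>h\<bar>\<close>.\<close>

lemma Fubini_cumul:
  assumes sm: "signed_measure (borel_on \<Omega>) \<mu>" and h: "integrable L h"
  shows "(\<integral>x. h x * cumul \<mu> x \<partial>L) =
    signed_integral (borel_on \<Omega>) \<mu> (\<lambda>y. \<integral>x. indicator {y..} x * h x \<partial>L)"
proof -
  let ?T = "total_variation (borel_on \<Omega>) \<mu>"
  let ?s = "sgn_measure (borel_on \<Omega>) \<mu>"
  interpret T: finite_measure ?T by (rule finite_measure_total_variation[OF sm])
  interpret L: finite_measure L by (rule finite_measure_lebesgue_on_Ioo)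
  interpret pair_sigma_finite ?T L by standard
  define k where "k y x = (if y \<le> x then h x * ?s y else 0)" for y x
  note sg[measurable] = borel_measurable_sgn_measure[OF sm]
  have km: "case_prod k \<in> borel_measurable (?T \<Otimes>\<^sub>M L)"
    using measurable_triangle_kernel(1)[OF borel_measurable_integrable[OF h] sg, of ?T]
    by (simp add: k_def[abs_def])
  have inner: "(\<lambda>x. k y x) = (\<lambda>x. (indicator {y..} x * h x) * ?s y)" for y
    by (auto simp: k_def indicator_def)
  have ki: "integrable L (k y)" for y
    unfolding inner using integrable_indicator_mult[OF h, of "{y..}"] by simp
  have int: "integrable (?T \<Otimes>\<^sub>M L) (case_prod k)"
  proof (rule Fubini_integrable[OF km])
    show "AE y in ?T. integrable L (\<lambda>x. case_prod k (y, x))" using ki by simp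
    have m: "(\<lambda>y. \<integral>x. norm (case_prod k (y, x)) \<partial>L) \<in> borel_measurable ?T"
      using km by (intro L.borel_measurable_lebesgue_integral) simp
    show "integrable ?T (\<lambda>y. \<integral>x. norm (case_prod k (y, x)) \<partial>L)"
    proof (rule T.integrable_const_bound[OF _ m])
      show "AE y in ?T. norm (\<integral>x. norm (case_prod k (y, x)) \<partial>L) \<le> (\<integral>x. \<bar>h x\<bar> \<partial>L)"
        using AE_abs_sgn_measure[OF sm]
      proof eventually_elim
        case (elim y)
        have "(\<integral>x. \<bar>k y x\<bar> \<partial>L) \<le> (\<integral>x. \<bar>h x\<bar> \<partial>L)"
          by (rule integral_mono[OF integrable_abs[OF ki] integrable_abs[OF h]])
            (auto simp: k_def abs_mult elim)
        moreover have "0 \<le> (\<integral>x. \<bar>k y x\<bar> \<partial>L)" by (rule Bochner_Integration.integral_nonneg) simp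
        ultimately show ?case by simp
      qed
    qed
  qed
  have "(\<integral>x. h x * cumul \<mu> x \<partial>L) = (\<integral>x. (\<integral>y. k y x \<partial>?T) \<partial>L)"
  proof (rule Bochner_Integration.integral_cong[OF refl])
    fix x
    have "h x * cumul \<mu> x = (\<integral>y. h x * (if y \<le> x then ?s y else 0) \<partial>?T)"
      unfolding cumul_eq_integral[OF sm] by simp
    also have "\<dots> = (\<integral>y. k y x \<partial>?T)"
      by (rule Bochner_Integration.integral_cong) (auto simp: k_def)
    finally show "h x * cumul \<mu> x = (\<integral>y. k y x \<partial>?T)" .
  qed
  also have "\<dots> = (\<integral>y. (\<integral>x. k y x \<partial>L) \<partial>?T)"
    by (rule Fubini_integral[OF int])
  also have "\<dots> = signed_integral (borel_on \<Omega>) \<mu> (\<lambda>y. \<integral>x. indicator {y..} x * h x \<partial>L)"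
    unfolding signed_integral_def inner by simp
  finally show ?thesis .
qed

text \<open>The rays \<open>{y..}\<close> and \<open>{..y}\<close> overlap only in \<open>y\<close>,
  a Lebesgue null point.\<close>

lemma integral_indicator_Atleast:
  assumes h: "integrable L h"
  shows "(\<integral>x. indicator {y..} x * h x \<partial>L) = (\<integral>x. h x \<partial>L) - primitive h y"
proof -
  note i = integrable_indicator_mult[OF h, of "{..y}"]
  have "(\<integral>x. indicator {y..} x * h x \<partial>L) = (\<integral>x. h x - indicator {..y} x * h x \<partial>L)"
  proof (rule integral_cong_AE)
    show "AE x in L. indicator {y..} x * h x = h x - indicator {..y} x * h x"
      using AE_L_neq[of y] by eventually_elim (auto simp: indicator_def)
    show "(\<lambda>x. indicator {y..} x * h x) \<in> borel_measurable L"
      using integrable_indicator_mult[OF h, of "{y..}"] by auto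
    show "(\<lambda>x. h x - indicator {..y} x * h x) \<in> borel_measurable L"
      using h i by auto
  qed
  also have "\<dots> = (\<integral>x. h x \<partial>L) - primitive h y"
    using h i by (simp add: primitive_def)
  finally show ?thesis .
qed

text \<open>Dominated convergence with majorant \<open>\<bar>h\<bar>\<close>: away from the single
  point \<open>t = x\<close> the indicators of the rays are eventually equal to the limit
  indicator.\<close>

lemma continuous_primitive:
  assumes h: "integrable L h"
  shows "continuous_on UNIV (primitive h)"
proof (unfold continuous_on_sequentially, intro allI ballI impI)
  fix X :: "nat \<Rightarrow> real" and x :: real
  assume "(\<forall>n. X n \<in> UNIV) \<and> X \<longlonglongrightarrow> x"
  then have X: "X \<longlonglongrightarrow> x" by blast
  have "(\<lambda>n. \<integral>t. indicator {..X n} t * h t \<partial>L) \<longlonglongrightarrow> (\<integral>t. indicator {..x} t * h t \<partial>L)"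
  proof (rule integral_dominated_convergence[where w="\<lambda>t. \<bar>h t\<bar>"])
    show "integrable L (\<lambda>t. \<bar>h t\<bar>)" using h by simp
    have m: "(\<lambda>t. indicator {..y} t * h t) \<in> borel_measurable L" for y
      using integrable_indicator_mult[OF h, of "{..y}"] by auto
    show "(\<lambda>t. indicator {..x} t * h t) \<in> borel_measurable L"
      "\<And>n. (\<lambda>t. indicator {..X n} t * h t) \<in> borel_measurable L" by (rule m)+
    show "AE t in L. norm (indicator {..X n} t * h t) \<le> \<bar>h t\<bar>" for n
      by (rule AE_I2) (auto simp: indicator_def)
    show "AE t in L. (\<lambda>n. indicator {..X n} t * h t) \<longlonglongrightarrow> indicator {..x} t * h t"
      using AE_L_neq[of x]
    proof eventually_elim
      case (elim t)
      have "\<forall>\<^sub>F n in sequentially. indicator {..X n} t = (indicator {..x} t :: real)"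
      proof (cases "t < x")
        case True
        then show ?thesis using order_tendstoD(1)[OF X True] by (auto elim!: eventually_mono)
      next
        case False
        then have xt: "x < t" using elim by simp
        show ?thesis using xt order_tendstoD(2)[OF X xt] by (auto elim!: eventually_mono)
      qed
      then show ?case by (intro tendsto_mult tendsto_const tendsto_eventually)
    qed
  qed
  then show "(primitive h \<circ> X) \<longlonglongrightarrow> primitive h x"
    by (simp add: primitive_def comp_def)
qed

lemma primitive_derivative:
  assumes y: "a \<le> y" "y \<le> b" and F: "\<And>x. (F has_real_derivative F' x) (at x)" and F': "continuous_on UNIV F'"
  shows "primitive F' y = F y - F a"
proof -
  have "primitive F' y = (\<integral>t. indicator \<Omega> t *\<^sub>R (indicator {..y} t * F' t) \<partial>lebesgue)"
    unfolding primitive_def by (rule integral_restrict_space) simp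
  also have "\<dots> = (\<integral>t. indicator {a<..<y} t *\<^sub>R F' t \<partial>lebesgue)"
  proof (rule integral_cong_AE)
    have F'm: "F' \<in> borel_measurable lebesgue"
      using borel_measurable_continuous_onI[OF F'] by (simp add: measurable_completion)
    then show "(\<lambda>t. indicator \<Omega> t *\<^sub>R (indicator {..y} t * F' t)) \<in> borel_measurable lebesgue"
      "(\<lambda>t. indicator {a<..<y} t *\<^sub>R F' t) \<in> borel_measurable lebesgue"
      by (auto intro!: borel_measurable_times borel_measurable_scaleR borel_measurable_indicator)
    show "AE t in lebesgue. indicator \<Omega> t *\<^sub>R (indicator {..y} t * F' t) = indicator {a<..<y} t *\<^sub>R F' t"
      using AE_completion[OF AE_lborel_singleton[of y]] by eventually_elim (use y in \<open>auto simp: indicator_def\<close>)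
  qed
  also have "\<dots> = (\<integral>t. F' t \<partial>lebesgue_on {a<..<y})"
    by (rule integral_restrict_space[symmetric]) simp
  also have "\<dots> = F y - F a" by (rule integral_derivative(2)[OF y(1) F F'])
  finally show ?thesis .
qed

lemma test_function_ends:
  assumes "\<psi> \<in> test_functions \<Omega>"
  shows "\<psi> a = 0" "\<psi> b = 0"
proof -
  obtain c d where "a < c" "d < b" "\<forall>x. x \<notin> {c..d} \<longrightarrow> \<psi> x = 0"
    using assms unfolding test_functions_iff[OF ab] by blast
  then show "\<psi> a = 0" "\<psi> b = 0" by auto
qed

lemma test_function_primitive_deriv:
  assumes \<psi>: "\<psi> \<in> test_functions \<Omega>"
  shows "\<And>y. a \<le> y \<Longrightarrow> y \<le> b \<Longrightarrow> primitive (deriv \<psi>) y = \<psi> y"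
    and "(\<integral>x. deriv \<psi> x \<partial>L) = 0"
proof -
  note s = test_function_smooth[OF \<psi>]
  note c = continuous_on_smooth[OF smooth_deriv[OF s]]
  show "primitive (deriv \<psi>) y = \<psi> y" if "a \<le> y" "y \<le> b" for y
    using primitive_derivative[OF that smooth_has_real_derivative[OF s] c] test_function_ends[OF \<psi>] by simp
  show "(\<integral>x. deriv \<psi> x \<partial>L) = 0"
    using integral_derivative(2)[OF less_imp_le[OF ab] smooth_has_real_derivative[OF s] c]
      test_function_ends[OF \<psi>] by simp
qed

text \<open>The ray integral of \<open>h\<close> above \<open>y\<close> is the mean minus the
  primitive. Mean zero removes the boundary term \<open>(\<integral>h) \<mu>(\<Omega>)\<close>, and
  only the primitive is left.\<close>

lemma integral_mult_cumul:
  assumes sm: "signed_measure (borel_on \<Omega>) \<mu>" and h: "integrable L h" and zero: "(\<integral>x. h x \<partial>L) = 0"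
  shows "(\<integral>x. h x * cumul \<mu> x \<partial>L) = - signed_integral (borel_on \<Omega>) \<mu> (primitive h)"
proof -
  have "(\<integral>x. h x * cumul \<mu> x \<partial>L) = signed_integral (borel_on \<Omega>) \<mu> (\<lambda>y. (-1) * primitive h y)"
    unfolding Fubini_cumul[OF sm h] integral_indicator_Atleast[OF h] zero by simp
  then show ?thesis by (simp only: signed_integral_cmult)
qed

text \<open>Integration by parts is applied to \<open>deriv \<psi>\<close>, which has mean zero and
  primitive \<open>\<psi>\<close>. Every finite signed measure is therefore a distributional
  derivative, and this is what later permits arbitrary perturbations of the residual.\<close>

lemma has_measure_derivative_cumul:
  assumes sm: "signed_measure (borel_on \<Omega>) \<mu>"
  shows "has_measure_derivative \<Omega> (\<lambda>x. k + cumul \<mu> x) \<mu>"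
  unfolding has_measure_derivative_def
proof (rule conjI[OF sm], rule ballI)
  fix \<psi> assume \<psi>: "\<psi> \<in> test_functions \<Omega>"
  note d = smooth_deriv[OF test_function_smooth[OF \<psi>]]
  have int: "integrable L (deriv \<psi>)" by (rule integrable_smooth[OF d])
  have "(\<integral>x. (k + cumul \<mu> x) * deriv \<psi> x \<partial>L) = (\<integral>x. k * deriv \<psi> x + deriv \<psi> x * cumul \<mu> x \<partial>L)"
    by (simp only: distrib_right mult.commute[of "cumul \<mu> _"])
  also have "\<dots> = k * (\<integral>x. deriv \<psi> x \<partial>L) + (\<integral>x. deriv \<psi> x * cumul \<mu> x \<partial>L)"
    using int integrable_smooth_mult[OF d integrable_cumul[OF sm]] by (simp add: mult.commute)
  also have "\<dots> = - signed_integral (borel_on \<Omega>) \<mu> (primitive (deriv \<psi>))"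
    using integral_mult_cumul[OF sm int test_function_primitive_deriv(2)[OF \<psi>]]
      test_function_primitive_deriv(2)[OF \<psi>] by simp
  also have "signed_integral (borel_on \<Omega>) \<mu> (primitive (deriv \<psi>)) = signed_integral (borel_on \<Omega>) \<mu> \<psi>"
    by (rule signed_integral_cong) (use test_function_primitive_deriv(1)[OF \<psi>] in auto)
  finally show "(\<integral>x. (k + cumul \<mu> x) * deriv \<psi> x \<partial>L) = - signed_integral (borel_on \<Omega>) \<mu> \<psi>" .
qed

text \<open>Justifies the definite description in \<open>distr_deriv_def\<close>.\<close>

lemma has_measure_derivative_unique:
  assumes "has_measure_derivative \<Omega> u \<mu>" "has_measure_derivative \<Omega> u \<nu>"
  shows "\<mu> = \<nu>"
proof
  fix A
  have sm: "signed_measure (borel_on \<Omega>) \<mu>" "signed_measure (borel_on \<Omega>) \<nu>"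
    using assms by (auto simp: has_measure_derivative_def)
  \<comment> \<open>Differences of measures are written with explicit coefficients so that they
    match the two-term linearity lemmas; the same device recurs below.\<close>
  have "1 * \<mu> A + (-1) * \<nu> A = 0"
  proof (rule signed_measure_eq_zeroI[OF signed_measure_linear[OF sm]])
    fix \<psi> assume \<psi>: "\<psi> \<in> test_functions \<Omega>"
    have "signed_integral (borel_on \<Omega>) \<mu> \<psi> = signed_integral (borel_on \<Omega>) \<nu> \<psi>"
      using assms \<psi> unfolding has_measure_derivative_def by (metis neg_equal_iff_equal)
    then show "signed_integral (borel_on \<Omega>) (\<lambda>A. 1 * \<mu> A + (-1) * \<nu> A) \<psi> = 0"
      unfolding signed_integral_linear[OF sm bounded_measurable_smooth[OF test_function_smooth[OF \<psi>]]]
      by simp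
  qed
  then show "\<mu> A = \<nu> A" by simp
qed

lemma distr_deriv_eq: "has_measure_derivative \<Omega> u \<mu> \<Longrightarrow> distr_deriv \<Omega> u = \<mu>"
  unfolding distr_deriv_def using has_measure_derivative_unique by blast

lemma has_measure_derivative_distr_deriv:
  "u \<in> BV \<Omega> \<Longrightarrow> has_measure_derivative \<Omega> u (distr_deriv \<Omega> u)"
  using distr_deriv_eq by (auto simp: BV_def)

text \<open>\<open>u\<close> and \<open>cumul \<mu>\<close> have the same measure derivative, so
  their difference has weak derivative zero and the du Bois-Reymond lemma makes it constant.\<close>

lemma BV_representation:
  assumes u: "integrable L u" "has_measure_derivative \<Omega> u \<mu>"
  shows "\<exists>k. AE x in L. u x = k + cumul \<mu> x"
proof -
  have sm: "signed_measure (borel_on \<Omega>) \<mu>" using u by (simp add: has_measure_derivative_def)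
  note c = has_measure_derivative_cumul[OF sm, of 0]
  have "\<exists>k. AE x in L. u x - cumul \<mu> x = k"
  proof (rule du_Bois_Reymond)
    show "integrable L (\<lambda>x. u x - cumul \<mu> x)"
      by (rule Bochner_Integration.integrable_diff[OF u(1) integrable_cumul[OF sm]])
    fix \<psi> assume \<psi>: "\<psi> \<in> test_functions \<Omega>"
    note d = smooth_deriv[OF test_function_smooth[OF \<psi>]]
    have "(\<integral>x. (u x - cumul \<mu> x) * deriv \<psi> x \<partial>L) =
        (\<integral>x. u x * deriv \<psi> x \<partial>L) - (\<integral>x. cumul \<mu> x * deriv \<psi> x \<partial>L)"
      using integrable_smooth_mult[OF d u(1)] integrable_smooth_mult[OF d integrable_cumul[OF sm]]
      by (simp add: left_diff_distrib)
    also have "\<dots> = 0"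
      using u(2) c \<psi> by (simp add: has_measure_derivative_def)
    finally show "(\<integral>x. (u x - cumul \<mu> x) * deriv \<psi> x \<partial>L) = 0" .
  qed
  then obtain k where "AE x in L. u x - cumul \<mu> x = k" by blast
  then have "AE x in L. u x = k + cumul \<mu> x" by eventually_elim simp
  then show ?thesis by blast
qed

lemma has_measure_derivative_linear:
  assumes u: "integrable L u" "has_measure_derivative \<Omega> u \<mu>"
    and v: "integrable L v" "has_measure_derivative \<Omega> v \<nu>"
  shows "has_measure_derivative \<Omega> (\<lambda>x. s * u x + t * v x) (\<lambda>A. s * \<mu> A + t * \<nu> A)"
proof -
  have sm: "signed_measure (borel_on \<Omega>) \<mu>" "signed_measure (borel_on \<Omega>) \<nu>"
    using u v by (auto simp: has_measure_derivative_def)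
  show ?thesis
    unfolding has_measure_derivative_def
  proof (intro conjI ballI signed_measure_linear sm)
    fix \<psi> assume \<psi>: "\<psi> \<in> test_functions \<Omega>"
    note s = test_function_smooth[OF \<psi>]
    have "(\<integral>x. (s * u x + t * v x) * deriv \<psi> x \<partial>L) =
        s * (\<integral>x. u x * deriv \<psi> x \<partial>L) + t * (\<integral>x. v x * deriv \<psi> x \<partial>L)"
      using integrable_smooth_mult[OF smooth_deriv[OF s] u(1)] integrable_smooth_mult[OF smooth_deriv[OF s] v(1)]
      by (simp add: distrib_right mult.assoc)
    also have "\<dots> = - (s * signed_integral (borel_on \<Omega>) \<mu> \<psi> + t * signed_integral (borel_on \<Omega>) \<nu> \<psi>)"
      using u(2) v(2) \<psi> by (simp add: has_measure_derivative_def)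
    finally show "(\<integral>x. (s * u x + t * v x) * deriv \<psi> x \<partial>L) =
        - signed_integral (borel_on \<Omega>) (\<lambda>A. s * \<mu> A + t * \<nu> A) \<psi>"
      unfolding signed_integral_linear[OF sm bounded_measurable_smooth[OF s]] .
  qed
qed

lemma BV_AE_bounded:
  assumes "u \<in> BV \<Omega>"
  shows "\<exists>K. AE x in L. \<bar>u x\<bar> \<le> K"
proof -
  have u: "integrable L u" "has_measure_derivative \<Omega> u (distr_deriv \<Omega> u)"
    using assms has_measure_derivative_distr_deriv by (auto simp: BV_def)
  then have sm: "signed_measure (borel_on \<Omega>) (distr_deriv \<Omega> u)" by (simp add: has_measure_derivative_def)
  obtain k where "AE x in L. u x = k + cumul (distr_deriv \<Omega> u) x"
    using BV_representation[OF u] by blast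
  then have "AE x in L. \<bar>u x\<bar> \<le> \<bar>k\<bar> + measure (total_variation (borel_on \<Omega>) (distr_deriv \<Omega> u)) \<Omega>"
    by eventually_elim (use abs_cumul_le[OF sm] in \<open>auto intro: order_trans[OF abs_triangle_ineq]\<close>)
  then show ?thesis by blast
qed

text \<open>Here \<open>h\<close> is merely integrable and no test function. The constant in the
  representation of \<open>u\<close> is paired with \<open>\<integral>h = 0\<close>, so only
  \<open>cumul\<close> contributes; its boundedness gives integrability of the product.\<close>

lemma BV_integral_by_parts:
  assumes u: "u \<in> BV \<Omega>" and h: "integrable L h" and zero: "(\<integral>x. h x \<partial>L) = 0"
  shows "integrable L (\<lambda>x. h x * u x)"
    and "(\<integral>x. h x * u x \<partial>L) = - signed_integral (borel_on \<Omega>) (distr_deriv \<Omega> u) (primitive h)"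
proof -
  have u': "integrable L u" "has_measure_derivative \<Omega> u (distr_deriv \<Omega> u)"
    using u has_measure_derivative_distr_deriv by (auto simp: BV_def)
  then have sm: "signed_measure (borel_on \<Omega>) (distr_deriv \<Omega> u)" by (simp add: has_measure_derivative_def)
  obtain k where k: "AE x in L. u x = k + cumul (distr_deriv \<Omega> u) x"
    using BV_representation[OF u'] by blast
  have i: "integrable L (\<lambda>x. h x * cumul (distr_deriv \<Omega> u) x)"
    using integrable_bounded_mult[OF bounded_measurable_cumul[OF sm] h] by (simp add: mult.commute)
  have m: "(\<lambda>x. h x * u x) \<in> borel_measurable L"
    by (rule borel_measurable_times[OF borel_measurable_integrable[OF h] borel_measurable_integrable[OF u'(1)]])
  have eq: "AE x in L. k * h x + h x * cumul (distr_deriv \<Omega> u) x = h x * u x"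
    using k by eventually_elim (simp add: algebra_simps)
  have i2: "integrable L (\<lambda>x. k * h x + h x * cumul (distr_deriv \<Omega> u) x)"
    using i h by simp
  show "integrable L (\<lambda>x. h x * u x)"
    using integrable_cong_AE_imp[OF i2 m] eq by (auto elim: eventually_mono)
  have "(\<integral>x. h x * u x \<partial>L) = (\<integral>x. k * h x + h x * cumul (distr_deriv \<Omega> u) x \<partial>L)"
    using eq by (intro integral_cong_AE m borel_measurable_integrable[OF i2]) (auto elim: eventually_mono)
  also have "\<dots> = k * (\<integral>x. h x \<partial>L) + (\<integral>x. h x * cumul (distr_deriv \<Omega> u) x \<partial>L)"
    using i h by simp
  finally show "(\<integral>x. h x * u x \<partial>L) = - signed_integral (borel_on \<Omega>) (distr_deriv \<Omega> u) (primitive h)"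
    using integral_mult_cumul[OF sm h zero] zero by simp
qed

end

section \<open>Lebesgue spaces and conjugate exponents\<close>

lemma LpD:
  assumes "f \<in> Lp M p"
  shows "f \<in> borel_measurable M" "integrable M (\<lambda>x. \<bar>f x\<bar> powr p)"
  using assms by (auto simp: Lp_def)

lemma Lp_norm_nonneg: "0 \<le> Lp_norm M p f"
  by (simp add: Lp_norm_def)

lemma Lp_norm_powr:
  assumes "0 < p"
  shows "Lp_norm M p f powr p = (\<integral>x. \<bar>f x\<bar> powr p \<partial>M)"
proof -
  have "0 \<le> (\<integral>x. \<bar>f x\<bar> powr p \<partial>M)" by (rule Bochner_Integration.integral_nonneg) simp
  then show ?thesis using assms by (simp add: Lp_norm_def powr_powr)
qed

lemma Lp_norm_leI:
  assumes "0 < p" "0 \<le> S" "(\<integral>x. \<bar>f x\<bar> powr p \<partial>M) \<le> S powr p"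
  shows "Lp_norm M p f \<le> S"
proof -
  have "Lp_norm M p f \<le> (S powr p) powr (1 / p)"
    unfolding Lp_norm_def using assms
    by (intro powr_mono2) (auto intro: Bochner_Integration.integral_nonneg)
  also have "\<dots> = S" using assms by (simp add: powr_powr)
  finally show ?thesis .
qed

lemma Lp_norm_cong_AE:
  assumes "AE x in M. f x = g x" "f \<in> borel_measurable M" "g \<in> borel_measurable M"
  shows "Lp_norm M p f = Lp_norm M p g"
proof -
  have "(\<integral>x. \<bar>f x\<bar> powr p \<partial>M) = (\<integral>x. \<bar>g x\<bar> powr p \<partial>M)"
  proof (rule integral_cong_AE)
    show "AE x in M. \<bar>f x\<bar> powr p = \<bar>g x\<bar> powr p" using assms(1) by eventually_elim simp
  qed (use assms in measurable)
  then show ?thesis by (simp add: Lp_norm_def)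
qed

lemma Lp_norm_eq_0_iff:
  assumes "0 < p" "f \<in> Lp M p"
  shows "Lp_norm M p f = 0 \<longleftrightarrow> (AE x in M. f x = 0)"
proof -
  have "Lp_norm M p f = 0 \<longleftrightarrow> (\<integral>x. \<bar>f x\<bar> powr p \<partial>M) = 0"
    by (simp add: Lp_norm_def)
  also have "\<dots> \<longleftrightarrow> (AE x in M. \<bar>f x\<bar> powr p = 0)"
    by (rule integral_nonneg_eq_0_iff_AE[OF LpD(2)[OF assms(2)]]) simp
  finally show ?thesis by simp
qed

lemma Lp_cmult:
  assumes "f \<in> Lp M p"
  shows "(\<lambda>x. c * f x) \<in> Lp M p"
  using assms by (auto simp: Lp_def abs_mult powr_mult)

lemma Lp_norm_cmult:
  assumes "0 < p"
  shows "Lp_norm M p (\<lambda>x. c * f x) = \<bar>c\<bar> * Lp_norm M p f"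
proof -
  have "0 \<le> (\<integral>x. \<bar>f x\<bar> powr p \<partial>M)" by (rule Bochner_Integration.integral_nonneg) simp
  then show ?thesis
    using assms by (simp add: Lp_norm_def abs_mult powr_mult powr_powr)
qed

text \<open>Convexity of the power on the open half-line is extended to the end point 0, where it
  reduces to \<open>t powr p \<le> t\<close> for \<open>t\<close> between 0 and 1.\<close>

lemma powr_convex_nonneg:
  fixes u v \<theta> p :: real
  assumes p: "1 \<le> p" and "0 \<le> u" "0 \<le> v" "0 \<le> \<theta>" "\<theta> \<le> 1"
  shows "(\<theta> * u + (1 - \<theta>) * v) powr p \<le> \<theta> * u powr p + (1 - \<theta>) * v powr p"
proof -
  have le: "(t * s) powr p \<le> t * s powr p" if "0 \<le> t" "t \<le> 1" "0 \<le> s" for t s :: real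
  proof -
    have "t powr p \<le> t"
      using that p powr_mono'[of 1 p t] by (cases "t = 0") auto
    then show ?thesis using that by (simp add: powr_mult mult_right_mono)
  qed
  consider "u = 0" | "v = 0" | "0 < u" "0 < v" using assms by linarith
  then show ?thesis
  proof cases
    case 3
    have "convex_on {0<..} (\<lambda>x. x powr p)" by (rule powr_convex[OF p])
    from convex_onD[OF this, of "1 - \<theta>" u v] show ?thesis
      using 3 assms by (simp add: algebra_simps)
  qed (use le[of "1 - \<theta>" v] le[of \<theta> u] assms in auto)
qed

text \<open>The pointwise core of Minkowski's inequality:
  \<open>(\<bar>x\<bar> + \<bar>y\<bar>) / (S + T)\<close> is the convex combination of
  \<open>\<bar>x\<bar> / S\<close> and \<open>\<bar>y\<bar> / T\<close> with weights proportional to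
  \<open>S\<close> and \<open>T\<close>.\<close>

lemma abs_add_powr_le:
  fixes x y S T p :: real
  assumes p: "1 \<le> p" and ST: "0 < S" "0 < T"
  shows "(\<bar>x + y\<bar> / (S + T)) powr p \<le> S / (S + T) * (\<bar>x\<bar> / S) powr p + T / (S + T) * (\<bar>y\<bar> / T) powr p"
proof -
  have 1: "1 - S / (S + T) = T / (S + T)" using ST by (simp add: field_simps)
  have "\<bar>x + y\<bar> / (S + T) \<le> (\<bar>x\<bar> + \<bar>y\<bar>) / (S + T)"
    using ST by (intro divide_right_mono) auto
  also have "\<dots> = S / (S + T) * (\<bar>x\<bar> / S) + T / (S + T) * (\<bar>y\<bar> / T)"
    using ST by (simp add: add_divide_distrib)
  finally have "(\<bar>x + y\<bar> / (S + T)) powr p \<le> (S / (S + T) * (\<bar>x\<bar> / S) + T / (S + T) * (\<bar>y\<bar> / T)) powr p"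
    using p ST by (intro powr_mono2) auto
  also have "\<dots> \<le> S / (S + T) * (\<bar>x\<bar> / S) powr p + T / (S + T) * (\<bar>y\<bar> / T) powr p"
    using powr_convex_nonneg[OF p, of "\<bar>x\<bar> / S" "\<bar>y\<bar> / T" "S / (S + T)"] ST unfolding 1 by simp
  finally show ?thesis .
qed

lemma Lp_add:
  assumes p: "1 \<le> p" and f: "f \<in> Lp M p" and g: "g \<in> Lp M p"
  shows "(\<lambda>x. f x + g x) \<in> Lp M p"
proof -
  note [measurable] = LpD(1)[OF f] LpD(1)[OF g]
  have "integrable M (\<lambda>x. \<bar>f x + g x\<bar> powr p)"
  proof (rule Bochner_Integration.integrable_bound)
    show "integrable M (\<lambda>x. 2 powr p * (\<bar>f x\<bar> powr p + \<bar>g x\<bar> powr p))"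
      using LpD(2)[OF f] LpD(2)[OF g] by simp
    show "AE x in M. norm (\<bar>f x + g x\<bar> powr p) \<le> norm (2 powr p * (\<bar>f x\<bar> powr p + \<bar>g x\<bar> powr p))"
    proof (rule AE_I2)
      fix x
      have "(\<bar>f x + g x\<bar> / 2) powr p \<le> \<bar>f x\<bar> powr p / 2 + \<bar>g x\<bar> powr p / 2"
        using abs_add_powr_le[OF p, of 1 1 "f x" "g x"] by simp
      also have "\<dots> \<le> \<bar>f x\<bar> powr p + \<bar>g x\<bar> powr p" by (intro add_mono) auto
      finally have "(\<bar>f x + g x\<bar> / 2) powr p \<le> \<bar>f x\<bar> powr p + \<bar>g x\<bar> powr p" .
      moreover have "\<bar>f x + g x\<bar> powr p = 2 powr p * (\<bar>f x + g x\<bar> / 2) powr p"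
        by (simp add: powr_divide)
      ultimately show "norm (\<bar>f x + g x\<bar> powr p) \<le> norm (2 powr p * (\<bar>f x\<bar> powr p + \<bar>g x\<bar> powr p))"
        by (simp add: mult_left_mono)
    qed
  qed measurable
  then show ?thesis by (simp add: Lp_def)
qed

text \<open>The pointwise estimate is integrated with \<open>S\<close> and \<open>T\<close> equal to
  the two norms; the normalized powers then have integral 1 and the weights add up to 1. If a norm
  vanishes, one of the functions is null and drops out.\<close>

lemma Lp_norm_triangle:
  assumes p: "1 \<le> p" and f: "f \<in> Lp M p" and g: "g \<in> Lp M p"
  shows "Lp_norm M p (\<lambda>x. f x + g x) \<le> Lp_norm M p f + Lp_norm M p g"
proof -
  note m[measurable] = LpD(1)[OF f] LpD(1)[OF g]
  let ?S = "Lp_norm M p f" and ?T = "Lp_norm M p g"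
  consider "?S = 0" | "?T = 0" | "0 < ?S" "0 < ?T"
    using Lp_norm_nonneg[of M p f] Lp_norm_nonneg[of M p g] by linarith
  then show ?thesis
  proof cases
    case 1
    then have "AE x in M. f x + g x = g x"
      using Lp_norm_eq_0_iff[OF _ f] p by (auto elim: eventually_mono)
    then have "Lp_norm M p (\<lambda>x. f x + g x) = ?T" by (rule Lp_norm_cong_AE) measurable
    then show ?thesis using 1 by simp
  next
    case 2
    then have "AE x in M. f x + g x = f x"
      using Lp_norm_eq_0_iff[OF _ g] p by (auto elim: eventually_mono)
    then have "Lp_norm M p (\<lambda>x. f x + g x) = ?S" by (rule Lp_norm_cong_AE) measurable
    then show ?thesis using 2 by simp
  next
    case 3
    define c where "c = ?S + ?T"
    have c: "0 < c" using 3 by (simp add: c_def)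
    have one: "(\<integral>x. (\<bar>h x\<bar> / Lp_norm M p h) powr p \<partial>M) = 1"
      and int: "integrable M (\<lambda>x. (\<bar>h x\<bar> / Lp_norm M p h) powr p)"
      if h: "h \<in> Lp M p" "0 < Lp_norm M p h" for h
    proof -
      have "(\<integral>x. (\<bar>h x\<bar> / Lp_norm M p h) powr p \<partial>M) = (\<integral>x. \<bar>h x\<bar> powr p \<partial>M) / Lp_norm M p h powr p"
        using h(2) by (simp add: powr_divide)
      also have "\<dots> = 1"
        using h(2) p by (simp add: Lp_norm_powr[symmetric])
      finally show "(\<integral>x. (\<bar>h x\<bar> / Lp_norm M p h) powr p \<partial>M) = 1" .
      show "integrable M (\<lambda>x. (\<bar>h x\<bar> / Lp_norm M p h) powr p)"
        using LpD(2)[OF h(1)] h(2) by (simp add: powr_divide)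
    qed
    have i: "integrable M (\<lambda>x. (\<bar>f x + g x\<bar> / c) powr p)"
      using LpD(2)[OF Lp_add[OF p f g]] c by (simp add: powr_divide)
    have "(\<integral>x. (\<bar>f x + g x\<bar> / c) powr p \<partial>M) \<le>
        (\<integral>x. ?S / c * (\<bar>f x\<bar> / ?S) powr p + ?T / c * (\<bar>g x\<bar> / ?T) powr p \<partial>M)"
    proof (rule integral_mono[OF i])
      show "integrable M (\<lambda>x. ?S / c * (\<bar>f x\<bar> / ?S) powr p + ?T / c * (\<bar>g x\<bar> / ?T) powr p)"
        by (intro Bochner_Integration.integrable_add integrable_mult_right int f g 3)
      show "(\<bar>f x + g x\<bar> / c) powr p \<le> ?S / c * (\<bar>f x\<bar> / ?S) powr p + ?T / c * (\<bar>g x\<bar> / ?T) powr p" for x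
        unfolding c_def by (rule abs_add_powr_le[OF p 3])
    qed
    also have "\<dots> = ?S / c * 1 + ?T / c * 1"
      using int[OF f 3(1)] int[OF g 3(2)] by (simp only: Bochner_Integration.integral_add
          integrable_mult_right integral_mult_right_zero one[OF f 3(1)] one[OF g 3(2)])
    also have "\<dots> = 1" using c by (simp add: c_def add_divide_distrib[symmetric])
    finally have "(\<integral>x. \<bar>f x + g x\<bar> powr p \<partial>M) / c powr p \<le> 1"
      using c by (simp add: powr_divide)
    then have "(\<integral>x. \<bar>f x + g x\<bar> powr p \<partial>M) \<le> c powr p"
      using c by (simp add: divide_le_eq)
    then show ?thesis
      using Lp_norm_leI[of p c] p c by (simp add: c_def)
  qed
qed

lemma Lp_diff:
  assumes "1 \<le> p" "f \<in> Lp M p" "g \<in> Lp M p"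
  shows "(\<lambda>x. f x - g x) \<in> Lp M p"
  using Lp_add[OF assms(1,2) Lp_cmult[OF assms(3), of "-1"]] by simp

lemma Lp_AE_bound:
  assumes "0 < p" "w \<in> Lp M p" "g \<in> borel_measurable M" "AE x in M. \<bar>g x\<bar> \<le> w x"
  shows "g \<in> Lp M p"
proof -
  have "integrable M (\<lambda>x. \<bar>g x\<bar> powr p)"
  proof (rule Bochner_Integration.integrable_bound[OF LpD(2)[OF assms(2)]])
    show "AE x in M. norm (\<bar>g x\<bar> powr p) \<le> norm (\<bar>w x\<bar> powr p)"
      using assms(4) by eventually_elim (use assms(1) in \<open>auto intro!: powr_mono2\<close>)
  qed (use assms(3) in measurable)
  then show ?thesis using assms(3) by (simp add: Lp_def)
qed

lemma Lp_dominated_convergence: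
  assumes p: "0 < p" and w: "w \<in> Lp M p"
    and g: "\<And>n. g n \<in> borel_measurable M" and h: "h \<in> borel_measurable M"
    and bound: "\<And>n. AE x in M. \<bar>g n x\<bar> \<le> w x"
    and lim: "AE x in M. (\<lambda>n. g n x) \<longlonglongrightarrow> h x"
  shows "(\<lambda>n. Lp_norm M p (\<lambda>x. g n x - h x)) \<longlonglongrightarrow> 0"
proof -
  note [measurable] = g h LpD(1)[OF w]
  have all: "AE x in M. \<forall>n. \<bar>g n x\<bar> \<le> w x" using bound by (simp add: AE_all_countable)
  have hw: "AE x in M. \<bar>h x\<bar> \<le> w x"
    using all lim
  proof eventually_elim
    case (elim x)
    have "(\<lambda>n. \<bar>g n x\<bar>) \<longlonglongrightarrow> \<bar>h x\<bar>" by (rule tendsto_rabs[OF elim(2)])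
    then show ?case by (rule LIMSEQ_le_const2) (use elim(1) in auto)
  qed
  have "(\<lambda>n. \<integral>x. \<bar>g n x - h x\<bar> powr p \<partial>M) \<longlonglongrightarrow> (\<integral>x. 0 \<partial>M)"
  proof (rule integral_dominated_convergence[where w="\<lambda>x. 2 powr p * \<bar>w x\<bar> powr p"])
    show "integrable M (\<lambda>x. 2 powr p * \<bar>w x\<bar> powr p)" using LpD(2)[OF w] by simp
    show "AE x in M. (\<lambda>n. \<bar>g n x - h x\<bar> powr p) \<longlonglongrightarrow> 0"
      using lim
    proof eventually_elim
      case (elim x)
      have "(\<lambda>n. \<bar>g n x - h x\<bar>) \<longlonglongrightarrow> 0"
        using tendsto_rabs[OF tendsto_diff[OF elim tendsto_const[of "h x"]]] by simp
      then show ?case by (rule tendsto_zero_powrI[OF _ tendsto_const]) (use p in auto)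
    qed
    show "AE x in M. norm (\<bar>g n x - h x\<bar> powr p) \<le> 2 powr p * \<bar>w x\<bar> powr p" for n
      using bound[of n] hw
    proof eventually_elim
      case (elim x)
      then have "\<bar>g n x - h x\<bar> \<le> 2 * \<bar>w x\<bar>" by linarith
      then have "\<bar>g n x - h x\<bar> powr p \<le> (2 * \<bar>w x\<bar>) powr p" using p by (intro powr_mono2) auto
      then show ?case by (simp add: powr_mult)
    qed
  qed simp_all
  then have "(\<lambda>n. \<integral>x. \<bar>g n x - h x\<bar> powr p \<partial>M) \<longlonglongrightarrow> 0" by simp
  then show ?thesis
    unfolding Lp_norm_def
    by (rule tendsto_zero_powrI[OF _ tendsto_const])
      (use p in \<open>auto intro!: always_eventually Bochner_Integration.integral_nonneg\<close>)
qed

lemma Lp_norm_mono: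
  assumes p: "0 < p" and g: "g \<in> Lp M p" and f: "f \<in> borel_measurable M" and le: "AE x in M. \<bar>f x\<bar> \<le> \<bar>g x\<bar>"
  shows "Lp_norm M p f \<le> Lp_norm M p g"
proof (rule Lp_norm_leI[OF p Lp_norm_nonneg])
  have ga: "(\<lambda>x. \<bar>g x\<bar>) \<in> Lp M p" using g by (auto simp: Lp_def)
  have "(\<integral>x. \<bar>f x\<bar> powr p \<partial>M) \<le> (\<integral>x. \<bar>g x\<bar> powr p \<partial>M)"
  proof (rule integral_mono_AE[OF LpD(2)[OF Lp_AE_bound[OF p ga f le]] LpD(2)[OF g]])
    show "AE x in M. \<bar>f x\<bar> powr p \<le> \<bar>g x\<bar> powr p"
      using le by eventually_elim (use p in \<open>auto intro!: powr_mono2\<close>)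
  qed
  then show "(\<integral>x. \<bar>f x\<bar> powr p \<partial>M) \<le> Lp_norm M p g powr p"
    by (simp only: Lp_norm_powr[OF p])
qed

text \<open>Equality says that the product \<open>m\<close> is both the weighted arithmetic and the
  weighted geometric mean of \<open>u = x powr q\<close> and \<open>v = y powr p\<close>. The
  defects \<open>A\<close> and \<open>B\<close> of \<open>ln s \<le> s - 1\<close> at
  \<open>u / m\<close> and \<open>v / m\<close> are nonnegative with weighted sum 0, so
  \<open>u = m = v\<close>.\<close>

lemma Young_equality:
  fixes x y p q :: real
  assumes pq: "1 < p" "1 < q" "1 / p + 1 / q = 1" and xy: "0 \<le> x" "0 \<le> y"
    and eq: "x * y = x powr q / q + y powr p / p"
  shows "x = y powr (p - 1)"
proof (cases "x = 0 \<or> y = 0")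
  case True
  then have "x powr q / q + y powr p / p = 0" using eq by auto
  then have "x powr q / q = 0 \<and> y powr p / p = 0"
    using pq by (subst (asm) add_nonneg_eq_0_iff) auto
  then show ?thesis using pq by auto
next
  case False
  then have pos: "0 < x" "0 < y" using xy by auto
  define u where "u = x powr q"
  define v where "v = y powr p"
  define m where "m = x * y"
  have uvm: "0 < u" "0 < v" "0 < m" using pos by (auto simp: u_def v_def m_def)
  have m: "m = u / q + v / p" using eq by (simp add: u_def v_def m_def)
  have "ln m = ln x + ln y" using pos by (simp add: m_def ln_mult)
  also have "\<dots> = 1 / q * ln u + 1 / p * ln v"
    using pos pq by (simp add: u_def v_def ln_powr)
  finally have lnm: "ln m = 1 / q * ln u + 1 / p * ln v" .
  define A where "A = u / m - 1 - ln (u / m)"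
  define B where "B = v / m - 1 - ln (v / m)"
  have AB: "0 \<le> A" "0 \<le> B"
    using uvm ln_le_minus_one[of "u / m"] ln_le_minus_one[of "v / m"] by (auto simp: A_def B_def)
  have "A = u / m - 1 - ln u + ln m" "B = v / m - 1 - ln v + ln m"
    using uvm by (simp_all add: A_def B_def ln_div)
  then have "1 / q * A + 1 / p * B = (u / q + v / p) / m - (1 / p + 1 / q) - (1 / q * ln u + 1 / p * ln v)
      + (1 / p + 1 / q) * ln m"
    by (simp only: add_divide_distrib distrib_left distrib_right right_diff_distrib) simp
  also have "\<dots> = 0"
    unfolding pq(3) lnm[symmetric] m[symmetric] using uvm by simp
  finally have "1 / q * A = 0 \<and> 1 / p * B = 0"
    using AB pq by (subst (asm) add_nonneg_eq_0_iff) auto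
  then have "A = 0" "B = 0" using pq by auto
  then have "u / m = 1" "v / m = 1"
    using uvm ln_eq_minus_one[of "u / m"] ln_eq_minus_one[of "v / m"] by (simp_all add: A_def B_def)
  then have "u = v" using uvm by simp
  have "x = u powr (1 / q)" using pos pq by (simp add: u_def powr_powr)
  also have "\<dots> = y powr (p / q)" using \<open>u = v\<close> by (simp add: v_def powr_powr)
  also have "p / q = p - 1" using pq by (simp add: field_simps)
  finally show ?thesis .
qed

lemma conj_exponent:
  fixes p q :: real
  assumes "1 < p" "q = p / (p - 1)"
  shows "1 < q" "1 / p + 1 / q = 1" "(p - 1) * q = p" "(q - 1) * p = q"
proof -
  have "0 < p - 1" "p - 1 \<noteq> 0" "p \<noteq> 0" using assms by auto
  then show "1 < q" "1 / p + 1 / q = 1" "(p - 1) * q = p" "(q - 1) * p = q"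
    unfolding assms(2) by (auto simp: divide_simps)
qed

text \<open>For \<open>r < 2\<close> the exponent is negative, and at \<open>x = 0\<close> the
  expression means 0; this agrees with the convention \<open>0 powr s = 0\<close>.\<close>

lemma abs_powr_mult:
  fixes x r :: real
  shows "\<bar>\<bar>x\<bar> powr (r - 2) * x\<bar> = \<bar>x\<bar> powr (r - 1)"
    and "x * (\<bar>x\<bar> powr (r - 2) * x) = \<bar>x\<bar> powr r"
proof -
  have "\<bar>x\<bar> powr (r - 2) * \<bar>x\<bar> = \<bar>x\<bar> powr (r - 1)"
  proof (cases "x = 0")
    case False
    then have "\<bar>x\<bar> powr (r - 2) * \<bar>x\<bar> powr 1 = \<bar>x\<bar> powr (r - 1)"
      by (simp only: powr_add[symmetric]) simp
    then show ?thesis using False by simp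
  qed simp
  then show "\<bar>\<bar>x\<bar> powr (r - 2) * x\<bar> = \<bar>x\<bar> powr (r - 1)" by (simp add: abs_mult)
  show "x * (\<bar>x\<bar> powr (r - 2) * x) = \<bar>x\<bar> powr r"
  proof (cases "x = 0")
    case False
    have "x * (\<bar>x\<bar> powr (r - 2) * x) = \<bar>x\<bar> powr (r - 2) * \<bar>x\<bar> powr 2"
      using False by (simp add: power2_eq_square)
    also have "\<dots> = \<bar>x\<bar> powr r" by (simp only: powr_add[symmetric]) simp
    finally show ?thesis .
  qed simp
qed

section \<open>Hoelder's inequality, its equality case and duality\<close>

context
  fixes M :: "'a measure" and p q :: real
  assumes p: "1 < p" and q: "q = p / (p - 1)"
begin

lemma integrable_Lp_mult:
  assumes f: "f \<in> Lp M q" and g: "g \<in> Lp M p"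
  shows "integrable M (\<lambda>x. f x * g x)"
proof (rule Bochner_Integration.integrable_bound)
  show "integrable M (\<lambda>x. \<bar>f x\<bar> powr q / q + \<bar>g x\<bar> powr p / p)"
    using LpD(2)[OF f] LpD(2)[OF g] by simp
  show "(\<lambda>x. f x * g x) \<in> borel_measurable M"
    using LpD(1)[OF f] LpD(1)[OF g] by measurable
  show "AE x in M. norm (f x * g x) \<le> norm (\<bar>f x\<bar> powr q / q + \<bar>g x\<bar> powr p / p)"
  proof (rule AE_I2)
    fix x
    have "\<bar>f x\<bar> * \<bar>g x\<bar> \<le> \<bar>f x\<bar> powr q / q + \<bar>g x\<bar> powr p / p"
      using p conj_exponent[OF p q] by (intro Youngs_inequality) auto
    then show "norm (f x * g x) \<le> norm (\<bar>f x\<bar> powr q / q + \<bar>g x\<bar> powr p / p)"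
      by (simp add: abs_mult)
  qed
qed

lemma Holder_inequality:
  assumes f: "f \<in> Lp M q" and g: "g \<in> Lp M p"
  shows "(\<integral>x. f x * g x \<partial>M) \<le> Lp_norm M q f * Lp_norm M p g"
proof -
  note c = conj_exponent[OF p q]
  let ?S = "Lp_norm M q f" and ?T = "Lp_norm M p g"
  have z: "(\<integral>x. f x * g x \<partial>M) = 0" if "AE x in M. f x * g x = 0"
    using integral_cong_AE[OF _ _ that] borel_measurable_integrable[OF integrable_Lp_mult[OF f g]] by simp
  consider "?S = 0" | "?T = 0" | "0 < ?S" "0 < ?T"
    using Lp_norm_nonneg[of M q f] Lp_norm_nonneg[of M p g] by linarith
  then show ?thesis
  proof cases
    case 1
    then have "AE x in M. f x * g x = 0"
      using Lp_norm_eq_0_iff[OF _ f] c(1) by (auto elim: eventually_mono)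
    then show ?thesis using 1 z by simp
  next
    case 2
    then have "AE x in M. f x * g x = 0"
      using Lp_norm_eq_0_iff[OF _ g] p by (auto elim: eventually_mono)
    then show ?thesis using 2 z by simp
  next
    case 3
    have "(\<integral>x. f x * g x \<partial>M) / (?S * ?T) = (\<integral>x. f x * g x / (?S * ?T) \<partial>M)" by simp
    also have "\<dots> \<le> (\<integral>x. \<bar>f x\<bar> powr q / ?S powr q / q + \<bar>g x\<bar> powr p / ?T powr p / p \<partial>M)"
    proof (rule integral_mono)
      show "integrable M (\<lambda>x. f x * g x / (?S * ?T))" using integrable_Lp_mult[OF f g] by simp
      show "integrable M (\<lambda>x. \<bar>f x\<bar> powr q / ?S powr q / q + \<bar>g x\<bar> powr p / ?T powr p / p)"
        using LpD(2)[OF f] LpD(2)[OF g] by simp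
      fix x
      have "f x * g x / (?S * ?T) \<le> (\<bar>f x\<bar> / ?S) * (\<bar>g x\<bar> / ?T)"
        using 3 abs_ge_self[of "f x * g x"] by (simp add: abs_mult divide_right_mono)
      also have "\<dots> \<le> (\<bar>f x\<bar> / ?S) powr q / q + (\<bar>g x\<bar> / ?T) powr p / p"
        using p c 3 by (intro Youngs_inequality) auto
      finally show "f x * g x / (?S * ?T) \<le> \<bar>f x\<bar> powr q / ?S powr q / q + \<bar>g x\<bar> powr p / ?T powr p / p"
        using 3 by (simp add: powr_divide)
    qed
    also have "\<dots> = (\<integral>x. \<bar>f x\<bar> powr q \<partial>M) / ?S powr q / q + (\<integral>x. \<bar>g x\<bar> powr p \<partial>M) / ?T powr p / p"
      using LpD(2)[OF f] LpD(2)[OF g] by simp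
    also have "\<dots> = 1"
      using p c 3 by (simp add: Lp_norm_powr[symmetric] add.commute)
    finally show ?thesis using 3 by (simp add: divide_le_eq)
  qed
qed

text \<open>The bound is tested on the extremal function
  \<open>\<bar>f\<bar> powr (q - 2) * f\<close>, for which both \<open>f * g\<close> and
  \<open>\<bar>g\<bar> powr p\<close> equal \<open>\<bar>f\<bar> powr q\<close>. This gives
  \<open>I \<le> \<beta> * I powr (1 / p)\<close>, and dividing by the power leaves the
  norm.\<close>

lemma Lp_norm_le_of_dual_bound:
  assumes f: "f \<in> Lp M q" and \<beta>: "0 \<le> \<beta>"
    and le: "\<And>g. g \<in> Lp M p \<Longrightarrow> (\<integral>x. f x * g x \<partial>M) \<le> \<beta> * Lp_norm M p g"
  shows "Lp_norm M q f \<le> \<beta>"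
proof -
  note c = conj_exponent[OF p q]
  define I where "I = (\<integral>x. \<bar>f x\<bar> powr q \<partial>M)"
  define g where "g x = \<bar>f x\<bar> powr (q - 2) * f x" for x
  have gp: "\<bar>g x\<bar> powr p = \<bar>f x\<bar> powr q" for x
    unfolding g_def abs_powr_mult powr_powr c(4) ..
  have "g \<in> borel_measurable M"
    unfolding g_def using LpD(1)[OF f] by measurable
  then have g: "g \<in> Lp M p"
    using LpD(2)[OF f] by (simp add: Lp_def gp)
  have "I = (\<integral>x. f x * g x \<partial>M)"
    by (simp add: I_def g_def abs_powr_mult)
  also have "\<dots> \<le> \<beta> * I powr (1 / p)"
    using le[OF g] by (simp add: Lp_norm_def gp I_def)
  finally have le': "I \<le> \<beta> * I powr (1 / p)" .
  have "0 \<le> I" unfolding I_def by (rule Bochner_Integration.integral_nonneg) simp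
  then consider "I = 0" | "0 < I" by linarith
  then show ?thesis
  proof cases
    case 1
    then show ?thesis using \<beta> by (simp add: Lp_norm_def I_def)
  next
    case 2
    have "I powr (1 / q) * I powr (1 / p) = I powr 1"
      using c(2) by (simp only: powr_add[symmetric] add.commute)
    then have "I powr (1 / q) * I powr (1 / p) \<le> \<beta> * I powr (1 / p)"
      using le' 2 by simp
    then have "I powr (1 / q) \<le> \<beta>"
      using 2 by simp
    then show ?thesis by (simp add: Lp_norm_def I_def)
  qed
qed

text \<open>The converse of the equality case of Hoelder: since \<open>(p - 1) * q = p\<close>, the
  q-th power of \<open>\<bar>f\<bar>\<close> is a multiple of \<open>\<bar>g\<bar> powr p\<close>,
  and everything is expressed through the norm of \<open>g\<close>.\<close>

lemma extremal_dual_function: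
  assumes g: "g \<in> Lp M p" "0 < Lp_norm M p g" and \<beta>: "0 < \<beta>" and f: "f \<in> borel_measurable M"
    and eq: "AE x in M. f x = \<beta> * (\<bar>g x\<bar> powr (p - 2) * g x) / Lp_norm M p g powr (p - 1)"
  shows "f \<in> Lp M q" "Lp_norm M q f = \<beta>" "(\<integral>x. f x * g x \<partial>M) = \<beta> * Lp_norm M p g"
proof -
  note c = conj_exponent[OF p q]
  note [measurable] = LpD(1)[OF g(1)] f
  let ?W = "Lp_norm M p g"
  have fq: "AE x in M. \<bar>f x\<bar> powr q = \<beta> powr q / ?W powr p * \<bar>g x\<bar> powr p"
    using eq
  proof eventually_elim
    case (elim x)
    have "\<bar>f x\<bar> = \<beta> * \<bar>\<bar>g x\<bar> powr (p - 2) * g x\<bar> / ?W powr (p - 1)"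
      using \<beta> unfolding elim by (simp add: abs_mult)
    then have "\<bar>f x\<bar> = \<beta> * \<bar>g x\<bar> powr (p - 1) / ?W powr (p - 1)"
      unfolding abs_powr_mult .
    then have "\<bar>f x\<bar> powr q = \<beta> powr q * (\<bar>g x\<bar> powr (p - 1)) powr q / (?W powr (p - 1)) powr q"
      using \<beta> by (simp add: powr_mult powr_divide)
    then show ?case by (simp add: powr_powr c(3))
  qed
  have i: "integrable M (\<lambda>x. \<beta> powr q / ?W powr p * \<bar>g x\<bar> powr p)"
    using LpD(2)[OF g(1)] by simp
  have "integrable M (\<lambda>x. \<bar>f x\<bar> powr q)"
    by (rule integrable_cong_AE_imp[OF i]) (use fq in \<open>auto elim: eventually_mono\<close>)
  then show "f \<in> Lp M q" using f by (simp add: Lp_def)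
  have "(\<integral>x. \<bar>f x\<bar> powr q \<partial>M) = (\<integral>x. \<beta> powr q / ?W powr p * \<bar>g x\<bar> powr p \<partial>M)"
    by (rule integral_cong_AE) (use fq in auto)
  also have "\<dots> = \<beta> powr q"
    using g(2) p by (simp add: Lp_norm_powr[symmetric])
  finally show "Lp_norm M q f = \<beta>"
    using \<beta> c(1) by (simp add: Lp_norm_def powr_powr)
  have "(\<integral>x. f x * g x \<partial>M) = (\<integral>x. \<beta> / ?W powr (p - 1) * \<bar>g x\<bar> powr p \<partial>M)"
  proof (rule integral_cong_AE)
    show "AE x in M. f x * g x = \<beta> / ?W powr (p - 1) * \<bar>g x\<bar> powr p"
      using eq
    proof eventually_elim
      case (elim x)
      have "f x * g x = \<beta> / ?W powr (p - 1) * (g x * (\<bar>g x\<bar> powr (p - 2) * g x))"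
        unfolding elim by simp
      then show ?case by (simp only: abs_powr_mult)
    qed
  qed measurable
  also have "\<dots> = \<beta> / ?W powr (p - 1) * ?W powr p"
    using p by (simp add: Lp_norm_powr)
  also have "?W powr p = ?W powr (p - 1) * ?W"
    using powr_add[of ?W "p - 1" 1] g(2) by simp
  finally show "(\<integral>x. f x * g x \<partial>M) = \<beta> * ?W" using g(2) by simp
qed

text \<open>\<open>F\<close> is the defect in Young's inequality, with \<open>f\<close> normalized
  by \<open>\<beta>\<close> instead of its own norm. It is nonnegative and its integral is at most
  \<open>1 / q + 1 / p - 1 = 0\<close>, so it vanishes almost everywhere. Vanishing forces equality
  twice: in Young, which fixes the size of \<open>f\<close>, and in
  \<open>f g \<le> \<bar>f\<bar> \<bar>g\<bar>\<close>, which fixes its sign.\<close>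

lemma Holder_equality:
  assumes f: "f \<in> Lp M q" "Lp_norm M q f \<le> \<beta>" and \<beta>: "0 < \<beta>"
    and g: "g \<in> Lp M p" "0 < Lp_norm M p g"
    and eq: "(\<integral>x. f x * g x \<partial>M) = \<beta> * Lp_norm M p g"
  shows "AE x in M. f x = \<beta> * (\<bar>g x\<bar> powr (p - 2) * g x) / Lp_norm M p g powr (p - 1)"
proof -
  note c = conj_exponent[OF p q]
  let ?W = "Lp_norm M p g"
  define F where "F x = \<bar>f x\<bar> powr q / \<beta> powr q / q + \<bar>g x\<bar> powr p / ?W powr p / p - f x * g x / (\<beta> * ?W)" for x
  have prod: "f x * g x / (\<beta> * ?W) \<le> (\<bar>f x\<bar> / \<beta>) * (\<bar>g x\<bar> / ?W)" for x
    using \<beta> g(2) abs_ge_self[of "f x * g x"] by (simp add: abs_mult divide_right_mono)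
  have Young: "(\<bar>f x\<bar> / \<beta>) * (\<bar>g x\<bar> / ?W) \<le> \<bar>f x\<bar> powr q / \<beta> powr q / q + \<bar>g x\<bar> powr p / ?W powr p / p" for x
    using Youngs_inequality[of q p "\<bar>f x\<bar> / \<beta>" "\<bar>g x\<bar> / ?W"] p c \<beta> g(2) by (simp add: powr_divide)
  have nonneg: "0 \<le> F x" for x
    using prod[of x] Young[of x] by (simp add: F_def)
  have int: "integrable M F"
    unfolding F_def using LpD(2)[OF f(1)] LpD(2)[OF g(1)] integrable_Lp_mult[OF f(1) g(1)] by simp
  have "(\<integral>x. F x \<partial>M) = (\<integral>x. \<bar>f x\<bar> powr q \<partial>M) / \<beta> powr q / q + (\<integral>x. \<bar>g x\<bar> powr p \<partial>M) / ?W powr p / p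
      - (\<integral>x. f x * g x \<partial>M) / (\<beta> * ?W)"
    unfolding F_def using LpD(2)[OF f(1)] LpD(2)[OF g(1)] integrable_Lp_mult[OF f(1) g(1)] by simp
  also have "\<dots> = Lp_norm M q f powr q / \<beta> powr q / q + 1 / p - 1"
    using p c \<beta> g(2) by (simp add: Lp_norm_powr[symmetric] eq)
  also have "\<dots> \<le> 1 / q + 1 / p - 1"
  proof -
    have "Lp_norm M q f powr q \<le> \<beta> powr q"
      using f(2) c(1) by (intro powr_mono2) (auto simp: Lp_norm_nonneg)
    then have "Lp_norm M q f powr q / \<beta> powr q \<le> 1" using \<beta> by simp
    then have "Lp_norm M q f powr q / \<beta> powr q / q \<le> 1 / q"
      using c(1) by (intro divide_right_mono) auto
    then show ?thesis by simp
  qed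
  also have "\<dots> = 0" using c(2) by simp
  finally have "(\<integral>x. F x \<partial>M) \<le> 0" .
  moreover have "0 \<le> (\<integral>x. F x \<partial>M)" by (rule Bochner_Integration.integral_nonneg) (rule nonneg)
  ultimately have "(\<integral>x. F x \<partial>M) = 0" by simp
  then have "AE x in M. F x = 0"
    using integral_nonneg_eq_0_iff_AE[OF int] nonneg by simp
  then show ?thesis
  proof eventually_elim
    case (elim x)
    define s where "s = \<bar>f x\<bar> / \<beta>"
    define t where "t = \<bar>g x\<bar> / ?W"
    have st: "s * t = f x * g x / (\<beta> * ?W)" "s * t = \<bar>f x\<bar> powr q / \<beta> powr q / q + \<bar>g x\<bar> powr p / ?W powr p / p"
      using prod[of x] Young[of x] elim by (auto simp: F_def s_def t_def)
    have "s = t powr (p - 1)"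
      by (rule Young_equality[OF p c(1,2)])
        (use st(2) \<beta> g(2) in \<open>auto simp: s_def t_def powr_divide\<close>)
    then have fx: "\<bar>f x\<bar> = \<beta> * \<bar>g x\<bar> powr (p - 1) / ?W powr (p - 1)"
      using \<beta> g(2) by (simp add: s_def t_def powr_divide field_simps)
    have sgn: "\<bar>f x\<bar> * \<bar>g x\<bar> = f x * g x"
      using st(1) \<beta> g(2) by (simp add: s_def t_def)
    show ?case
    proof (cases "g x = 0")
      case True
      then show ?thesis using fx p by simp
    next
      case False
      \<comment> \<open>Multiplying by \<open>\<bar>g x\<bar>\<close> instead of splitting by signs
        transfers the sign of \<open>g x\<close> to \<open>f x\<close>; the factor is cancelled at
        the end.\<close>
      have "f x * \<bar>g x\<bar> * \<bar>g x\<bar> = f x * g x * g x" by simp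
      also have "\<dots> = \<bar>f x\<bar> * \<bar>g x\<bar> * g x" by (simp only: sgn)
      finally have "f x * \<bar>g x\<bar> = \<bar>f x\<bar> * g x" using False by simp
      also have "\<dots> = \<beta> * (\<bar>g x\<bar> powr (p - 1) * g x) / ?W powr (p - 1)"
        by (simp add: fx)
      also have "\<bar>g x\<bar> powr (p - 1) = \<bar>g x\<bar> powr (p - 2) * \<bar>g x\<bar>"
        using abs_powr_mult(1)[of "g x" p] by (simp add: abs_mult)
      finally have "f x * \<bar>g x\<bar> = (\<beta> * (\<bar>g x\<bar> powr (p - 2) * g x) / ?W powr (p - 1)) * \<bar>g x\<bar>"
        by simp
      then show ?thesis using False by (subst (asm) mult_right_cancel) auto
    qed
  qed
qed

end

section \<open>Density of the test functions in the Lebesgue spaces\<close>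

context bounded_interval
begin

lemma bounded_measurable_Lp:
  assumes p: "0 < p" and g: "g \<in> bounded_measurable L"
  shows "g \<in> Lp L p"
proof -
  interpret finite_measure L by (rule finite_measure_lebesgue_on_Ioo)
  obtain K where K: "0 \<le> K" "\<And>x. x \<in> space L \<Longrightarrow> \<bar>g x\<bar> \<le> K" "g \<in> borel_measurable L"
    by (rule bounded_measurableE[OF g that])
  note [measurable] = K(3)
  have "integrable L (\<lambda>x. \<bar>g x\<bar> powr p)"
  proof (rule integrable_const_bound[where B="K powr p"])
    show "AE x in L. norm (\<bar>g x\<bar> powr p) \<le> K powr p"
      by (rule AE_I2) (use K p in \<open>auto intro!: powr_mono2\<close>)
  qed measurable
  then show ?thesis using K(3) by (simp add: Lp_def)
qed

lemma const_Lp: "0 < p \<Longrightarrow> (\<lambda>_. c) \<in> Lp L p"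
  by (rule bounded_measurable_Lp) (auto intro: bounded_measurableI[where K="\<bar>c\<bar>"])

lemma smooth_Lp: "0 < p \<Longrightarrow> smooth \<psi> \<Longrightarrow> \<psi> \<in> Lp L p"
  by (rule bounded_measurable_Lp[OF _ bounded_measurable_lebesgue_on[OF bounded_measurable_smooth]])

lemma Lp_integrable:
  assumes p: "1 < p" and f: "f \<in> Lp L p"
  shows "integrable L f"
    and "(\<integral>x. \<bar>f x\<bar> \<partial>L) \<le> Lp_norm L (p / (p - 1)) (\<lambda>_. 1) * Lp_norm L p f"
proof -
  have q: "0 < p / (p - 1)" using p by simp
  have "integrable L (\<lambda>x. 1 * f x)"
    by (rule integrable_Lp_mult[OF p refl const_Lp[OF q] f])
  then show "integrable L f" by simp
  have fa: "(\<lambda>x. \<bar>f x\<bar>) \<in> Lp L p" using f by (auto simp: Lp_def)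
  have "Lp_norm L p (\<lambda>x. \<bar>f x\<bar>) = Lp_norm L p f" by (simp add: Lp_norm_def)
  then show "(\<integral>x. \<bar>f x\<bar> \<partial>L) \<le> Lp_norm L (p / (p - 1)) (\<lambda>_. 1) * Lp_norm L p f"
    using Holder_inequality[OF p refl const_Lp[OF q, of 1] fa] by simp
qed

text \<open>The closure of the test functions in the p-norm, as a predicate, so that it can serve as
  invariant in inductions over Borel sets and Borel functions.\<close>

definition test_limit :: "real \<Rightarrow> (real \<Rightarrow> real) \<Rightarrow> bool" where
  "test_limit p h \<longleftrightarrow> h \<in> Lp L p \<and>
    (\<forall>\<epsilon>>0. \<exists>\<psi>\<in>test_functions \<Omega>. Lp_norm L p (\<lambda>x. \<psi> x - h x) < \<epsilon>)"

lemma test_limit_closed: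
  assumes p: "1 \<le> p" and h: "h \<in> Lp L p"
    and ex: "\<And>\<epsilon>. 0 < \<epsilon> \<Longrightarrow> \<exists>g. test_limit p g \<and> Lp_norm L p (\<lambda>x. g x - h x) < \<epsilon>"
  shows "test_limit p h"
  unfolding test_limit_def
proof (intro conjI allI impI h)
  fix \<epsilon> :: real assume "0 < \<epsilon>"
  then have e: "0 < \<epsilon> / 2" by simp
  obtain g where g: "test_limit p g" "Lp_norm L p (\<lambda>x. g x - h x) < \<epsilon> / 2"
    using ex[OF e] by blast
  obtain \<psi> where \<psi>: "\<psi> \<in> test_functions \<Omega>" "Lp_norm L p (\<lambda>x. \<psi> x - g x) < \<epsilon> / 2"
    using g(1) e unfolding test_limit_def by blast
  have gL: "g \<in> Lp L p" using g(1) by (simp add: test_limit_def)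
  have pL: "\<psi> \<in> Lp L p" using smooth_Lp[OF _ test_function_smooth[OF \<psi>(1)]] p by simp
  have "Lp_norm L p (\<lambda>x. (\<psi> x - g x) + (g x - h x)) \<le>
      Lp_norm L p (\<lambda>x. \<psi> x - g x) + Lp_norm L p (\<lambda>x. g x - h x)"
    by (rule Lp_norm_triangle[OF p Lp_diff[OF p pL gL] Lp_diff[OF p gL h]])
  then have "Lp_norm L p (\<lambda>x. \<psi> x - h x) < \<epsilon>" using \<psi>(2) g(2) by simp
  then show "\<exists>\<psi>\<in>test_functions \<Omega>. Lp_norm L p (\<lambda>x. \<psi> x - h x) < \<epsilon>" using \<psi>(1) by blast
qed

text \<open>Dominated almost-everywhere limits converge in the p-norm, and the closure is closed.
  The passages from bumps to intervals, Borel sets and nonnegative functions all use this.\<close>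

lemma test_limit_dominated:
  assumes p: "1 \<le> p" and g: "\<And>n. test_limit p (g n)" and w: "w \<in> Lp L p"
    and h: "h \<in> borel_measurable L"
    and bound: "\<And>n. AE x in L. \<bar>g n x\<bar> \<le> w x"
    and lim: "AE x in L. (\<lambda>n. g n x) \<longlonglongrightarrow> h x"
  shows "test_limit p h"
proof (rule test_limit_closed[OF p])
  have p0: "0 < p" using p by simp
  have all: "AE x in L. \<forall>n. \<bar>g n x\<bar> \<le> w x" using bound by (simp add: AE_all_countable)
  have "AE x in L. \<bar>h x\<bar> \<le> w x"
    using all lim
  proof eventually_elim
    case (elim x)
    have "(\<lambda>n. \<bar>g n x\<bar>) \<longlonglongrightarrow> \<bar>h x\<bar>" by (rule tendsto_rabs[OF elim(2)])
    then show ?case by (rule LIMSEQ_le_const2) (use elim(1) in auto)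
  qed
  then show "h \<in> Lp L p" by (rule Lp_AE_bound[OF p0 w h])
  have gm: "g n \<in> borel_measurable L" for n using g[of n] by (simp add: test_limit_def Lp_def)
  fix \<epsilon> :: real assume "0 < \<epsilon>"
  then have "\<forall>\<^sub>F n in sequentially. Lp_norm L p (\<lambda>x. g n x - h x) < \<epsilon>"
    by (rule order_tendstoD(2)[OF Lp_dominated_convergence[OF p0 w gm h bound lim]])
  then obtain n where "Lp_norm L p (\<lambda>x. g n x - h x) < \<epsilon>"
    by (auto simp: eventually_sequentially)
  then show "\<exists>g. test_limit p g \<and> Lp_norm L p (\<lambda>x. g x - h x) < \<epsilon>" using g by blast
qed

lemma test_limit_test:
  assumes p: "1 \<le> p" and \<psi>: "\<psi> \<in> test_functions \<Omega>"
  shows "test_limit p \<psi>"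
proof -
  have "Lp_norm L p (\<lambda>x. \<psi> x - \<psi> x) = 0" by (simp add: Lp_norm_def)
  then show ?thesis
    unfolding test_limit_def using \<psi> smooth_Lp[OF _ test_function_smooth[OF \<psi>]] p by force
qed

lemma test_limit_empty:
  assumes p: "1 \<le> p"
  shows "test_limit p (indicator {})"
proof -
  have "(indicator {} :: real \<Rightarrow> real) = (\<lambda>_. 0)" by (simp add: fun_eq_iff)
  then show ?thesis using test_limit_test[OF p test_functions_zero] by (simp only:)
qed

lemma test_limit_cmult:
  assumes p: "1 \<le> p" and h: "test_limit p h"
  shows "test_limit p (\<lambda>x. c * h x)"
proof (cases "c = 0")
  case True
  then show ?thesis using test_limit_test[OF p test_functions_zero] by simp
next
  case False
  show ?thesis
    unfolding test_limit_def
  proof (intro conjI allI impI)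
    show "(\<lambda>x. c * h x) \<in> Lp L p" by (rule Lp_cmult) (use h in \<open>simp add: test_limit_def\<close>)
    fix \<epsilon> :: real assume "0 < \<epsilon>"
    then have "0 < \<epsilon> / \<bar>c\<bar>" using False by simp
    then obtain \<psi> where \<psi>: "\<psi> \<in> test_functions \<Omega>" "Lp_norm L p (\<lambda>x. \<psi> x - h x) < \<epsilon> / \<bar>c\<bar>"
      using h unfolding test_limit_def by blast
    have "Lp_norm L p (\<lambda>x. c * \<psi> x - c * h x) = \<bar>c\<bar> * Lp_norm L p (\<lambda>x. \<psi> x - h x)"
      using Lp_norm_cmult[of p L c "\<lambda>x. \<psi> x - h x"] p by (simp add: right_diff_distrib)
    also have "\<dots> < \<epsilon>" using \<psi>(2) False by (simp add: less_divide_eq mult.commute)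
    finally show "\<exists>\<psi>\<in>test_functions \<Omega>. Lp_norm L p (\<lambda>x. \<psi> x - c * h x) < \<epsilon>"
      by (rule bexI[OF _ test_functions_cmult[OF \<psi>(1)]])
  qed
qed

lemma test_limit_add:
  assumes p: "1 \<le> p" and g: "test_limit p g" and h: "test_limit p h"
  shows "test_limit p (\<lambda>x. g x + h x)"
  unfolding test_limit_def
proof (intro conjI allI impI)
  have L: "g \<in> Lp L p" "h \<in> Lp L p" using g h by (auto simp: test_limit_def)
  then show "(\<lambda>x. g x + h x) \<in> Lp L p" by (rule Lp_add[OF p])
  fix \<epsilon> :: real assume "0 < \<epsilon>"
  then have e: "0 < \<epsilon> / 2" by simp
  obtain \<psi> where \<psi>: "\<psi> \<in> test_functions \<Omega>" "Lp_norm L p (\<lambda>x. \<psi> x - g x) < \<epsilon> / 2"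
    using g e unfolding test_limit_def by blast
  obtain \<xi> where \<xi>: "\<xi> \<in> test_functions \<Omega>" "Lp_norm L p (\<lambda>x. \<xi> x - h x) < \<epsilon> / 2"
    using h e unfolding test_limit_def by blast
  have pL: "\<psi> \<in> Lp L p" "\<xi> \<in> Lp L p"
    using smooth_Lp[OF _ test_function_smooth] \<psi>(1) \<xi>(1) p by auto
  have "Lp_norm L p (\<lambda>x. (\<psi> x - g x) + (\<xi> x - h x)) \<le>
      Lp_norm L p (\<lambda>x. \<psi> x - g x) + Lp_norm L p (\<lambda>x. \<xi> x - h x)"
    by (rule Lp_norm_triangle[OF p Lp_diff[OF p pL(1) L(1)] Lp_diff[OF p pL(2) L(2)]])
  also have "(\<lambda>x. (\<psi> x - g x) + (\<xi> x - h x)) = (\<lambda>x. (\<psi> x + \<xi> x) - (g x + h x))" by auto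
  finally have "Lp_norm L p (\<lambda>x. (\<psi> x + \<xi> x) - (g x + h x)) < \<epsilon>" using \<psi>(2) \<xi>(2) by simp
  then show "\<exists>\<psi>\<in>test_functions \<Omega>. Lp_norm L p (\<lambda>x. \<psi> x - (g x + h x)) < \<epsilon>"
    by (rule bexI[OF _ test_functions_add[OF \<psi>(1) \<xi>(1)]])
qed

lemma borel_measurable_L: "u \<in> borel_measurable borel \<Longrightarrow> u \<in> borel_measurable L"
  by (rule borel_measurable_lebesgue_on_of_borel_on[OF measurable_restrict_space1])

lemma test_limit_cong_AE:
  assumes p: "1 \<le> p" and g: "test_limit p g" and h: "h \<in> borel_measurable L" and eq: "AE x in L. g x = h x"
  shows "test_limit p h"
proof (rule test_limit_dominated[OF p, where g="\<lambda>_. g" and w="\<lambda>x. \<bar>g x\<bar>"])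
  show "(\<lambda>x. \<bar>g x\<bar>) \<in> Lp L p" using g by (auto simp: test_limit_def Lp_def)
  show "AE x in L. (\<lambda>_. g x) \<longlonglongrightarrow> h x" using eq by eventually_elim simp
qed (use g h in auto)

lemma test_limit_Ioo:
  assumes p: "1 \<le> p"
  shows "test_limit p (indicator {c<..<d})"
proof -
  have compact_case: "test_limit p (indicator {c<..<d})" if "a < c" "d < b" for c d
  proof (cases "c < d")
    case True
    show ?thesis
    proof (rule test_limit_dominated[OF p, where g="bump c d" and w="\<lambda>_. 1"])
      show "test_limit p (bump c d n)" for n
        by (rule test_limit_test[OF p test_functions_bump[OF that(1) True that(2)]])
    qed (use p abs_bump_le bump_tendsto in \<open>auto intro!: const_Lp borel_measurable_L\<close>)
  next
    case False
    then show ?thesis using test_limit_empty[OF p] by simp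
  qed
  obtain c' d' where c'd': "\<And>n. a < c' n" "\<And>n. d' n < b"
    "\<And>x. (\<lambda>n. indicator {c' n<..<d' n} x :: real) \<longlonglongrightarrow> indicator ({c<..<d} \<inter> \<Omega>) x"
    by (rule Ioo_exhaustion[OF that])
  show ?thesis
  proof (rule test_limit_dominated[OF p, where g="\<lambda>n. indicator {c' n<..<d' n}" and w="\<lambda>_. 1"])
    show "test_limit p (indicator {c' n<..<d' n})" for n
      by (rule compact_case[OF c'd'(1,2)])
    show "(\<lambda>_. 1) \<in> Lp L p" using p by (intro const_Lp) simp
    show "indicator {c<..<d} \<in> borel_measurable L" by (rule borel_measurable_L) simp
    show "AE x in L. \<bar>indicator {c' n<..<d' n} x\<bar> \<le> (1::real)" for n
      by (rule AE_I2) (simp add: indicator_def)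
    show "AE x in L. (\<lambda>n. indicator {c' n<..<d' n} x) \<longlonglongrightarrow> (indicator {c<..<d} x :: real)"
    proof (rule AE_I2)
      fix x assume "x \<in> space L"
      then have "indicator ({c<..<d} \<inter> \<Omega>) x = (indicator {c<..<d} x :: real)"
        by (simp add: indicator_def)
      then show "(\<lambda>n. indicator {c' n<..<d' n} x) \<longlonglongrightarrow> (indicator {c<..<d} x :: real)"
        using c'd'(3)[of x] by simp
    qed
  qed
qed

lemma test_limit_indicator:
  assumes p: "1 \<le> p" and A: "A \<in> sets borel"
  shows "test_limit p (indicator A)"
proof -
  let ?G = "range (\<lambda>(c, d). {c<..<d::real})"
  have A': "A \<in> sigma_sets UNIV ?G" using A unfolding borel_Ioo_sigma_sets .
  have m: "indicator B \<in> borel_measurable L" if "B \<in> sigma_sets UNIV ?G" for B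
    using that unfolding borel_Ioo_sigma_sets[symmetric] by (intro borel_measurable_L) simp
  have sub: "?G \<subseteq> Pow UNIV" by simp
  show ?thesis
    using Int_stable_Ioo sub A'
  proof (induction rule: sigma_sets_induct_disjoint)
    case (basic A)
    then show ?case using test_limit_Ioo[OF p] by auto
  next
    case empty
    show ?case by (rule test_limit_empty[OF p])
  next
    case (compl A)
    \<comment> \<open>\<open>L\<close> sees only \<open>\<Omega>\<close>, where the complement of
      \<open>A\<close> is the indicator of \<open>\<Omega>\<close> minus that of \<open>A\<close>;
      the former is already covered by \<open>test_limit_Ioo\<close>.\<close>
    have "test_limit p (\<lambda>x. indicator {a<..<b} x + (-1) * indicator A x)"
      by (rule test_limit_add[OF p test_limit_Ioo[OF p] test_limit_cmult[OF p compl(2)]])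
    then show ?case
    proof (rule test_limit_cong_AE[OF p])
      show "indicator (UNIV - A) \<in> borel_measurable L"
        using compl(1) by (intro m sigma_sets.Compl)
      show "AE x in L. indicator {a<..<b} x + (-1) * indicator A x = (indicator (UNIV - A) x :: real)"
        by (rule AE_I2) (auto simp: indicator_def)
    qed
  next
    case (union A)
    have fin: "test_limit p (indicator (\<Union>i<n. A i))" for n :: nat
    proof (induction n)
      case 0
      have "(\<Union>i<0::nat. A i) = {}" by simp
      then show ?case using test_limit_empty[OF p] by (simp only:)
    next
      case (Suc n)
      have "A i \<inter> A n = {}" if "i < n" for i
        using union(1) that unfolding disjoint_family_on_def by (metis UNIV_I less_irrefl)
      then have "(\<Union>i<n. A i) \<inter> A n = {}" by blast
      then have "indicator (\<Union>i<Suc n. A i) = (\<lambda>x. indicator (\<Union>i<n. A i) x + indicator (A n) x :: real)"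
        by (auto simp: fun_eq_iff indicator_def less_Suc_eq)
      then show ?case using test_limit_add[OF p Suc union(3)] by simp
    qed
    show ?case
    proof (rule test_limit_dominated[OF p fin, where w="\<lambda>_. 1"])
      show "(\<lambda>_. 1) \<in> Lp L p" using p by (intro const_Lp) simp
      show "indicator (\<Union>i. A i) \<in> borel_measurable L"
        using union(2) by (intro m sigma_sets.Union) auto
      show "AE x in L. \<bar>indicator (\<Union>i<n. A i) x\<bar> \<le> (1::real)" for n
        by (rule AE_I2) (simp add: indicator_def)
      show "AE x in L. (\<lambda>n. indicator (\<Union>i<n. A i) x) \<longlonglongrightarrow> (indicator (\<Union>i. A i) x :: real)"
        by (rule AE_I2) (rule LIMSEQ_indicator_UN)
    qed
  qed
qed

lemma test_limit_nonneg:
  assumes p: "1 \<le> p" and u: "u \<in> borel_measurable borel" "\<And>x. 0 \<le> u x" "u \<in> Lp L p"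
  shows "test_limit p u"
proof -
  have p0: "0 < p" using p by simp
  \<comment> \<open>Integrability is made part of the induction statement. Summands and members of
    an increasing sequence inherit it because they are dominated by the whole.\<close>
  have "u \<in> Lp L p \<longrightarrow> test_limit p u"
    using u(1,2)
  proof (induction rule: borel_measurable_induct_real)
    case (set A)
    then show ?case using test_limit_indicator[OF p] by simp
  next
    case (mult u c)
    show ?case
    \<comment> \<open>Membership of \<open>0 * u\<close> says nothing about \<open>u\<close>, so the
      induction hypothesis can only be used for a nonzero factor.\<close>
    proof (cases "c = 0")
      case True
      then show ?thesis using test_limit_test[OF p test_functions_zero] by simp
    next
      case False
      show ?thesis
      proof
        assume "(\<lambda>x. c * u x) \<in> Lp L p"
        then have "(\<lambda>x. (1 / c) * (c * u x)) \<in> Lp L p" by (rule Lp_cmult)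
        then have "u \<in> Lp L p" using False by simp
        then show "test_limit p (\<lambda>x. c * u x)" using mult test_limit_cmult[OF p] by blast
      qed
    qed
  next
    case (add u v)
    have uv: "u \<in> borel_measurable borel" "v \<in> borel_measurable borel" "\<And>x. 0 \<le> u x" "\<And>x. 0 \<le> v x"
      by (rule add)+
    show ?case
    proof
      assume w: "(\<lambda>x. v x + u x) \<in> Lp L p"
      have "u \<in> Lp L p"
        by (rule Lp_AE_bound[OF p0 w borel_measurable_L[OF uv(1)]]) (use uv in auto)
      moreover have "v \<in> Lp L p"
        by (rule Lp_AE_bound[OF p0 w borel_measurable_L[OF uv(2)]]) (use uv in auto)
      ultimately show "test_limit p (\<lambda>x. v x + u x)" using add.IH test_limit_add[OF p] by blast
    qed
  next
    case (seq U)
    have U: "\<And>n. U n \<in> borel_measurable borel" "\<And>n x. 0 \<le> U n x" "incseq U"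
      "\<And>x. (\<lambda>n. U n x) \<longlonglongrightarrow> u x"
      by (rule seq, (simp only: space_borel UNIV_I)?)+
    show ?case
    proof
      assume w: "u \<in> Lp L p"
      have le: "U n x \<le> u x" for n x
        by (rule incseq_le[OF _ U(4)]) (use U(3) in \<open>auto simp: incseq_def le_fun_def\<close>)
      have "U n \<in> Lp L p" for n
        by (rule Lp_AE_bound[OF p0 w borel_measurable_L[OF U(1)]]) (use le U(2) in auto)
      then have "test_limit p (U n)" for n using seq.IH by blast
      then show "test_limit p u"
      proof (rule test_limit_dominated[OF p _ w borel_measurable_L[OF u(1)]])
        show "AE x in L. \<bar>U n x\<bar> \<le> u x" for n using le U(2) by (intro AE_I2) auto
        show "AE x in L. (\<lambda>n. U n x) \<longlonglongrightarrow> u x" using U(4) by (intro AE_I2) auto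
      qed
    qed
  qed
  then show ?thesis using u(3) by blast
qed

lemma test_functions_dense_Lp:
  assumes p: "1 \<le> p" and h: "h \<in> Lp L p"
  shows "test_limit p h"
proof -
  have p0: "0 < p" using p by simp
  obtain v where v: "v \<in> borel_measurable borel" "AE x in L. h x = v x"
    using borel_version[OF LpD(1)[OF h]] by blast
  have vL: "v \<in> Lp L p"
  proof (rule Lp_AE_bound[OF p0 _ borel_measurable_L[OF v(1)], where w="\<lambda>x. \<bar>h x\<bar>"])
    show "(\<lambda>x. \<bar>h x\<bar>) \<in> Lp L p" using h by (auto simp: Lp_def)
    show "AE x in L. \<bar>v x\<bar> \<le> \<bar>h x\<bar>" using v(2) by eventually_elim simp
  qed
  then have vabs: "(\<lambda>x. \<bar>v x\<bar>) \<in> Lp L p" by (auto simp: Lp_def)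
  \<comment> \<open>The choices \<open>s = 1\<close> and \<open>s = -1\<close> give the positive and
    the negative part of the Borel representative.\<close>
  have "test_limit p (\<lambda>x. max 0 (s * v x))" if "\<bar>s\<bar> = 1" for s
  proof (rule test_limit_nonneg[OF p])
    show m: "(\<lambda>x. max 0 (s * v x)) \<in> borel_measurable borel" using v(1) by measurable
    have "\<bar>max 0 (s * v x)\<bar> \<le> \<bar>v x\<bar>" for x
      using that abs_mult[of s "v x"] abs_ge_self[of "s * v x"] by (auto simp: max_def)
    then show "(\<lambda>x. max 0 (s * v x)) \<in> Lp L p"
      by (intro Lp_AE_bound[OF p0 vabs borel_measurable_L[OF m]] AE_I2)
  qed simp
  from test_limit_add[OF p this[of 1] test_limit_cmult[OF p this[of "-1"], of "-1"]]
  have "test_limit p (\<lambda>x. max 0 (1 * v x) + (-1) * max 0 (-1 * v x))" by simp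
  also have "(\<lambda>x. max 0 (1 * v x) + (-1) * max 0 (-1 * v x)) = v"
    by (auto simp: fun_eq_iff max_def)
  finally have "test_limit p v" .
  then show ?thesis
    by (rule test_limit_cong_AE[OF p _ LpD(1)[OF h]]) (use v(2) in \<open>auto elim: eventually_mono\<close>)
qed

text \<open>The set where the bound fails is open and null, hence empty. Bounds valid Lebesgue-a.e.
  thus hold at every point, including atoms of the residual.\<close>

lemma AE_le_continuous:
  fixes f :: "real \<Rightarrow> real"
  assumes f: "continuous_on \<Omega> f" and le: "AE x in L. f x \<le> c" and x: "x \<in> \<Omega>"
  shows "f x \<le> c"
proof -
  let ?U = "f -` {c<..} \<inter> \<Omega>"
  have op: "open ?U"
    using f continuous_on_open_vimage[of \<Omega> f] by simp
  have "AE x in lebesgue. x \<in> \<Omega> \<longrightarrow> f x \<le> c"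
    using le by (subst (asm) AE_restrict_space_iff) auto
  then have "AE x in lebesgue. x \<notin> ?U" by eventually_elim auto
  then have "?U \<in> null_sets lebesgue"
    using op by (subst AE_iff_null_sets) auto
  then have "?U = {}"
    using open_not_negligible[OF op] by (auto simp: negligible_iff_null_sets)
  then show ?thesis using x by force
qed

section \<open>Sobolev functions with zero boundary values as primitives\<close>

lemma abs_primitive_le:
  assumes h: "integrable L h"
  shows "\<bar>primitive h x\<bar> \<le> (\<integral>t. \<bar>h t\<bar> \<partial>L)"
proof -
  note i = integrable_indicator_mult[OF h, of "{..x}"]
  have "\<bar>primitive h x\<bar> \<le> (\<integral>t. \<bar>indicator {..x} t * h t\<bar> \<partial>L)"
    unfolding primitive_def by (rule integral_abs_bound)
  also have "\<dots> \<le> (\<integral>t. \<bar>h t\<bar> \<partial>L)"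
    using i h by (intro integral_mono) (auto simp: indicator_def)
  finally show ?thesis .
qed

lemma primitive_diff:
  assumes "integrable L g" "integrable L h"
  shows "primitive (\<lambda>x. g x - h x) y = primitive g y - primitive h y"
  using integrable_indicator_mult[OF assms(1), of "{..y}"] integrable_indicator_mult[OF assms(2), of "{..y}"]
  by (simp add: primitive_def right_diff_distrib)

lemma bounded_measurable_primitive:
  "integrable L h \<Longrightarrow> primitive h \<in> bounded_measurable (borel_on \<Omega>)"
  by (rule bounded_measurable_continuous[OF continuous_primitive])

lemma weak_derivative_unique:
  assumes "has_weak_derivative \<Omega> \<phi> g" "has_weak_derivative \<Omega> \<phi> h" "integrable L g" "integrable L h"
  shows "AE x in L. g x = h x"
proof -
  have "AE x in L. g x - h x = 0"
  proof (rule fundamental_lemma)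
    show "integrable L (\<lambda>x. g x - h x)" using assms by simp
    fix \<psi> assume \<psi>: "\<psi> \<in> test_functions \<Omega>"
    have "(\<integral>x. \<phi> x * deriv \<psi> x \<partial>L) = - (\<integral>x. g x * \<psi> x \<partial>L)"
      "(\<integral>x. \<phi> x * deriv \<psi> x \<partial>L) = - (\<integral>x. h x * \<psi> x \<partial>L)"
      using assms(1,2) \<psi> by (simp_all add: has_weak_derivative_def)
    then have "(\<integral>x. g x * \<psi> x \<partial>L) = (\<integral>x. h x * \<psi> x \<partial>L)" by linarith
    then show "(\<integral>x. (g x - h x) * \<psi> x \<partial>L) = 0"
      using integrable_smooth_mult[OF test_function_smooth[OF \<psi>]] assms(3,4)
      by (simp add: left_diff_distrib)
  qed
  then show ?thesis by eventually_elim simp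
qed

lemma L1_tendsto_zero:
  assumes f: "\<And>n. f n \<in> Lp L 2" and lim: "(\<lambda>n. Lp_norm L 2 (f n)) \<longlonglongrightarrow> 0"
  shows "(\<lambda>n. \<integral>x. \<bar>f n x\<bar> \<partial>L) \<longlonglongrightarrow> 0"
proof (rule tendsto_sandwich[OF _ _ tendsto_const])
  show "\<forall>\<^sub>F n in sequentially. (\<integral>x. \<bar>f n x\<bar> \<partial>L) \<le> Lp_norm L (2 / (2 - 1)) (\<lambda>_. 1) * Lp_norm L 2 (f n)"
    using Lp_integrable(2)[OF _ f] by (intro always_eventually) auto
  show "(\<lambda>n. Lp_norm L (2 / (2 - 1)) (\<lambda>_. 1) * Lp_norm L 2 (f n)) \<longlonglongrightarrow> 0"
    using tendsto_mult[OF tendsto_const lim] by simp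
qed (auto intro!: always_eventually Bochner_Integration.integral_nonneg)

text \<open>Test functions are primitives of their derivatives. Along the approximating sequence the
  derivatives converge in L1, so the primitives converge uniformly on \<open>\<Omega>\<close>; the
  functions also converge to \<open>\<phi>\<close> in L1. Hence \<open>\<phi>\<close> is a primitive
  almost everywhere, and everywhere on \<open>\<Omega>\<close> by continuity. The mean vanishes as a
  limit of vanishing means.\<close>

lemma H01_eq_primitive:
  assumes \<phi>: "\<phi> \<in> H01 \<Omega>" "continuous_on \<Omega> \<phi>" and h: "has_weak_derivative \<Omega> \<phi> h" "h \<in> Lp L 2"
  shows "(\<integral>x. h x \<partial>L) = 0" and "\<And>x. x \<in> \<Omega> \<Longrightarrow> \<phi> x = primitive h x"
proof -
  interpret L: finite_measure L by (rule finite_measure_lebesgue_on_Ioo)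
  obtain g \<psi> where g: "g \<in> Lp L 2" "has_weak_derivative \<Omega> \<phi> g" and \<psi>: "\<And>n. \<psi> n \<in> test_functions \<Omega>"
    and lim0: "(\<lambda>n. Lp_norm L 2 (\<lambda>x. \<psi> n x - \<phi> x)) \<longlonglongrightarrow> 0"
    and lim1: "(\<lambda>n. Lp_norm L 2 (\<lambda>x. deriv (\<psi> n) x - g x)) \<longlonglongrightarrow> 0"
    using \<phi>(1) unfolding H01_def by blast
  have \<phi>L: "\<phi> \<in> Lp L 2" using \<phi>(1) by (simp add: H01_def)
  have s: "smooth (\<psi> n)" "smooth (deriv (\<psi> n))" for n
    using test_function_smooth[OF \<psi>] smooth_deriv by auto
  have di: "integrable L (deriv (\<psi> n))" for n by (rule integrable_smooth[OF s(2)])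
  have int: "integrable L g" "integrable L h" "integrable L \<phi>"
    using Lp_integrable(1)[of 2] g(1) h(2) \<phi>L by auto
  define d where "d n = (\<integral>x. \<bar>deriv (\<psi> n) x - g x\<bar> \<partial>L)" for n
  define e where "e n = (\<integral>x. \<bar>\<psi> n x - \<phi> x\<bar> \<partial>L)" for n
  have d: "d \<longlonglongrightarrow> 0"
    unfolding d_def by (rule L1_tendsto_zero[OF Lp_diff[OF _ smooth_Lp[OF _ s(2)] g(1)] lim1]) auto
  have e: "e \<longlonglongrightarrow> 0"
    unfolding e_def by (rule L1_tendsto_zero[OF Lp_diff[OF _ smooth_Lp[OF _ s(1)] \<phi>L] lim0]) auto
  \<comment> \<open>The derivative \<open>g\<close> in the definition of \<open>H01\<close> is
    existentially bound and has to be identified with the prescribed \<open>h\<close>.\<close>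
  have gh: "AE x in L. g x = h x"
    by (rule weak_derivative_unique[OF g(2) h(1) int(1,2)])
  have "\<bar>\<integral>x. g x \<partial>L\<bar> \<le> d n" for n
  proof -
    have "(\<integral>x. deriv (\<psi> n) x - g x \<partial>L) = - (\<integral>x. g x \<partial>L)"
      using di[of n] int(1) test_function_primitive_deriv(2)[OF \<psi>[of n]] by simp
    then show ?thesis
      unfolding d_def using integral_abs_bound[of L "\<lambda>x. deriv (\<psi> n) x - g x"] by simp
  qed
  then have "\<bar>\<integral>x. g x \<partial>L\<bar> \<le> 0" by (intro LIMSEQ_le_const[OF d]) auto
  moreover have "(\<integral>x. h x \<partial>L) = (\<integral>x. g x \<partial>L)"
    using gh int by (intro integral_cong_AE) (auto elim: eventually_mono)
  ultimately show "(\<integral>x. h x \<partial>L) = 0" by simp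
  have close: "\<bar>\<psi> n x - primitive g x\<bar> \<le> d n" if "x \<in> \<Omega>" for n x
  proof -
    have "\<psi> n x - primitive g x = primitive (\<lambda>x. deriv (\<psi> n) x - g x) x"
      using test_function_primitive_deriv(1)[OF \<psi>[of n], of x] that primitive_diff[OF di int(1)] by simp
    then show ?thesis
      unfolding d_def using abs_primitive_le[of "\<lambda>x. deriv (\<psi> n) x - g x" x] di int(1) by simp
  qed
  have pi: "integrable L (primitive g)"
    using integrable_bounded_mult[OF bounded_measurable_lebesgue_on[OF bounded_measurable_primitive[OF int(1)]] integrable_L_const[of 1]]
    by simp
  have "(\<integral>x. \<bar>\<phi> x - primitive g x\<bar> \<partial>L) \<le> e n + d n * measure L (space L)" for n
  proof -
    have "(\<integral>x. \<bar>\<phi> x - primitive g x\<bar> \<partial>L) \<le> (\<integral>x. \<bar>\<psi> n x - \<phi> x\<bar> + d n \<partial>L)"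
    proof (rule integral_mono)
      show "integrable L (\<lambda>x. \<bar>\<phi> x - primitive g x\<bar>)" using pi int(3) by simp
      show "integrable L (\<lambda>x. \<bar>\<psi> n x - \<phi> x\<bar> + d n)"
        using integrable_smooth[OF s(1)] int(3) by simp
      show "\<bar>\<phi> x - primitive g x\<bar> \<le> \<bar>\<psi> n x - \<phi> x\<bar> + d n" if "x \<in> space L" for x
        using close[of x n] that by simp
    qed
    also have "\<dots> = e n + d n * measure L (space L)"
      unfolding e_def using integrable_smooth[OF s(1)] int(3) by simp
    finally show ?thesis .
  qed
  moreover have "(\<lambda>n. e n + d n * measure L (space L)) \<longlonglongrightarrow> 0 + 0 * measure L (space L)"
    by (intro tendsto_add tendsto_mult e d tendsto_const)
  ultimately have "(\<integral>x. \<bar>\<phi> x - primitive g x\<bar> \<partial>L) \<le> 0"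
    by (intro LIMSEQ_le_const[of _ 0]) auto
  then have "(\<integral>x. \<bar>\<phi> x - primitive g x\<bar> \<partial>L) = 0"
    by (intro antisym Bochner_Integration.integral_nonneg) auto
  then have "AE x in L. \<bar>\<phi> x - primitive g x\<bar> = 0"
    using integral_nonneg_eq_0_iff_AE[of L "\<lambda>x. \<bar>\<phi> x - primitive g x\<bar>"] pi int(3) by simp
  then have ae: "AE x in L. \<bar>\<phi> x - primitive g x\<bar> \<le> 0" by eventually_elim simp
  have "continuous_on \<Omega> (\<lambda>x. \<bar>\<phi> x - primitive g x\<bar>)"
    by (intro continuous_intros \<phi>(2) continuous_on_subset[OF continuous_primitive[OF int(1)]]) auto
  then have "\<phi> x = primitive g x" if "x \<in> \<Omega>" for x
    using AE_le_continuous[OF _ ae that] by simp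
  moreover have "primitive g x = primitive h x" for x
    unfolding primitive_def
    using gh integrable_indicator_mult[OF int(1), of "{..x}"] integrable_indicator_mult[OF int(2), of "{..x}"]
    by (intro integral_cong_AE) (auto elim: eventually_mono)
  ultimately show "\<phi> x = primitive h x" if "x \<in> \<Omega>" for x using that by simp
qed

lemma integrable_locally_integrable:
  assumes "integrable L g"
  shows "g \<in> locally_integrable \<Omega>"
  unfolding locally_integrable_def
proof (intro CollectI allI impI)
  fix K assume K: "compact K \<and> K \<subseteq> \<Omega>"
  then have Ks: "K \<in> sets lebesgue" using borel_compact[of K] by auto
  have "set_integrable lebesgue \<Omega> g"
    using assms by (simp add: integrable_restrict_space set_integrable_def)
  then have "set_integrable lebesgue K g"
    by (rule set_integrable_subset) (use K Ks in auto)
  then show "integrable (lebesgue_on K) g"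
    using Ks by (simp add: integrable_restrict_space set_integrable_def)
qed

text \<open>The primitive of \<open>h\<close> is the distribution function of the measure with
  density \<open>h\<close>, so the weak derivative is a special case of the measure
  derivative.\<close>

lemma primitive_has_weak_derivative:
  assumes h: "integrable L h"
  shows "has_weak_derivative \<Omega> (primitive h) h"
  unfolding has_weak_derivative_def
proof (intro conjI ballI)
  note sm = signed_measure_lebesgue_density[OF h]
  have "integrable L (primitive h)"
    using integrable_bounded_mult[OF bounded_measurable_lebesgue_on[OF bounded_measurable_primitive[OF h]] integrable_L_const[of 1]]
    by simp
  then show "primitive h \<in> locally_integrable \<Omega>" by (rule integrable_locally_integrable)
  show "h \<in> locally_integrable \<Omega>" by (rule integrable_locally_integrable[OF h])
  have c: "cumul (lebesgue_density \<Omega> h) x = primitive h x" for x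
    unfolding cumul_def primitive_def set_integral_lebesgue_density[OF h Atmost_borel_on]
    by (rule Bochner_Integration.integral_cong) (auto simp: indicator_def)
  fix \<psi> assume \<psi>: "\<psi> \<in> test_functions \<Omega>"
  have "(\<integral>x. primitive h x * deriv \<psi> x \<partial>L) = - signed_integral (borel_on \<Omega>) (lebesgue_density \<Omega> h) \<psi>"
    using has_measure_derivative_cumul[OF sm, of 0] \<psi> by (simp add: has_measure_derivative_def c)
  also have "\<dots> = - (\<integral>x. h x * \<psi> x \<partial>L)"
    using signed_integral_lebesgue_density[OF h bounded_measurable_smooth[OF test_function_smooth[OF \<psi>]]]
    by (simp add: mult.commute)
  finally show "(\<integral>x. primitive h x * deriv \<psi> x \<partial>L) = - (\<integral>x. h x * \<psi> x \<partial>L)" .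
qed

text \<open>Test functions \<open>\<xi> n\<close> that tend to \<open>h\<close> in L2 need not have
  test functions as primitives. Subtracting \<open>m n * \<eta>\<close> makes the means zero and is
  harmless in the limit; taking primitives is continuous from L1 to the sup norm, so the primitives
  converge too.\<close>

lemma primitive_in_H01:
  assumes h: "h \<in> Lp L 2" and zero: "(\<integral>x. h x \<partial>L) = 0"
  shows "primitive h \<in> H01 \<Omega>"
proof -
  have int: "integrable L h" using Lp_integrable(1)[OF _ h] by simp
  have pL: "primitive h \<in> Lp L 2"
    by (rule bounded_measurable_Lp[OF _ bounded_measurable_lebesgue_on[OF bounded_measurable_primitive[OF int]]]) simp
  define C where "C = Lp_norm L (2 / (2 - 1)) (\<lambda>_. 1)"
  have L1: "(\<integral>x. \<bar>k x\<bar> \<partial>L) \<le> C * Lp_norm L 2 k" if "k \<in> Lp L 2" for k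
    unfolding C_def using Lp_integrable(2)[OF _ that] by simp
  obtain \<eta> where \<eta>: "\<eta> \<in> test_functions \<Omega>" "(\<integral>x. \<eta> x \<partial>L) = 1"
    using exists_normalized_test_function by blast
  have "\<exists>\<psi>\<in>test_functions \<Omega>. Lp_norm L 2 (\<lambda>x. \<psi> x - h x) < 1 / real (Suc n)" for n
    using test_functions_dense_Lp[OF _ h] by (simp add: test_limit_def)
  then obtain \<xi> where \<xi>: "\<And>n. \<xi> n \<in> test_functions \<Omega>"
    "\<And>n. Lp_norm L 2 (\<lambda>x. \<xi> n x - h x) < 1 / real (Suc n)"
    by metis
  have \<xi>L: "\<xi> n \<in> Lp L 2" and \<eta>L: "\<eta> \<in> Lp L 2" for n
    using smooth_Lp[OF _ test_function_smooth] \<xi>(1) \<eta>(1) by auto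
  have \<xi>0: "(\<lambda>n. Lp_norm L 2 (\<lambda>x. \<xi> n x - h x)) \<longlonglongrightarrow> 0"
  proof (rule tendsto_sandwich[OF _ _ tendsto_const LIMSEQ_Suc[OF lim_1_over_n]])
    show "\<forall>\<^sub>F n in sequentially. Lp_norm L 2 (\<lambda>x. \<xi> n x - h x) \<le> 1 / real (Suc n)"
      by (intro always_eventually allI less_imp_le \<xi>(2))
  qed (simp add: Lp_norm_nonneg)
  define m where "m n = (\<integral>x. \<xi> n x \<partial>L)" for n
  \<comment> \<open>Since \<open>h\<close> has mean zero, \<open>m n\<close> is the mean of
    \<open>\<xi> n - h\<close>, which is controlled by the L1 norm.\<close>
  have m0: "m \<longlonglongrightarrow> 0"
  proof (rule tendsto_rabs_zero_cancel, rule tendsto_sandwich[OF _ _ tendsto_const])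
    show "\<forall>\<^sub>F n in sequentially. \<bar>m n\<bar> \<le> (\<integral>x. \<bar>\<xi> n x - h x\<bar> \<partial>L)"
    proof (rule always_eventually, rule allI)
      fix n
      have "m n = (\<integral>x. \<xi> n x - h x \<partial>L)"
        unfolding m_def using integrable_smooth[OF test_function_smooth[OF \<xi>(1)]] int zero by simp
      then show "\<bar>m n\<bar> \<le> (\<integral>x. \<bar>\<xi> n x - h x\<bar> \<partial>L)"
        using integral_abs_bound[of L "\<lambda>x. \<xi> n x - h x"] by simp
    qed
    show "(\<lambda>n. \<integral>x. \<bar>\<xi> n x - h x\<bar> \<partial>L) \<longlonglongrightarrow> 0"
      by (rule L1_tendsto_zero[OF Lp_diff[OF _ \<xi>L h] \<xi>0]) simp
  qed simp
  define \<zeta> where "\<zeta> n x = \<xi> n x + (- m n) * \<eta> x" for n x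
  have \<zeta>: "\<zeta> n \<in> test_functions \<Omega>" for n
    unfolding \<zeta>_def by (intro test_functions_add test_functions_cmult \<xi> \<eta>)
  have \<zeta>L: "\<zeta> n \<in> Lp L 2" for n
    using smooth_Lp[OF _ test_function_smooth[OF \<zeta>]] by simp
  have \<zeta>z: "(\<integral>x. \<zeta> n x \<partial>L) = 0" for n
    unfolding \<zeta>_def using integrable_smooth[OF test_function_smooth[OF \<xi>(1)[of n]]]
      integrable_smooth[OF test_function_smooth[OF \<eta>(1)]] \<eta>(2) by (simp add: m_def)
  have \<zeta>0: "(\<lambda>n. Lp_norm L 2 (\<lambda>x. \<zeta> n x - h x)) \<longlonglongrightarrow> 0"
  proof (rule tendsto_sandwich[OF _ _ tendsto_const])
    show "\<forall>\<^sub>F n in sequentially. Lp_norm L 2 (\<lambda>x. \<zeta> n x - h x) \<le>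
        Lp_norm L 2 (\<lambda>x. \<xi> n x - h x) + \<bar>m n\<bar> * Lp_norm L 2 \<eta>"
    proof (rule always_eventually, rule allI)
      fix n
      have "Lp_norm L 2 (\<lambda>x. (\<xi> n x - h x) + (- m n) * \<eta> x) \<le>
          Lp_norm L 2 (\<lambda>x. \<xi> n x - h x) + Lp_norm L 2 (\<lambda>x. (- m n) * \<eta> x)"
        by (rule Lp_norm_triangle[OF _ Lp_diff[OF _ \<xi>L h] Lp_cmult[OF \<eta>L]]) auto
      also have "Lp_norm L 2 (\<lambda>x. (- m n) * \<eta> x) = \<bar>m n\<bar> * Lp_norm L 2 \<eta>"
        by (subst Lp_norm_cmult) auto
      also have "(\<lambda>x. (\<xi> n x - h x) + (- m n) * \<eta> x) = (\<lambda>x. \<zeta> n x - h x)"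
        by (auto simp: \<zeta>_def)
      finally show "Lp_norm L 2 (\<lambda>x. \<zeta> n x - h x) \<le>
          Lp_norm L 2 (\<lambda>x. \<xi> n x - h x) + \<bar>m n\<bar> * Lp_norm L 2 \<eta>" .
    qed
    have "(\<lambda>n. Lp_norm L 2 (\<lambda>x. \<xi> n x - h x) + \<bar>m n\<bar> * Lp_norm L 2 \<eta>) \<longlonglongrightarrow> 0 + \<bar>0\<bar> * Lp_norm L 2 \<eta>"
      by (intro tendsto_add tendsto_mult tendsto_rabs \<xi>0 m0 tendsto_const)
    then show "(\<lambda>n. Lp_norm L 2 (\<lambda>x. \<xi> n x - h x) + \<bar>m n\<bar> * Lp_norm L 2 \<eta>) \<longlonglongrightarrow> 0" by simp
  qed (simp add: Lp_norm_nonneg)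
  obtain \<psi> where \<psi>: "\<And>n. \<psi> n \<in> test_functions \<Omega>" "\<And>n. deriv (\<psi> n) = \<zeta> n"
    using test_function_primitive[OF \<zeta> \<zeta>z] by metis
  have close: "AE x in L. \<bar>\<psi> n x - primitive h x\<bar> \<le> \<bar>C * Lp_norm L 2 (\<lambda>x. \<zeta> n x - h x)\<bar>" for n
  proof (rule AE_I2)
    fix x assume x: "x \<in> space L"
    have zi: "integrable L (\<zeta> n)" by (rule integrable_smooth[OF test_function_smooth[OF \<zeta>]])
    have "\<psi> n x = primitive (\<zeta> n) x"
      using test_function_primitive_deriv(1)[OF \<psi>(1)[of n], of x] x by (simp add: \<psi>(2))
    then have "\<psi> n x - primitive h x = primitive (\<lambda>x. \<zeta> n x - h x) x"
      by (simp add: primitive_diff[OF zi int])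
    also have "\<bar>\<dots>\<bar> \<le> (\<integral>x. \<bar>\<zeta> n x - h x\<bar> \<partial>L)"
      by (rule abs_primitive_le) (use zi int in simp)
    also have "\<dots> \<le> C * Lp_norm L 2 (\<lambda>x. \<zeta> n x - h x)"
      by (rule L1[OF Lp_diff[OF _ \<zeta>L h]]) simp
    finally show "\<bar>\<psi> n x - primitive h x\<bar> \<le> \<bar>C * Lp_norm L 2 (\<lambda>x. \<zeta> n x - h x)\<bar>" by simp
  qed
  have \<psi>m: "(\<lambda>x. \<psi> n x - primitive h x) \<in> borel_measurable L" for n
    using LpD(1)[OF smooth_Lp[OF _ test_function_smooth[OF \<psi>(1)[of n]]], of 2] LpD(1)[OF pL] by simp
  have "(\<lambda>n. Lp_norm L 2 (\<lambda>x. \<psi> n x - primitive h x)) \<longlonglongrightarrow> 0"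
  proof (rule tendsto_sandwich[OF _ _ tendsto_const])
    let ?e = "\<lambda>n. C * Lp_norm L 2 (\<lambda>x. \<zeta> n x - h x)"
    show "\<forall>\<^sub>F n in sequentially. Lp_norm L 2 (\<lambda>x. \<psi> n x - primitive h x) \<le> \<bar>?e n\<bar> * Lp_norm L 2 (\<lambda>_. 1)"
    proof (rule always_eventually, rule allI)
      fix n
      have "Lp_norm L 2 (\<lambda>x. \<psi> n x - primitive h x) \<le> Lp_norm L 2 (\<lambda>_. ?e n * 1)"
        by (rule Lp_norm_mono[OF _ _ \<psi>m]) (use close[of n] in \<open>simp_all add: const_Lp\<close>)
      also have "\<dots> = \<bar>?e n\<bar> * Lp_norm L 2 (\<lambda>_. 1)" by (rule Lp_norm_cmult) simp
      finally show "Lp_norm L 2 (\<lambda>x. \<psi> n x - primitive h x) \<le> \<bar>?e n\<bar> * Lp_norm L 2 (\<lambda>_. 1)" .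
    qed
    have "(\<lambda>n. \<bar>?e n\<bar> * Lp_norm L 2 (\<lambda>_. 1)) \<longlonglongrightarrow> \<bar>C * 0\<bar> * Lp_norm L 2 (\<lambda>_. 1)"
      by (intro tendsto_mult tendsto_rabs \<zeta>0 tendsto_const)
    then show "(\<lambda>n. \<bar>?e n\<bar> * Lp_norm L 2 (\<lambda>_. 1)) \<longlonglongrightarrow> 0" by simp
  qed (simp add: Lp_norm_nonneg)
  then show ?thesis
    unfolding H01_def using pL h primitive_has_weak_derivative[OF int] \<psi> \<zeta>0
    by (intro CollectI conjI bexI[of _ h] exI[of _ \<psi>]) auto
qed

end

section \<open>The optimality system\<close>

text \<open>The one-sided first-order condition. Only positive \<open>t\<close> occur because the
  norms bring one-sided bounds; dividing by \<open>t\<close> and letting it tend to 0 removes the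
  quadratic term.\<close>

lemma nonneg_of_quadratic:
  fixes A C :: real
  assumes "\<And>t. 0 < t \<Longrightarrow> t < 1 \<Longrightarrow> 0 \<le> t * A + t\<^sup>2 * C"
  shows "0 \<le> A"
proof -
  \<comment> \<open>The shift by two keeps \<open>t n\<close> strictly below 1 from the
    start.\<close>
  define t where "t n = 1 / (real (Suc (Suc n)))" for n
  have "0 \<le> A + t n * C" for n
  proof -
    have t: "0 < t n" "t n < 1" by (auto simp: t_def)
    have "0 \<le> t n * (A + t n * C)"
      using assms[OF t] by (simp add: power2_eq_square distrib_left mult.assoc)
    then show ?thesis using t(1) by (simp add: zero_le_mult_iff)
  qed
  moreover have "t \<longlonglongrightarrow> 0"
    unfolding t_def by (rule LIMSEQ_Suc[OF LIMSEQ_Suc[OF lim_1_over_n]])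
  then have "(\<lambda>n. A + t n * C) \<longlonglongrightarrow> A + 0 * C"
    by (intro tendsto_intros)
  ultimately show ?thesis
    using LIMSEQ_le_const[of "\<lambda>n. A + t n * C" "A + 0 * C" 0] by auto
qed

lemma Lp_norm_2_sq: "(Lp_norm M 2 f)\<^sup>2 = (\<integral>x. (f x)\<^sup>2 \<partial>M)"
proof -
  have "(Lp_norm M 2 f)\<^sup>2 = Lp_norm M 2 f powr 2"
    using Lp_norm_nonneg[of M 2 f] by simp
  then show ?thesis by (simp add: Lp_norm_powr)
qed

lemma integrable_L2_mult:
  assumes "f \<in> Lp M 2" "g \<in> Lp M 2"
  shows "integrable M (\<lambda>x. f x * g x)"
  using integrable_Lp_mult[of 2 2 f M g] assms by simp

section \<open>Functions of bounded variation and residual measures\<close>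

context bounded_interval
begin

lemma BV_D:
  assumes "u \<in> BV \<Omega>"
  shows "integrable L u" "has_measure_derivative \<Omega> u (distr_deriv \<Omega> u)"
    "signed_measure (borel_on \<Omega>) (distr_deriv \<Omega> u)"
  using assms has_measure_derivative_distr_deriv[OF assms] by (auto simp: BV_def has_measure_derivative_def)

lemma BV_Lp:
  assumes p: "0 < p" and u: "u \<in> BV \<Omega>"
  shows "u \<in> Lp L p"
proof -
  obtain K where "AE x in L. \<bar>u x\<bar> \<le> K" using BV_AE_bounded[OF u] by blast
  then show ?thesis
    by (rule Lp_AE_bound[OF p const_Lp[OF p] borel_measurable_integrable[OF BV_D(1)[OF u]]])
qed

lemma BV_linear:
  assumes u: "u \<in> BV \<Omega>" and v: "v \<in> BV \<Omega>"
  shows "(\<lambda>x. s * u x + t * v x) \<in> BV \<Omega>"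
    and "distr_deriv \<Omega> (\<lambda>x. s * u x + t * v x) = (\<lambda>A. s * distr_deriv \<Omega> u A + t * distr_deriv \<Omega> v A)"
proof -
  note lin = has_measure_derivative_linear[OF BV_D(1,2)[OF u] BV_D(1,2)[OF v], of s t]
  have "integrable L (\<lambda>x. s * u x + t * v x)" using BV_D(1)[OF u] BV_D(1)[OF v] by simp
  then show "(\<lambda>x. s * u x + t * v x) \<in> BV \<Omega>" using lin by (auto simp: BV_def)
  show "distr_deriv \<Omega> (\<lambda>x. s * u x + t * v x) = (\<lambda>A. s * distr_deriv \<Omega> u A + t * distr_deriv \<Omega> v A)"
    by (rule distr_deriv_eq[OF lin])
qed

lemma cumul_BV:
  assumes sm: "signed_measure (borel_on \<Omega>) \<mu>"
  shows "(\<lambda>x. k + cumul \<mu> x) \<in> BV \<Omega>" "distr_deriv \<Omega> (\<lambda>x. k + cumul \<mu> x) = \<mu>"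
proof -
  note d = has_measure_derivative_cumul[OF sm, of k]
  have "integrable L (\<lambda>x. k + cumul \<mu> x)"
    using integrable_cumul[OF sm] integrable_L_const[of k] by simp
  then show "(\<lambda>x. k + cumul \<mu> x) \<in> BV \<Omega>" using d by (auto simp: BV_def)
  show "distr_deriv \<Omega> (\<lambda>x. k + cumul \<mu> x) = \<mu>" by (rule distr_deriv_eq[OF d])
qed

lemma residual_measure_linear:
  assumes u: "u \<in> BV \<Omega>" and v: "v \<in> BV \<Omega>" and w: "integrable L w" and z: "integrable L z"
  shows "residual_measure \<Omega> (\<lambda>x. s * u x + t * v x) (\<lambda>x. s * w x + t * z x) =
    (\<lambda>A. s * residual_measure \<Omega> u w A + t * residual_measure \<Omega> v z A)"
proof
  fix A
  have "lebesgue_density \<Omega> (\<lambda>x. s * w x + t * z x) A = s * lebesgue_density \<Omega> w A + t * lebesgue_density \<Omega> z A"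
  proof (cases "A \<in> sets (borel_on \<Omega>)")
    case True
    have AL: "A \<in> sets L" by (rule subsetD[OF sets_borel_on_subset True])
    have i: "integrable L (\<lambda>x. indicator A x * w x)" "integrable L (\<lambda>x. indicator A x * z x)"
      using integrable_mult_indicator[OF AL w] integrable_mult_indicator[OF AL z] by simp_all
    have wz: "integrable L (\<lambda>x. s * w x + t * z x)" using w z by simp
    have "(\<lambda>x. indicator A x * (s * w x + t * z x)) =
        (\<lambda>x. s * (indicator A x * w x) + t * (indicator A x * z x))"
      by (simp add: fun_eq_iff distrib_left mult.left_commute)
    then show ?thesis
      unfolding set_integral_lebesgue_density[OF w True] set_integral_lebesgue_density[OF z True]
        set_integral_lebesgue_density[OF wz True]
      using i by simp
  qed (simp add: lebesgue_density_def)
  then show "residual_measure \<Omega> (\<lambda>x. s * u x + t * v x) (\<lambda>x. s * w x + t * z x) A =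
    s * residual_measure \<Omega> u w A + t * residual_measure \<Omega> v z A"
    unfolding residual_measure_def BV_linear(2)[OF u v] by (simp add: algebra_simps)
qed

lemma residual_measure_alt:
  "residual_measure \<Omega> u w = (\<lambda>A. 1 * distr_deriv \<Omega> u A + (-1) * lebesgue_density \<Omega> w A)"
  by (simp add: residual_measure_def)

lemma signed_measure_residual:
  assumes "u \<in> BV \<Omega>" "integrable L w"
  shows "signed_measure (borel_on \<Omega>) (residual_measure \<Omega> u w)"
  unfolding residual_measure_alt
  by (rule signed_measure_linear[OF BV_D(3)[OF assms(1)] signed_measure_lebesgue_density[OF assms(2)]])

lemma signed_integral_residual:
  assumes "u \<in> BV \<Omega>" "integrable L w" "g \<in> bounded_measurable (borel_on \<Omega>)"
  shows "signed_integral (borel_on \<Omega>) (residual_measure \<Omega> u w) g =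
    signed_integral (borel_on \<Omega>) (distr_deriv \<Omega> u) g - (\<integral>x. g x * w x \<partial>L)"
  unfolding residual_measure_alt
    signed_integral_linear[OF BV_D(3)[OF assms(1)] signed_measure_lebesgue_density[OF assms(2)] assms(3)]
    signed_integral_lebesgue_density[OF assms(2,3)] by simp

lemma Radon_norm_linear_le:
  assumes "signed_measure (borel_on \<Omega>) \<mu>" "signed_measure (borel_on \<Omega>) \<nu>"
  shows "Radon_norm \<Omega> (\<lambda>A. s * \<mu> A + t * \<nu> A) \<le> \<bar>s\<bar> * Radon_norm \<Omega> \<mu> + \<bar>t\<bar> * Radon_norm \<Omega> \<nu>"
  using total_variation_linear_le[OF assms] by (simp add: Radon_norm_def)

lemma abs_signed_integral_le_Radon_norm:
  assumes "signed_measure (borel_on \<Omega>) \<mu>" "g \<in> bounded_measurable (borel_on \<Omega>)"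
    and "\<And>x. x \<in> \<Omega> \<Longrightarrow> \<bar>g x\<bar> \<le> K"
  shows "\<bar>signed_integral (borel_on \<Omega>) \<mu> g\<bar> \<le> K * Radon_norm \<Omega> \<mu>"
  using abs_signed_integral_le[OF assms(1,2), of K] assms(3) by (simp add: Radon_norm_def mult.commute)

section \<open>Membership in the set-valued sign\<close>

lemma SgnD:
  assumes "\<phi> \<in> (\<lambda>v x. \<alpha> * v x) ` Sgn \<Omega> \<nu>" "0 < \<alpha>"
  shows "AE x in L. \<bar>\<phi> x\<bar> \<le> \<alpha>"
    and "AE x in total_variation (borel_on \<Omega>) \<nu>. \<phi> x = \<alpha> * sgn_measure (borel_on \<Omega>) \<nu> x"
proof -
  obtain v where v: "v \<in> Sgn \<Omega> \<nu>" "\<phi> = (\<lambda>x. \<alpha> * v x)" using assms(1) by blast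
  have le: "Linf_norm L v \<le> 1" using v(1) by (simp add: Sgn_def)
  have "AE x in L. ereal \<bar>v x\<bar> \<le> Linf_norm L v"
    unfolding Linf_norm_def by (rule esssup_AE)
  then show "AE x in L. \<bar>\<phi> x\<bar> \<le> \<alpha>"
  proof eventually_elim
    case (elim x)
    have "ereal \<bar>v x\<bar> \<le> 1" using elim le by (rule order_trans)
    then have "\<bar>v x\<bar> \<le> 1" by simp
    then show ?case using assms(2) mult_left_mono[of "\<bar>v x\<bar>" 1 \<alpha>] by (simp add: v(2) abs_mult)
  qed
  have "AE x in total_variation (borel_on \<Omega>) \<nu>. v x = sgn_measure (borel_on \<Omega>) \<nu> x"
    using v(1) by (simp add: Sgn_def)
  then show "AE x in total_variation (borel_on \<Omega>) \<nu>. \<phi> x = \<alpha> * sgn_measure (borel_on \<Omega>) \<nu> x"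
    by eventually_elim (simp add: v(2))
qed

text \<open>Continuity makes the candidate Borel measurable, which covers both measurability
  requirements of \<open>Sgn\<close>, and the pointwise bound gives both essential bounds at
  once.\<close>

lemma SgnI:
  assumes \<phi>: "continuous_on UNIV \<phi>" and \<alpha>: "0 < \<alpha>" and le: "\<And>x. x \<in> \<Omega> \<Longrightarrow> \<bar>\<phi> x\<bar> \<le> \<alpha>"
    and ae: "AE x in total_variation (borel_on \<Omega>) \<nu>. \<phi> x = \<alpha> * sgn_measure (borel_on \<Omega>) \<nu> x"
  shows "\<phi> \<in> (\<lambda>v x. \<alpha> * v x) ` Sgn \<Omega> \<nu>"
proof -
  let ?T = "total_variation (borel_on \<Omega>) \<nu>"
  define v where "v x = \<phi> x / \<alpha>" for x
  have vm: "v \<in> borel_measurable (borel_on \<Omega>)"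
    unfolding v_def using \<alpha> \<phi>
    by (intro measurable_restrict_space1 borel_measurable_continuous_onI continuous_intros) auto
  have v1: "\<bar>v x\<bar> \<le> 1" if "x \<in> \<Omega>" for x
    using le[OF that] \<alpha> by (simp add: v_def)
  have norm_le: "Linf_norm M v \<le> 1" if "v \<in> borel_measurable M" "space M = \<Omega>" for M
    unfolding Linf_norm_def
  proof (rule esssup_I)
    show "(\<lambda>x. ereal \<bar>v x\<bar>) \<in> borel_measurable M" using that(1) by measurable
    show "AE x in M. ereal \<bar>v x\<bar> \<le> 1"
      by (rule AE_I2) (use v1 that(2) in auto)
  qed
  have Linf: "v \<in> Linf M" if "v \<in> borel_measurable M" "space M = \<Omega>" for M
    unfolding Linf_def using that(1) norm_le[OF that] by (auto intro: le_less_trans)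
  have vL: "v \<in> borel_measurable L" by (rule borel_measurable_lebesgue_on_of_borel_on[OF vm])
  have vT: "v \<in> borel_measurable (completion ?T)"
    using vm by (intro measurable_completion) (simp cong: measurable_cong_sets)
  have "AE x in ?T. v x = sgn_measure (borel_on \<Omega>) \<nu> x"
    using ae by eventually_elim (use \<alpha> in \<open>simp add: v_def\<close>)
  then have "v \<in> Sgn \<Omega> \<nu>"
    unfolding Sgn_def using Linf[OF vL] Linf[OF vT] norm_le[OF vL] by simp
  moreover have "\<phi> = (\<lambda>x. \<alpha> * v x)" using \<alpha> by (simp add: v_def fun_eq_iff)
  ultimately show ?thesis by blast
qed

lemma signed_integral_eq_Radon_norm:
  assumes sm: "signed_measure (borel_on \<Omega>) \<nu>" and g: "g \<in> bounded_measurable (borel_on \<Omega>)"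
    and ae: "AE x in total_variation (borel_on \<Omega>) \<nu>. g x = \<alpha> * sgn_measure (borel_on \<Omega>) \<nu> x"
  shows "signed_integral (borel_on \<Omega>) \<nu> g = \<alpha> * Radon_norm \<Omega> \<nu>"
proof -
  let ?T = "total_variation (borel_on \<Omega>) \<nu>"
  have "signed_integral (borel_on \<Omega>) \<nu> g = (\<integral>x. \<alpha> \<partial>?T)"
    unfolding signed_integral_def
  proof (rule integral_cong_AE)
    show "(\<lambda>x. g x * sgn_measure (borel_on \<Omega>) \<nu> x) \<in> borel_measurable ?T"
      by (rule borel_measurable_integrable[OF integrable_mult_sgn_measure[OF sm g]])
    show "AE x in ?T. g x * sgn_measure (borel_on \<Omega>) \<nu> x = \<alpha>"
      using ae AE_abs_sgn_measure[OF sm]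
    proof eventually_elim
      case (elim x)
      have "sgn_measure (borel_on \<Omega>) \<nu> x * sgn_measure (borel_on \<Omega>) \<nu> x = 1"
        using abs_mult_self_eq[of "sgn_measure (borel_on \<Omega>) \<nu> x"] elim(2) by simp
      then show ?case by (simp add: elim(1) mult.assoc)
    qed
  qed simp
  then show ?thesis by (simp add: Radon_norm_def mult.commute)
qed

text \<open>The equality case of the norm bound: \<open>\<alpha> - g * sgn\<close> is nonnegative
  with integral zero, hence vanishes almost everywhere, and multiplying by the sign, whose square is
  1, solves for \<open>g\<close>.\<close>

lemma AE_eq_sgn_measure:
  assumes sm: "signed_measure (borel_on \<Omega>) \<nu>" and g: "g \<in> bounded_measurable (borel_on \<Omega>)"
    and le: "\<And>x. x \<in> \<Omega> \<Longrightarrow> \<bar>g x\<bar> \<le> \<alpha>"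
    and eq: "signed_integral (borel_on \<Omega>) \<nu> g = \<alpha> * Radon_norm \<Omega> \<nu>"
  shows "AE x in total_variation (borel_on \<Omega>) \<nu>. g x = \<alpha> * sgn_measure (borel_on \<Omega>) \<nu> x"
proof -
  let ?T = "total_variation (borel_on \<Omega>) \<nu>" and ?s = "sgn_measure (borel_on \<Omega>) \<nu>"
  interpret finite_measure ?T by (rule finite_measure_total_variation[OF sm])
  note i = integrable_mult_sgn_measure[OF sm g]
  have int: "integrable ?T (\<lambda>x. \<alpha> - g x * ?s x)" using i by simp
  have nonneg: "AE x in ?T. 0 \<le> \<alpha> - g x * ?s x"
    using AE_abs_sgn_measure[OF sm] AE_space
  proof eventually_elim
    case (elim x)
    have "g x * ?s x \<le> \<bar>g x\<bar> * \<bar>?s x\<bar>" unfolding abs_mult[symmetric] by (rule abs_ge_self)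
    then show ?case using elim le[of x] by simp
  qed
  have "(\<integral>x. \<alpha> - g x * ?s x \<partial>?T) = \<alpha> * Radon_norm \<Omega> \<nu> - signed_integral (borel_on \<Omega>) \<nu> g"
    using i by (simp add: signed_integral_def Radon_norm_def mult.commute)
  then have "AE x in ?T. \<alpha> - g x * ?s x = 0"
    using integral_nonneg_eq_0_iff_AE[OF int nonneg] eq by simp
  then show ?thesis
    using AE_abs_sgn_measure[OF sm]
  proof eventually_elim
    case (elim x)
    have "?s x * ?s x = 1" using abs_mult_self_eq[of "?s x"] elim(2) by simp
    then have "g x = g x * (?s x * ?s x)" by simp
    also have "\<dots> = \<alpha> * ?s x" using elim(1) by (simp add: mult.assoc[symmetric])
    finally show ?case .
  qed
qed

text \<open>The coefficient 1 keeps the shape of \<open>BV_linear\<close>. The linear term carries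
  \<open>u - f\<close>, the weak derivative of the function \<open>\<phi>\<close> sought.\<close>

lemma L2_expansion:
  assumes f: "f \<in> Lp L 2" and u: "u \<in> Lp L 2" and v: "v \<in> Lp L 2"
  shows "1 / 2 * (Lp_norm L 2 (\<lambda>x. f x - (1 * u x + t * v x)))\<^sup>2 =
    1 / 2 * (Lp_norm L 2 (\<lambda>x. f x - u x))\<^sup>2 + t * (\<integral>x. (u x - f x) * v x \<partial>L) + t\<^sup>2 * (1 / 2 * (\<integral>x. v x * v x \<partial>L))"
proof -
  have d: "(\<lambda>x. u x - f x) \<in> Lp L 2" by (rule Lp_diff[OF _ u f]) simp
  have i: "integrable L (\<lambda>x. (u x - f x) * (u x - f x))" "integrable L (\<lambda>x. (u x - f x) * v x)" "integrable L (\<lambda>x. v x * v x)"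
    by (intro integrable_L2_mult d v)+
  have "(\<integral>x. (f x - (1 * u x + t * v x))\<^sup>2 \<partial>L) =
      (\<integral>x. (u x - f x) * (u x - f x) + (2 * t * ((u x - f x) * v x) + t\<^sup>2 * (v x * v x)) \<partial>L)"
    by (rule Bochner_Integration.integral_cong) (auto simp: power2_eq_square algebra_simps)
  also have "\<dots> = (\<integral>x. (u x - f x) * (u x - f x) \<partial>L) + (2 * t * (\<integral>x. (u x - f x) * v x \<partial>L) + t\<^sup>2 * (\<integral>x. v x * v x \<partial>L))"
    using i by simp
  also have "(\<integral>x. (u x - f x) * (u x - f x) \<partial>L) = (\<integral>x. (f x - u x)\<^sup>2 \<partial>L)"
    by (rule Bochner_Integration.integral_cong) (auto simp: power2_eq_square algebra_simps)
  finally show ?thesis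
    unfolding Lp_norm_2_sq by (simp add: algebra_simps)
qed

text \<open>The linear term of the square is minus the pairing of \<open>\<Phi>\<close> with the
  change of \<open>Du\<close>, which splits into the changes of the residual and of
  \<open>w\<close>. At \<open>(w, u)\<close> each weighted norm equals its pairing with
  \<open>\<Phi>\<close>, elsewhere it is at least the pairing, so the norms compensate the linear
  term and half of \<open>\<integral>v^2\<close> remains.\<close>

lemma optimality_sufficient:
  assumes p: "1 < p" and q: "q = p / (p - 1)" and \<alpha>: "0 < \<alpha>"
    and f: "f \<in> Lp L 2" and w: "w \<in> Lp L p" and u: "u \<in> BV \<Omega>"
    and zero: "(\<integral>x. u x - f x \<partial>L) = 0"
    and \<Phi>: "\<Phi> = primitive (\<lambda>x. u x - f x)"
    and le: "\<And>x. x \<in> \<Omega> \<Longrightarrow> \<bar>\<Phi> x\<bar> \<le> \<alpha>"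
    and ae: "AE x in total_variation (borel_on \<Omega>) (residual_measure \<Omega> u w).
      \<Phi> x = \<alpha> * sgn_measure (borel_on \<Omega>) (residual_measure \<Omega> u w) x"
    and norm: "Lp_norm L q \<Phi> \<le> \<beta>" and eq: "(\<integral>x. \<Phi> x * w x \<partial>L) = \<beta> * Lp_norm L p w"
  shows "is_solution \<Omega> p \<alpha> \<beta> f (w, u)"
proof -
  let ?S = "signed_integral (borel_on \<Omega>)" and ?R = "residual_measure \<Omega>"
  have hi: "integrable L (\<lambda>x. u x - f x)"
    using BV_D(1)[OF u] Lp_integrable(1)[OF _ f] by simp
  have \<Phi>b: "\<Phi> \<in> bounded_measurable (borel_on \<Omega>)"
    unfolding \<Phi> by (rule bounded_measurable_primitive[OF hi])
  have \<Phi>q: "\<Phi> \<in> Lp L q"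
    using conj_exponent(1)[OF p q] by (intro bounded_measurable_Lp bounded_measurable_lebesgue_on \<Phi>b) simp
  have wi: "integrable L w" by (rule Lp_integrable(1)[OF p w])
  have "objective \<Omega> p \<alpha> \<beta> f (w, u) \<le> objective \<Omega> p \<alpha> \<beta> f (w', u')"
    if w': "w' \<in> Lp L p" and u': "u' \<in> BV \<Omega>" for w' u'
  proof -
    have wi': "integrable L w'" by (rule Lp_integrable(1)[OF p w'])
    define v where "v x = 1 * u' x + (-1) * u x" for x
    have v: "v \<in> BV \<Omega>" and dv: "distr_deriv \<Omega> v = (\<lambda>A. 1 * distr_deriv \<Omega> u' A + (-1) * distr_deriv \<Omega> u A)"
      using BV_linear[OF u' u, of 1 "-1"] by (simp_all add: v_def[abs_def])
    have uv: "(\<lambda>x. f x - (1 * u x + 1 * v x)) = (\<lambda>x. f x - u' x)" by (simp add: v_def)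
    have "1 / 2 * (Lp_norm L 2 (\<lambda>x. f x - u' x))\<^sup>2 =
        1 / 2 * (Lp_norm L 2 (\<lambda>x. f x - u x))\<^sup>2 + (\<integral>x. (u x - f x) * v x \<partial>L) + 1 / 2 * (\<integral>x. v x * v x \<partial>L)"
      using L2_expansion[OF f BV_Lp[OF _ u] BV_Lp[OF _ v], of 1] unfolding uv by simp
    moreover have "0 \<le> (\<integral>x. v x * v x \<partial>L)" by (rule Bochner_Integration.integral_nonneg) simp
    moreover have "(\<integral>x. (u x - f x) * v x \<partial>L) = - ?S (distr_deriv \<Omega> v) \<Phi>"
      unfolding \<Phi> by (rule BV_integral_by_parts(2)[OF v hi zero])
    moreover have "?S (distr_deriv \<Omega> v) \<Phi> = ?S (distr_deriv \<Omega> u') \<Phi> - ?S (distr_deriv \<Omega> u) \<Phi>"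
      unfolding dv signed_integral_linear[OF BV_D(3)[OF u'] BV_D(3)[OF u] \<Phi>b] by simp
    moreover have "?S (?R u' w') \<Phi> = ?S (distr_deriv \<Omega> u') \<Phi> - (\<integral>x. \<Phi> x * w' x \<partial>L)"
      by (rule signed_integral_residual[OF u' wi' \<Phi>b])
    moreover have "?S (?R u w) \<Phi> = ?S (distr_deriv \<Omega> u) \<Phi> - (\<integral>x. \<Phi> x * w x \<partial>L)"
      by (rule signed_integral_residual[OF u wi \<Phi>b])
    moreover have "?S (?R u w) \<Phi> = \<alpha> * Radon_norm \<Omega> (?R u w)"
      by (rule signed_integral_eq_Radon_norm[OF signed_measure_residual[OF u wi] \<Phi>b ae])
    moreover have "?S (?R u' w') \<Phi> \<le> \<alpha> * Radon_norm \<Omega> (?R u' w')"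
      using abs_signed_integral_le_Radon_norm[OF signed_measure_residual[OF u' wi'] \<Phi>b le] by simp
    moreover have "(\<integral>x. \<Phi> x * w' x \<partial>L) \<le> \<beta> * Lp_norm L p w'"
      using Holder_inequality[OF p q \<Phi>q w'] mult_right_mono[OF norm Lp_norm_nonneg[of L p w']] by linarith
    ultimately show ?thesis
      unfolding objective_def prod.case using eq by linarith
  qed
  then show ?thesis
    unfolding is_solution_def is_arg_min_def using w u by (auto simp: not_less)
qed

lemma optimality_necessary:
  assumes p: "1 < p" and q: "q = p / (p - 1)" and \<alpha>: "0 < \<alpha>" and \<beta>: "0 < \<beta>"
    and f: "f \<in> Lp L 2" and w: "w \<in> Lp L p" and u: "u \<in> BV \<Omega>"
    and sol: "is_solution \<Omega> p \<alpha> \<beta> f (w, u)"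
    and \<Phi>: "\<Phi> = primitive (\<lambda>x. u x - f x)"
  shows "(\<integral>x. u x - f x \<partial>L) = 0"
    and "\<And>x. x \<in> \<Omega> \<Longrightarrow> \<bar>\<Phi> x\<bar> \<le> \<alpha>"
    and "signed_integral (borel_on \<Omega>) (residual_measure \<Omega> u w) \<Phi> = \<alpha> * Radon_norm \<Omega> (residual_measure \<Omega> u w)"
    and "Lp_norm L q \<Phi> \<le> \<beta>" and "(\<integral>x. \<Phi> x * w x \<partial>L) = \<beta> * Lp_norm L p w"
proof -
  let ?S = "signed_integral (borel_on \<Omega>)" and ?R = "residual_measure \<Omega>"
  have hi: "integrable L (\<lambda>x. u x - f x)"
    using BV_D(1)[OF u] Lp_integrable(1)[OF _ f] by simp
  have \<Phi>b: "\<Phi> \<in> bounded_measurable (borel_on \<Omega>)"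
    unfolding \<Phi> by (rule bounded_measurable_primitive[OF hi])
  have \<Phi>q: "\<Phi> \<in> Lp L q"
    using conj_exponent(1)[OF p q] by (intro bounded_measurable_Lp bounded_measurable_lebesgue_on \<Phi>b) simp
  have p1: "1 \<le> p" and p0: "0 < p" using p by auto
  have wi: "integrable L w" by (rule Lp_integrable(1)[OF p w])
  note \<nu> = signed_measure_residual[OF u wi]
  \<comment> \<open>All competitors \<open>(w + t z, u + t v)\<close> at once; \<open>t\<close> may
    have either sign, and the residual moves by \<open>t\<close> times the residual of
    \<open>(z, v)\<close>.\<close>
  have variation: "0 \<le> t * (\<integral>x. (u x - f x) * v x \<partial>L) + t\<^sup>2 * (1 / 2 * (\<integral>x. v x * v x \<partial>L))
      + \<alpha> * (Radon_norm \<Omega> (\<lambda>A. 1 * ?R u w A + t * ?R v z A) - Radon_norm \<Omega> (?R u w))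
      + \<beta> * (Lp_norm L p (\<lambda>x. 1 * w x + t * z x) - Lp_norm L p w)"
    if v: "v \<in> BV \<Omega>" and z: "z \<in> Lp L p" for v z t
  proof -
    have zi: "integrable L z" by (rule Lp_integrable(1)[OF p z])
    have "(\<lambda>x. 1 * w x + t * z x) \<in> Lp L p" by (rule Lp_add[OF p1 Lp_cmult[OF w] Lp_cmult[OF z]])
    moreover have "(\<lambda>x. 1 * u x + t * v x) \<in> BV \<Omega>" by (rule BV_linear(1)[OF u v])
    ultimately have "objective \<Omega> p \<alpha> \<beta> f (w, u) \<le>
        objective \<Omega> p \<alpha> \<beta> f ((\<lambda>x. 1 * w x + t * z x), (\<lambda>x. 1 * u x + t * v x))"
      using sol unfolding is_solution_def is_arg_min_def by (auto simp: not_less)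
    then show ?thesis
      unfolding objective_def prod.case residual_measure_linear[OF u v wi zi]
        L2_expansion[OF f BV_Lp[OF zero_less_numeral u] BV_Lp[OF zero_less_numeral v]]
      by (simp add: right_diff_distrib)
  qed
  have z0: "(\<lambda>_. 0) \<in> Lp L p" by (rule const_Lp[OF p0])
  have ld0: "lebesgue_density \<Omega> (\<lambda>_. 0) A = 0" for A by (simp add: lebesgue_density_def)
  show zero: "(\<integral>x. u x - f x \<partial>L) = 0"
  proof -
    \<comment> \<open>Constants have zero derivative, so they change only the data term. This comes
      first because integration by parts against \<open>u - f\<close> presupposes mean zero.\<close>
    have sm0: "signed_measure (borel_on \<Omega>) (\<lambda>_. 0)" by (simp add: signed_measure_def)
    have c: "(\<lambda>_. k) \<in> BV \<Omega>" "distr_deriv \<Omega> (\<lambda>_. k) = (\<lambda>_. 0)" for k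
      using cumul_BV[OF sm0, of k] by (simp_all add: cumul_def)
    have "0 \<le> (\<integral>x. (u x - f x) * k \<partial>L)" for k
    proof (rule nonneg_of_quadratic)
      fix t :: real
      show "0 \<le> t * (\<integral>x. (u x - f x) * k \<partial>L) + t\<^sup>2 * (1 / 2 * (\<integral>x. k * k \<partial>L))"
        using variation[OF c(1)[of k] z0, of t] by (simp add: residual_measure_def c(2) ld0)
    qed
    then have "0 \<le> (\<integral>x. u x - f x \<partial>L) * k" for k by simp
    from this[of 1] this[of "-1"] show ?thesis by linarith
  qed
  have by_parts: "(\<integral>x. (u x - f x) * v x \<partial>L) = - ?S (distr_deriv \<Omega> v) \<Phi>" if "v \<in> BV \<Omega>" for v
    unfolding \<Phi> by (rule BV_integral_by_parts(2)[OF that hi zero])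
  \<comment> \<open>With \<open>w\<close> kept fixed, \<open>u\<close> moves by the distribution
    function of \<open>\<kappa>\<close>, so the residual moves by exactly
    \<open>\<kappa>\<close>.\<close>
  have measure_variation: "0 \<le> t * (- ?S \<kappa> \<Phi>) + t\<^sup>2 * (1 / 2 * (\<integral>x. (0 + cumul \<kappa> x) * (0 + cumul \<kappa> x) \<partial>L))
      + \<alpha> * (Radon_norm \<Omega> (\<lambda>A. 1 * ?R u w A + t * \<kappa> A) - Radon_norm \<Omega> (?R u w))"
    if \<kappa>: "signed_measure (borel_on \<Omega>) \<kappa>" for \<kappa> t
  proof -
    note c = cumul_BV[OF \<kappa>, of 0]
    have R: "?R (\<lambda>x. 0 + cumul \<kappa> x) (\<lambda>_. 0) = \<kappa>"
      unfolding residual_measure_def c(2) ld0 by simp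
    have S: "(\<integral>x. (u x - f x) * (0 + cumul \<kappa> x) \<partial>L) = - ?S \<kappa> \<Phi>"
      using by_parts[OF c(1)] unfolding c(2) .
    have "Lp_norm L p (\<lambda>x. 1 * w x + t * 0) = Lp_norm L p w" by simp
    then show ?thesis
      using variation[OF c(1) z0, of t] unfolding R S by simp
  qed
  have dual: "?S \<kappa> \<Phi> \<le> \<alpha> * Radon_norm \<Omega> \<kappa>" if \<kappa>: "signed_measure (borel_on \<Omega>) \<kappa>" for \<kappa>
  proof -
    have "0 \<le> \<alpha> * Radon_norm \<Omega> \<kappa> - ?S \<kappa> \<Phi>"
    proof (rule nonneg_of_quadratic)
      fix t :: real assume t: "0 < t" "t < 1"
      have "Radon_norm \<Omega> (\<lambda>A. 1 * ?R u w A + t * \<kappa> A) - Radon_norm \<Omega> (?R u w) \<le> t * Radon_norm \<Omega> \<kappa>"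
        using Radon_norm_linear_le[OF \<nu> \<kappa>, of 1 t] t by simp
      then have "\<alpha> * (Radon_norm \<Omega> (\<lambda>A. 1 * ?R u w A + t * \<kappa> A) - Radon_norm \<Omega> (?R u w)) \<le> \<alpha> * (t * Radon_norm \<Omega> \<kappa>)"
        using \<alpha> by (intro mult_left_mono) auto
      with measure_variation[OF \<kappa>, of t]
      show "0 \<le> t * (\<alpha> * Radon_norm \<Omega> \<kappa> - ?S \<kappa> \<Phi>) + t\<^sup>2 * (1 / 2 * (\<integral>x. (0 + cumul \<kappa> x) * (0 + cumul \<kappa> x) \<partial>L))"
        by (simp only: right_diff_distrib mult.left_commute[of t \<alpha>])
    qed
    then show ?thesis by simp
  qed
  show le: "\<bar>\<Phi> x\<bar> \<le> \<alpha>" if x: "x \<in> \<Omega>" for x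
  proof -
    \<comment> \<open>Point masses test \<open>\<Phi>\<close> at each single point with norm at most
      1, and both signs give the absolute value.\<close>
    let ?\<delta> = "point_mass (borel_on \<Omega>) x"
    note sm = signed_measure_point_mass[of "borel_on \<Omega>" x]
    have R: "Radon_norm \<Omega> ?\<delta> \<le> 1"
      using total_variation_point_mass[of "borel_on \<Omega>" x] by (simp add: Radon_norm_def)
    have S: "?S ?\<delta> \<Phi> = \<Phi> x" by (rule signed_integral_point_mass[OF \<Phi>b]) (use x in simp)
    have "s * \<Phi> x \<le> \<alpha>" if s: "\<bar>s\<bar> = 1" for s
    proof -
      \<comment> \<open>The dummy term with coefficient 0 lets the two-measure lemmas handle a
        scalar multiple.\<close>
      have "s * \<Phi> x = ?S (\<lambda>A. s * ?\<delta> A + 0 * ?\<delta> A) \<Phi>"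
        unfolding signed_integral_linear[OF sm sm \<Phi>b] S by simp
      also have "\<dots> \<le> \<alpha> * Radon_norm \<Omega> (\<lambda>A. s * ?\<delta> A + 0 * ?\<delta> A)"
        by (rule dual[OF signed_measure_linear[OF sm sm]])
      also have "\<dots> \<le> \<alpha> * 1"
        using Radon_norm_linear_le[OF sm sm, of s 0] R s \<alpha> by (intro mult_left_mono) auto
      finally show ?thesis by simp
    qed
    from this[of 1] this[of "-1"] show ?thesis by (simp add: abs_le_iff)
  qed
  show "?S (?R u w) \<Phi> = \<alpha> * Radon_norm \<Omega> (?R u w)"
  proof (rule antisym[OF dual[OF \<nu>]])
    \<comment> \<open>Moving backwards along the residual itself shrinks it by \<open>1 - t\<close>;
      its norm then decreases proportionally, which reverses the dual inequality.\<close>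
    have "0 \<le> ?S (?R u w) \<Phi> - \<alpha> * Radon_norm \<Omega> (?R u w)"
    proof (rule nonneg_of_quadratic)
      fix t :: real assume t: "0 < t" "t < 1"
      have "Radon_norm \<Omega> (\<lambda>A. (1 - t) * ?R u w A + 0 * ?R u w A) \<le> (1 - t) * Radon_norm \<Omega> (?R u w)"
        using Radon_norm_linear_le[OF \<nu> \<nu>, of "1 - t" 0] t by simp
      moreover have "(\<lambda>A. (1 - t) * ?R u w A + 0 * ?R u w A) = (\<lambda>A. 1 * ?R u w A + (- t) * ?R u w A)"
        by (simp add: fun_eq_iff left_diff_distrib)
      ultimately have "Radon_norm \<Omega> (\<lambda>A. 1 * ?R u w A + (- t) * ?R u w A) - Radon_norm \<Omega> (?R u w) \<le> - (t * Radon_norm \<Omega> (?R u w))"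
        by (simp add: left_diff_distrib)
      then have "\<alpha> * (Radon_norm \<Omega> (\<lambda>A. 1 * ?R u w A + (- t) * ?R u w A) - Radon_norm \<Omega> (?R u w)) \<le> \<alpha> * (- (t * Radon_norm \<Omega> (?R u w)))"
        using \<alpha> by (intro mult_left_mono) auto
      also have "\<dots> = - (t * (\<alpha> * Radon_norm \<Omega> (?R u w)))" by simp
      finally have le: "\<alpha> * (Radon_norm \<Omega> (\<lambda>A. 1 * ?R u w A + (- t) * ?R u w A) - Radon_norm \<Omega> (?R u w)) \<le> - (t * (\<alpha> * Radon_norm \<Omega> (?R u w)))" .
      have "(- t) * (- ?S (?R u w) \<Phi>) = t * ?S (?R u w) \<Phi>" "(- t)\<^sup>2 = t\<^sup>2" by auto
      with measure_variation[OF \<nu>, of "- t"] le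
      show "0 \<le> t * (?S (?R u w) \<Phi> - \<alpha> * Radon_norm \<Omega> (?R u w)) + t\<^sup>2 * (1 / 2 * (\<integral>x. (0 + cumul (?R u w) x) * (0 + cumul (?R u w) x) \<partial>L))"
        by (simp only: right_diff_distrib)
    qed
    then show "\<alpha> * Radon_norm \<Omega> (?R u w) \<le> ?S (?R u w) \<Phi>" by simp
  qed
  \<comment> \<open>Now \<open>w\<close> moves by \<open>z\<close> and \<open>u\<close> by the
    distribution function of the density of \<open>z\<close>. Both contributions cancel in the
    residual, and its norm drops out of the comparison.\<close>
  have density_variation: "0 \<le> t * (- (\<integral>x. \<Phi> x * z x \<partial>L))
      + t\<^sup>2 * (1 / 2 * (\<integral>x. (0 + cumul (lebesgue_density \<Omega> z) x) * (0 + cumul (lebesgue_density \<Omega> z) x) \<partial>L))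
      + \<beta> * (Lp_norm L p (\<lambda>x. 1 * w x + t * z x) - Lp_norm L p w)"
    if z: "z \<in> Lp L p" for z t
  proof -
    have zi: "integrable L z" by (rule Lp_integrable(1)[OF p z])
    note c = cumul_BV[OF signed_measure_lebesgue_density[OF zi], of 0]
    have R: "?R (\<lambda>x. 0 + cumul (lebesgue_density \<Omega> z) x) z = (\<lambda>_. 0)"
      unfolding residual_measure_def c(2) by simp
    have S: "(\<integral>x. (u x - f x) * (0 + cumul (lebesgue_density \<Omega> z) x) \<partial>L) = - (\<integral>x. \<Phi> x * z x \<partial>L)"
      using by_parts[OF c(1)] unfolding c(2) signed_integral_lebesgue_density[OF zi \<Phi>b] .
    have e: "(\<lambda>A. 1 * ?R u w A + t * 0) = ?R u w" by simp
    show ?thesis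
      using variation[OF c(1) z, of t] unfolding R S e by simp
  qed
  have dual_w: "(\<integral>x. \<Phi> x * z x \<partial>L) \<le> \<beta> * Lp_norm L p z" if z: "z \<in> Lp L p" for z
  proof -
    let ?C = "1 / 2 * (\<integral>x. (0 + cumul (lebesgue_density \<Omega> z) x) * (0 + cumul (lebesgue_density \<Omega> z) x) \<partial>L)"
    have "0 \<le> \<beta> * Lp_norm L p z - (\<integral>x. \<Phi> x * z x \<partial>L)"
    proof (rule nonneg_of_quadratic)
      fix t :: real assume t: "0 < t" "t < 1"
      have "Lp_norm L p (\<lambda>x. 1 * w x + t * z x) \<le> Lp_norm L p (\<lambda>x. 1 * w x) + Lp_norm L p (\<lambda>x. t * z x)"
        by (rule Lp_norm_triangle[OF p1 Lp_cmult[OF w] Lp_cmult[OF z]])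
      then have "Lp_norm L p (\<lambda>x. 1 * w x + t * z x) - Lp_norm L p w \<le> t * Lp_norm L p z"
        using t unfolding Lp_norm_cmult[OF p0] by simp
      then have "\<beta> * (Lp_norm L p (\<lambda>x. 1 * w x + t * z x) - Lp_norm L p w) \<le> \<beta> * (t * Lp_norm L p z)"
        using \<beta> by (intro mult_left_mono) auto
      with density_variation[OF z, of t]
      show "0 \<le> t * (\<beta> * Lp_norm L p z - (\<integral>x. \<Phi> x * z x \<partial>L)) + t\<^sup>2 * ?C"
        by (simp only: right_diff_distrib mult.left_commute[of t \<beta>])
    qed
    then show ?thesis by simp
  qed
  show "Lp_norm L q \<Phi> \<le> \<beta>"
    by (rule Lp_norm_le_of_dual_bound[OF p q \<Phi>q _ dual_w]) (use \<beta> in auto)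
  show "(\<integral>x. \<Phi> x * w x \<partial>L) = \<beta> * Lp_norm L p w"
  proof (rule antisym[OF dual_w[OF w]])
    let ?C = "1 / 2 * (\<integral>x. (0 + cumul (lebesgue_density \<Omega> w) x) * (0 + cumul (lebesgue_density \<Omega> w) x) \<partial>L)"
    \<comment> \<open>As for the residual: replacing \<open>w\<close> by \<open>(1 - t) w\<close>
      scales its norm exactly and supplies the inequality opposite to \<open>dual_w\<close>.\<close>
    have "0 \<le> (\<integral>x. \<Phi> x * w x \<partial>L) - \<beta> * Lp_norm L p w"
    proof (rule nonneg_of_quadratic)
      fix t :: real assume t: "0 < t" "t < 1"
      have "(\<lambda>x. 1 * w x + (- t) * w x) = (\<lambda>x. (1 - t) * w x)"
        by (simp add: fun_eq_iff left_diff_distrib)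
      then have "Lp_norm L p (\<lambda>x. 1 * w x + (- t) * w x) = \<bar>1 - t\<bar> * Lp_norm L p w"
        by (simp only: Lp_norm_cmult[OF p0])
      then have "Lp_norm L p (\<lambda>x. 1 * w x + (- t) * w x) - Lp_norm L p w = - (t * Lp_norm L p w)"
        using t by (simp add: left_diff_distrib)
      then have eq: "\<beta> * (Lp_norm L p (\<lambda>x. 1 * w x + (- t) * w x) - Lp_norm L p w) = - (t * (\<beta> * Lp_norm L p w))"
        by (simp only: mult_minus_right mult.left_commute)
      have "(- t) * (- (\<integral>x. \<Phi> x * w x \<partial>L)) = t * (\<integral>x. \<Phi> x * w x \<partial>L)" "(- t)\<^sup>2 = t\<^sup>2" by auto
      with density_variation[OF w, of "- t"] eq
      show "0 \<le> t * ((\<integral>x. \<Phi> x * w x \<partial>L) - \<beta> * Lp_norm L p w) + t\<^sup>2 * ?C"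
        by (simp only: right_diff_distrib)
    qed
    then show "\<beta> * Lp_norm L p w \<le> (\<integral>x. \<Phi> x * w x \<partial>L)" by simp
  qed
qed

end

text \<open>Elements of \<open>H01\<close> are functions here, so the continuous representative is
  imposed by \<open>continuous_on\<close>; \<open>Sgn\<close> looks at its values at atoms. The
  derivative is encoded weakly, and \<open>w = 0\<close> as equality almost everywhere.\<close>

theorem theorem4p4:
  fixes a b p q \<alpha> \<beta> :: real and \<Omega> :: "real set" and f w u :: "real \<Rightarrow> real"
  assumes "a < b" and "\<Omega> = {a<..<b}"
    and "1 < p" and "q = p / (p - 1)"
    and "0 < \<alpha>" and "0 < \<beta>"
    and "f \<in> Lp (lebesgue_on \<Omega>) 2"
    and "w \<in> Lp (lebesgue_on \<Omega>) p" and "u \<in> BV \<Omega>"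
  shows "is_solution \<Omega> p \<alpha> \<beta> f (w, u) \<longleftrightarrow>
    (\<exists>\<phi> \<in> H01 \<Omega>. continuous_on \<Omega> \<phi> \<and>
       has_weak_derivative \<Omega> \<phi> (\<lambda>x. u x - f x) \<and>
       \<phi> \<in> (\<lambda>v x. \<alpha> * v x) ` Sgn \<Omega> (residual_measure \<Omega> u w) \<and>
       (if AE x in lebesgue_on \<Omega>. w x = 0
        then \<phi> \<in> Lp (lebesgue_on \<Omega>) q \<and> Lp_norm (lebesgue_on \<Omega>) q \<phi> \<le> \<beta>
        else AE x in lebesgue_on \<Omega>.
               \<phi> x = \<beta> * (\<bar>w x\<bar> powr (p - 2) * w x) / Lp_norm (lebesgue_on \<Omega>) p w powr (p - 1)))"
proof -
  interpret bounded_interval a b by standard (rule assms(1))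
  note \<Omega> = assms(2) and p = assms(3) and q = assms(4) and \<alpha> = assms(5) and \<beta> = assms(6)
  let ?L = "lebesgue_on {a<..<b}"
  have f: "f \<in> Lp ?L 2" and w: "w \<in> Lp ?L p" and u: "u \<in> BV {a<..<b}"
    using assms(7-9) by (simp_all add: \<Omega>)
  define \<Phi> where "\<Phi> = primitive (\<lambda>x. u x - f x)"
  define \<nu> where "\<nu> = residual_measure {a<..<b} u w"
  have p0: "0 < p" and q0: "0 < q" using p conj_exponent(1)[OF p q] by auto
  have h: "(\<lambda>x. u x - f x) \<in> Lp ?L 2" by (rule Lp_diff[OF _ BV_Lp[OF _ u] f]) auto
  have hi: "integrable ?L (\<lambda>x. u x - f x)" by (rule Lp_integrable(1)[OF _ h]) simp
  have cont: "continuous_on UNIV \<Phi>" unfolding \<Phi>_def by (rule continuous_primitive[OF hi])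
  have \<Phi>b: "\<Phi> \<in> bounded_measurable (borel_on {a<..<b})"
    by (rule bounded_measurable_continuous[OF cont])
  have \<Phi>q: "\<Phi> \<in> Lp ?L q"
    by (rule bounded_measurable_Lp[OF q0 bounded_measurable_lebesgue_on[OF \<Phi>b]])
  have \<nu>: "signed_measure (borel_on {a<..<b}) \<nu>"
    unfolding \<nu>_def by (rule signed_measure_residual[OF u Lp_integrable(1)[OF p w]])
  \<comment> \<open>Ties the case distinction of the statement to the norm, which must be positive
    for the quotient formula.\<close>
  have W: "(AE x in ?L. w x = 0) \<longleftrightarrow> Lp_norm ?L p w = 0"
    using Lp_norm_eq_0_iff[OF p0 w] by simp
  have Wpos: "0 < Lp_norm ?L p w" if "\<not> (AE x in ?L. w x = 0)"
    using that W Lp_norm_nonneg[of ?L p w] by linarith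
  show ?thesis
    unfolding \<Omega> \<nu>_def[symmetric]
  proof
    assume sol: "is_solution {a<..<b} p \<alpha> \<beta> f (w, u)"
    note nec = optimality_necessary[OF p q \<alpha> \<beta> f w u sol \<Phi>_def, folded \<nu>_def]
    show "\<exists>\<phi> \<in> H01 {a<..<b}. continuous_on {a<..<b} \<phi> \<and>
       has_weak_derivative {a<..<b} \<phi> (\<lambda>x. u x - f x) \<and>
       \<phi> \<in> (\<lambda>v x. \<alpha> * v x) ` Sgn {a<..<b} \<nu> \<and>
       (if AE x in ?L. w x = 0
        then \<phi> \<in> Lp ?L q \<and> Lp_norm ?L q \<phi> \<le> \<beta>
        else AE x in ?L. \<phi> x = \<beta> * (\<bar>w x\<bar> powr (p - 2) * w x) / Lp_norm ?L p w powr (p - 1))"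
    proof (intro bexI[of _ \<Phi>] conjI)
      show "\<Phi> \<in> H01 {a<..<b}" unfolding \<Phi>_def by (rule primitive_in_H01[OF h nec(1)])
      show "continuous_on {a<..<b} \<Phi>" by (rule continuous_on_subset[OF cont]) simp
      show "has_weak_derivative {a<..<b} \<Phi> (\<lambda>x. u x - f x)"
        unfolding \<Phi>_def by (rule primitive_has_weak_derivative[OF hi])
      show "\<Phi> \<in> (\<lambda>v x. \<alpha> * v x) ` Sgn {a<..<b} \<nu>"
        by (rule SgnI[OF cont \<alpha> nec(2) AE_eq_sgn_measure[OF \<nu> \<Phi>b nec(2,3)]])
      show "if AE x in ?L. w x = 0 then \<Phi> \<in> Lp ?L q \<and> Lp_norm ?L q \<Phi> \<le> \<beta>
        else AE x in ?L. \<Phi> x = \<beta> * (\<bar>w x\<bar> powr (p - 2) * w x) / Lp_norm ?L p w powr (p - 1)"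
        using \<Phi>q nec(4) Holder_equality[OF p q \<Phi>q nec(4) \<beta> w Wpos nec(5)] by simp
    qed
  next
    assume "\<exists>\<phi> \<in> H01 {a<..<b}. continuous_on {a<..<b} \<phi> \<and>
       has_weak_derivative {a<..<b} \<phi> (\<lambda>x. u x - f x) \<and>
       \<phi> \<in> (\<lambda>v x. \<alpha> * v x) ` Sgn {a<..<b} \<nu> \<and>
       (if AE x in ?L. w x = 0
        then \<phi> \<in> Lp ?L q \<and> Lp_norm ?L q \<phi> \<le> \<beta>
        else AE x in ?L. \<phi> x = \<beta> * (\<bar>w x\<bar> powr (p - 2) * w x) / Lp_norm ?L p w powr (p - 1))"
    then obtain \<phi> where \<phi>: "\<phi> \<in> H01 {a<..<b}" "continuous_on {a<..<b} \<phi>"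
       "has_weak_derivative {a<..<b} \<phi> (\<lambda>x. u x - f x)" "\<phi> \<in> (\<lambda>v x. \<alpha> * v x) ` Sgn {a<..<b} \<nu>"
      and cases: "if AE x in ?L. w x = 0
        then \<phi> \<in> Lp ?L q \<and> Lp_norm ?L q \<phi> \<le> \<beta>
        else AE x in ?L. \<phi> x = \<beta> * (\<bar>w x\<bar> powr (p - 2) * w x) / Lp_norm ?L p w powr (p - 1)"
      by blast
    note prim = H01_eq_primitive[OF \<phi>(1-3) h, folded \<Phi>_def]
    have eq: "AE x in ?L. \<phi> x = \<Phi> x" by (rule AE_I2) (simp add: prim(2))
    have le: "\<bar>\<Phi> x\<bar> \<le> \<alpha>" if x: "x \<in> {a<..<b}" for x
    proof -
      have "continuous_on {a<..<b} (\<lambda>x. \<bar>\<phi> x\<bar>)" by (intro continuous_intros \<phi>(2))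
      from AE_le_continuous[OF this SgnD(1)[OF \<phi>(4) \<alpha>] x] show ?thesis by (simp add: prim(2)[OF x])
    qed
    \<comment> \<open>Agreement of \<open>\<phi>\<close> and \<open>\<Phi>\<close> Lebesgue-a.e.
      would not be enough here, as \<open>\<nu>\<close> may be singular; they agree at every point
      of \<open>\<Omega>\<close>.\<close>
    have ae: "AE x in total_variation (borel_on {a<..<b}) \<nu>. \<Phi> x = \<alpha> * sgn_measure (borel_on {a<..<b}) \<nu> x"
      using SgnD(2)[OF \<phi>(4) \<alpha>] AE_space by eventually_elim (simp add: prim(2))
    have \<phi>m: "\<phi> \<in> borel_measurable ?L" using \<phi>(1) by (simp add: H01_def Lp_def)
    have "Lp_norm ?L q \<Phi> \<le> \<beta> \<and> (\<integral>x. \<Phi> x * w x \<partial>?L) = \<beta> * Lp_norm ?L p w"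
    proof (cases "AE x in ?L. w x = 0")
      case True
      have "Lp_norm ?L q \<Phi> = Lp_norm ?L q \<phi>"
        by (rule Lp_norm_cong_AE[OF _ LpD(1)[OF \<Phi>q] \<phi>m]) (use eq in \<open>auto elim: eventually_mono\<close>)
      moreover have "(\<integral>x. \<Phi> x * w x \<partial>?L) = (\<integral>x. 0 \<partial>?L)"
      proof (rule integral_cong_AE)
        show "(\<lambda>x. \<Phi> x * w x) \<in> borel_measurable ?L"
          by (rule borel_measurable_times[OF LpD(1)[OF \<Phi>q] LpD(1)[OF w]])
        show "AE x in ?L. \<Phi> x * w x = 0" using True by eventually_elim simp
      qed simp
      ultimately show ?thesis using cases True W by simp
    next
      case False
      have "AE x in ?L. \<phi> x = \<beta> * (\<bar>w x\<bar> powr (p - 2) * w x) / Lp_norm ?L p w powr (p - 1)"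
        using cases False by simp
      with eq have "AE x in ?L. \<Phi> x = \<beta> * (\<bar>w x\<bar> powr (p - 2) * w x) / Lp_norm ?L p w powr (p - 1)"
        by eventually_elim simp
      from extremal_dual_function[OF p q w Wpos[OF False] \<beta> LpD(1)[OF \<Phi>q] this] show ?thesis by simp
    qed
    then show "is_solution {a<..<b} p \<alpha> \<beta> f (w, u)"
      using optimality_sufficient[OF p q \<alpha> f w u prim(1) \<Phi>_def le ae[unfolded \<nu>_def]] by blast
  qed
qed

end
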